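(* (i) For every $\alpha>0$ and every $u\in W^{2,2}(\mathbb{R}^4)$, $$\int_{\mathbb{R}^4}\left(e^{\alpha u^2}-1\right)dx<\infty.$$ (ii) For all constants $\tau>0$ and $\sigma>0$, $$\sup\left\{\int_{\mathbb{R}^4}\left(e^{32\pi^2 u^2}-1\right)dx:\ u\in W^{2,2}(\mathbb{R}^4),\ \int_{\mathbb{R}^4}\left(|\Delta u|^2+\tau|\nabla u|^2+\sigma u^2\right)dx\le 1\right\}<\infty.$$ (iii) The constant $32\pi^2$ in (ii) is sharp: if $32\pi^2$ is replaced by any $\alpha>32\pi^2$, the supremum is $+\infty$.
   Context: $W^{2,2}(\mathbb{R}^4)$ is the usual Sobolev space of functions on $\mathbb{R}^4$ with square-integrable derivatives up to order two. *)

theory Defs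
  imports "HOL-Analysis.Analysis"
begin

definition partial :: "'a::euclidean_space \<Rightarrow> ('a \<Rightarrow> real) \<Rightarrow> ('a \<Rightarrow> real)" where
  "partial v f = (\<lambda>x. deriv (\<lambda>t. f (x + t *\<^sub>R v)) 0)"

definition Cinf :: "('a::euclidean_space \<Rightarrow> real) \<Rightarrow> bool" where
  "Cinf f \<longleftrightarrow> (\<forall>vs. set vs \<subseteq> Basis \<longrightarrow>
      continuous_on UNIV (foldr partial vs f) \<and>
      (\<forall>v\<in>Basis. \<forall>x. (\<lambda>t. foldr partial vs f (x + t *\<^sub>R v)) differentiable (at 0)))"

definition test_fun :: "('a::euclidean_space \<Rightarrow> real) \<Rightarrow> bool" where
  "test_fun \<phi> \<longleftrightarrow> Cinf \<phi> \<and> compact (closure {x. \<phi> x \<noteq> 0})"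

definition weak_deriv :: "'a::euclidean_space \<Rightarrow> ('a \<Rightarrow> real) \<Rightarrow> ('a \<Rightarrow> real) \<Rightarrow> bool" where
  "weak_deriv v u g \<longleftrightarrow> g \<in> borel_measurable lborel \<and>
     (\<forall>\<phi>. test_fun \<phi> \<longrightarrow>
        integrable lborel (\<lambda>x. g x * \<phi> x) \<and>
        integrable lborel (\<lambda>x. u x * partial v \<phi> x) \<and>
        (\<integral>x. u x * partial v \<phi> x \<partial>lborel) = - (\<integral>x. g x * \<phi> x \<partial>lborel))"

definition L2 :: "('a::euclidean_space \<Rightarrow> real) \<Rightarrow> bool" where
  "L2 u \<longleftrightarrow> u \<in> borel_measurable lborel \<and> integrable lborel (\<lambda>x. (u x)\<^sup>2)"

definition W22 :: "('a::euclidean_space \<Rightarrow> real) set" where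
  "W22 = {u. L2 u \<and> (\<forall>i\<in>Basis. \<exists>g. weak_deriv i u g \<and> L2 g \<and>
              (\<forall>j\<in>Basis. \<exists>h. weak_deriv j g h \<and> L2 h))}"

text \<open>A chosen weak partial derivative (unique a.e.).\<close>
definition wpartial :: "'a::euclidean_space \<Rightarrow> ('a \<Rightarrow> real) \<Rightarrow> ('a \<Rightarrow> real)" where
  "wpartial v u = (SOME g. weak_deriv v u g)"

definition wlap :: "('a::euclidean_space \<Rightarrow> real) \<Rightarrow> ('a \<Rightarrow> real)" where
  "wlap u = (\<lambda>x. \<Sum>b\<in>Basis. wpartial b (wpartial b u) x)"

definition grad_sq :: "('a::euclidean_space \<Rightarrow> real) \<Rightarrow> ('a \<Rightarrow> real)" where
  "grad_sq u = (\<lambda>x. \<Sum>b\<in>Basis. (wpartial b u x)\<^sup>2)"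

definition energy :: "real \<Rightarrow> real \<Rightarrow> ('a::euclidean_space \<Rightarrow> real) \<Rightarrow> real" where
  "energy \<tau> \<sigma> u = (\<integral>x. (wlap u x)\<^sup>2 + \<tau> * grad_sq u x + \<sigma> * (u x)\<^sup>2 \<partial>lborel)"

definition exp_int :: "real \<Rightarrow> ('a::euclidean_space \<Rightarrow> real) \<Rightarrow> ennreal" where
  "exp_int \<alpha> u = (\<integral>\<^sup>+ x. ennreal (exp (\<alpha> * (u x)\<^sup>2) - 1) \<partial>lborel)"

end

theory Submission
  imports Defs
begin

text \<open>
  Every \<open>u\<close> in \<open>W22\<close> is, up to a harmless smooth term, the convolution of its Laplacian with a
  cut-off \<open>k\<close> of the fundamental solution \<open>1 / (4 \<pi>\<^sup>2 |z|\<^sup>2)\<close>. By the Cauchy--Schwarz inequality the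
  average of \<open>u\<close> over a set \<open>E\<close> is then controlled by the norm of \<open>\<Delta>u\<close> times the norm of the averaged
  kernel \<open>k\<^sub>E\<close>, and because \<open>32 \<pi>\<^sup>2 (k * k)\<close> behaves like \<open>ln (1 / |z|\<^sup>4)\<close>, the inner products
  satisfy \<open>32 \<pi>\<^sup>2 \<langle>k\<^sub>E, k\<^sub>F\<rangle> \<le> ln (1 / |E|) + C\<close> with the sharp constant; no rearrangement is needed.

  Testing with a single superlevel set and splitting off the part of \<open>\<Delta>u\<close> that is large but has small
  norm gives (i). For (ii) one tests with the sum of two averaged kernels, belonging to the superlevel
  sets \<open>{u > s}\<close> and \<open>{u > s'}\<close> of measures \<open>e\<^sup>-\<^sup>t\<close> and \<open>e\<^sup>-\<^sup>t\<^sup>'\<close>: for \<open>s \<le> s'\<close>,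
  \<open>32 \<pi>\<^sup>2 (s + s')\<^sup>2 \<le> 3 t + t' + C\<close>. Hence \<open>t - 32 \<pi>\<^sup>2 s\<^sup>2\<close> can be small only in a bounded range of
  \<open>32 \<pi>\<^sup>2 s\<^sup>2\<close>, which makes the layer-cake sum at the critical exponent converge. Sharpness (iii) is seen
  on multiples of cut-offs of \<open>- ln (|x|\<^sup>2 + e\<^sup>2)\<close> as \<open>e \<rightarrow> 0\<close>.
\<close>

section \<open>Smooth functions\<close>

text \<open>One superlevel set alone loses the critical case: it bounds 32 pi^2 s^2 - t from above,
  so each term \<open>exp j * m j\<close> of the layer-cake sum is bounded, which does not make the
  sum converge. Testing with two averaged kernels gains because <k_E, k_F> is controlled by the
  larger of the two sets: the cross term costs 2 t instead of 2 sqrt (t t').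

  The second obstacle is the error left by the cut-off. It is of the size of the norm of u, and
  expanding (error + sqrt Q)^2 directly leaves a cross term of order sqrt t. Since the energy bounds
  |Delta u|^2 + sigma u^2 jointly by 1, a Cauchy-Schwarz inequality in the plane, with the error
  weighted by sigma, turns it into an additive constant and keeps the factor of t equal to one.

  The constant comes from the square of 1 / (4 pi^2 |z|^2): its integral over r < |z| < 1 is 2 pi^2
  ln (1 / r) / (16 pi^4) = ln (1 / r^4) / (32 pi^2), and r^4 is the measure of the set.\<close>

lemma Cinf_foldr: "Cinf f \<Longrightarrow> set vs \<subseteq> Basis \<Longrightarrow> Cinf (foldr partial vs f)"
  unfolding Cinf_def by (metis foldr_append le_sup_iff set_append)

lemma Cinf_continuous: "Cinf f \<Longrightarrow> continuous_on S f"
  unfolding Cinf_def by (metis (no_types) continuous_on_subset empty_subsetI foldr_Nil id_apply list.set(1) subset_UNIV)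

lemma Cinf_partial: "Cinf f \<Longrightarrow> v \<in> Basis \<Longrightarrow> Cinf (partial v f)"
  using Cinf_foldr[of f "[v]"] by simp

lemma Cinf_differentiable:
  "Cinf f \<Longrightarrow> v \<in> Basis \<Longrightarrow> (\<lambda>t. f (x + t *\<^sub>R v)) differentiable (at 0)"
  unfolding Cinf_def by (metis empty_subsetI foldr_Nil id_apply list.set(1))

lemma partial_eqI:
  "((\<lambda>t. f (x + t *\<^sub>R v)) has_real_derivative d) (at 0) \<Longrightarrow> partial v f x = d"
  unfolding partial_def by (rule DERIV_imp_deriv)

lemma has_partial:
  assumes "(\<lambda>t. f (x + t *\<^sub>R v)) differentiable (at 0)"
  shows "((\<lambda>t. f (x + t *\<^sub>R v)) has_real_derivative partial v f x) (at 0)"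
  using assms by (simp add: partial_def DERIV_deriv_iff_real_differentiable)

lemma Cinf_has_partial:
  assumes "Cinf f" "v \<in> Basis"
  shows "((\<lambda>t. f (x + t *\<^sub>R v)) has_real_derivative partial v f (x + t *\<^sub>R v)) (at t)"
proof -
  have "((\<lambda>s. f ((x + t *\<^sub>R v) + s *\<^sub>R v)) has_real_derivative partial v f (x + t *\<^sub>R v)) (at 0)"
    by (intro has_partial Cinf_differentiable assms)
  then have "((\<lambda>s. f (x + (s + t) *\<^sub>R v)) has_real_derivative partial v f (x + t *\<^sub>R v)) (at 0)"
    by (simp add: scaleR_add_left add_ac)
  then show ?thesis
    using DERIV_shift[of "\<lambda>s. f (x + s *\<^sub>R v)" "partial v f (x + t *\<^sub>R v)" 0 t] by simp
qed

text \<open>Closing under sums and products is what the sum and product rules ask for. Constants and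
  negatives are not built in; a generating set supplies them, usually by containing all smooth
  functions.\<close>

inductive_set ring_gen :: "('a::euclidean_space \<Rightarrow> real) set \<Rightarrow> ('a \<Rightarrow> real) set" for S where
  gen: "f \<in> S \<Longrightarrow> f \<in> ring_gen S"
| plus: "f \<in> ring_gen S \<Longrightarrow> g \<in> ring_gen S \<Longrightarrow> (\<lambda>x. f x + g x) \<in> ring_gen S"
| times: "f \<in> ring_gen S \<Longrightarrow> g \<in> ring_gen S \<Longrightarrow> (\<lambda>x. f x * g x) \<in> ring_gen S"

lemma partial_plus:
  assumes "(\<lambda>t. f (x + t *\<^sub>R v)) differentiable (at 0)" "(\<lambda>t. g (x + t *\<^sub>R v)) differentiable (at 0)"
  shows "partial v (\<lambda>x. f x + g x) x = partial v f x + partial v g x"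
  by (intro partial_eqI DERIV_add has_partial assms)

lemma partial_times:
  assumes "(\<lambda>t. f (x + t *\<^sub>R v)) differentiable (at 0)" "(\<lambda>t. g (x + t *\<^sub>R v)) differentiable (at 0)"
  shows "partial v (\<lambda>x. f x * g x) x = partial v f x * g x + partial v g x * f x"
  using DERIV_mult[OF has_partial[OF assms(1)] has_partial[OF assms(2)]]
  by (intro partial_eqI) simp

text \<open>Smoothness speaks about all iterated partials, so it is proved coinductively: by the sum
  and product rules the ring generated by \<open>S\<close> is closed under \<open>partial\<close> as
  soon as it contains the partials of the generators. Formulas for higher derivatives never
  appear.\<close>

lemma Cinf_coinduct:
  assumes S: "\<And>f. f \<in> S \<Longrightarrow> continuous_on UNIV f"
    "\<And>f v x. f \<in> S \<Longrightarrow> v \<in> Basis \<Longrightarrow> (\<lambda>t. f (x + t *\<^sub>R v)) differentiable (at 0)"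
    "\<And>f v. f \<in> S \<Longrightarrow> v \<in> Basis \<Longrightarrow> partial v f \<in> ring_gen S"
    and f: "f \<in> ring_gen S"
  shows "Cinf f"
proof -
  have *: "continuous_on UNIV g \<and> (\<forall>v\<in>Basis. (\<forall>x. (\<lambda>t. g (x + t *\<^sub>R v)) differentiable (at 0)) \<and>
             partial v g \<in> ring_gen S)" if "g \<in> ring_gen S" for g
    using that
  proof induction
    case (gen f)
    then show ?case using S by blast
  next
    case (plus f g)
    have "partial v (\<lambda>x. f x + g x) = (\<lambda>x. partial v f x + partial v g x)" if "v \<in> Basis" for v
      using plus.IH that by (auto intro!: partial_plus)
    then show ?case
      using plus by (auto intro!: continuous_intros ring_gen.plus)
  next
    case (times f g)
    have "partial v (\<lambda>x. f x * g x) = (\<lambda>x. partial v f x * g x + partial v g x * f x)" if "v \<in> Basis" for v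
      using times.IH that by (auto intro!: partial_times)
    then show ?case
      using times by (auto intro!: continuous_intros ring_gen.plus ring_gen.times differentiable_mult)
  qed
  have "foldr partial vs f \<in> ring_gen S" if "set vs \<subseteq> Basis" for vs
    using that by (induction vs) (use f * in auto)
  then show ?thesis
    unfolding Cinf_def using * by blast
qed

lemma Cinf_I:
  assumes "continuous_on UNIV f" "\<And>v x. v \<in> Basis \<Longrightarrow> (\<lambda>t. f (x + t *\<^sub>R v)) differentiable (at 0)"
    "\<And>v. v \<in> Basis \<Longrightarrow> Cinf (partial v f)"
  shows "Cinf f"
proof (rule Cinf_coinduct[where S = "insert f {g. Cinf g}"])
  show "f \<in> ring_gen (insert f {g. Cinf g})" by (auto intro: ring_gen.gen)
  show "\<And>g. g \<in> insert f {g. Cinf g} \<Longrightarrow> continuous_on UNIV g"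
    by (elim insertE) (simp_all add: assms(1) Cinf_continuous)
  show "\<And>g v x. g \<in> insert f {g. Cinf g} \<Longrightarrow> v \<in> Basis \<Longrightarrow> (\<lambda>t. g (x + t *\<^sub>R v)) differentiable at 0"
    by (elim insertE) (simp_all add: assms(2) Cinf_differentiable)
  show "\<And>g v. g \<in> insert f {g. Cinf g} \<Longrightarrow> v \<in> Basis \<Longrightarrow> partial v g \<in> ring_gen (insert f {g. Cinf g})"
    by (elim insertE) (simp_all add: assms(3) Cinf_partial ring_gen.gen)
qed

lemma ring_gen_Cinf: "f \<in> ring_gen {g. Cinf g} \<Longrightarrow> Cinf f"
  by (rule Cinf_coinduct)
    (auto intro: ring_gen.gen Cinf_continuous Cinf_differentiable Cinf_partial)

section \<open>Operations that preserve smoothness\<close>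

lemma Cinf_plus: "Cinf f \<Longrightarrow> Cinf g \<Longrightarrow> Cinf (\<lambda>x. f x + g x)"
  and Cinf_times: "Cinf f \<Longrightarrow> Cinf g \<Longrightarrow> Cinf (\<lambda>x. f x * g x)"
  by (rule ring_gen_Cinf, (rule ring_gen.intros)+, simp, rule ring_gen.gen, simp)+

lemma Cinf_const: "Cinf (\<lambda>x. c)"
proof -
  have p: "partial v (\<lambda>x. c) = (\<lambda>x. 0)" for c and v :: 'a
    by (auto intro!: partial_eqI)
  show ?thesis
    by (rule Cinf_coinduct[where S = "range (\<lambda>c x. c)"]) (auto intro: ring_gen.gen simp: p)
qed

lemma Cinf_uminus: "Cinf f \<Longrightarrow> Cinf (\<lambda>x. - f x)"
  using Cinf_times[OF Cinf_const[of "-1"], of f] by simp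

lemma Cinf_minus: "Cinf f \<Longrightarrow> Cinf g \<Longrightarrow> Cinf (\<lambda>x. f x - g x)"
  using Cinf_plus[OF _ Cinf_uminus, of f g] by simp

lemma Cinf_inner: "Cinf (\<lambda>x. (x - a) \<bullet> b)"
proof (rule Cinf_I)
  have d: "((\<lambda>t. (x + t *\<^sub>R v - a) \<bullet> b) has_real_derivative v \<bullet> b) (at 0)" for x v
    unfolding inner_simps by (rule derivative_eq_intros refl | simp)+
  show "(\<lambda>t. (x + t *\<^sub>R v - a) \<bullet> b) differentiable at 0" for x v
    using d real_differentiable_def by blast
  have "partial v (\<lambda>x. (x - a) \<bullet> b) = (\<lambda>x. v \<bullet> b)" for v
    by (intro ext partial_eqI d)
  then show "Cinf (partial v (\<lambda>x. (x - a) \<bullet> b))" for v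
    by (simp add: Cinf_const)
  show "continuous_on UNIV (\<lambda>x. (x - a) \<bullet> b)"
    by (intro continuous_intros)
qed

lemma Cinf_prod: "(\<And>i. i \<in> I \<Longrightarrow> Cinf (f i)) \<Longrightarrow> Cinf (\<lambda>x. \<Prod>i\<in>I. f i x)"
  by (induction I rule: infinite_finite_induct) (simp_all add: Cinf_times Cinf_const)

lemma Cinf_sum: "(\<And>i. i \<in> I \<Longrightarrow> Cinf (f i)) \<Longrightarrow> Cinf (\<lambda>x. \<Sum>i\<in>I. f i x)"
  by (induction I rule: infinite_finite_induct) (simp_all add: Cinf_plus Cinf_const)

lemma Cinf_power: "Cinf f \<Longrightarrow> Cinf (\<lambda>x. f x ^ n)"
  by (induction n) (simp_all add: Cinf_times Cinf_const)

lemma Cinf_inner_self: "Cinf (\<lambda>x. (x - a) \<bullet> (x - a))"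
proof -
  have "(\<lambda>x. (x - a) \<bullet> (x - a)) = (\<lambda>x. \<Sum>b\<in>Basis. ((x - a) \<bullet> b) * ((x - a) \<bullet> b))"
    by (rule ext) (rule euclidean_inner)
  then show ?thesis
    by (simp add: Cinf_sum Cinf_times Cinf_inner)
qed

lemma Cinf_inverse:
  assumes g: "Cinf g" and nz: "\<And>x. g x \<noteq> 0"
  shows "Cinf (\<lambda>x. inverse (g x))"
proof (rule Cinf_coinduct[where S = "insert (\<lambda>x. inverse (g x)) {g. Cinf g}"])
  let ?S = "insert (\<lambda>x. inverse (g x)) {g. Cinf g}"
  have d: "((\<lambda>t. inverse (g (x + t *\<^sub>R v))) has_real_derivative
      - partial v g x * (inverse (g x) * inverse (g x))) (at 0)" if "v \<in> Basis" for x v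
    using DERIV_inverse_fun[OF has_partial[OF Cinf_differentiable[OF g that]], of x] nz by (simp add: mult_ac)
  then have diff: "(\<lambda>t. inverse (g (x + t *\<^sub>R v))) differentiable at 0" if "v \<in> Basis" for x v
    using that real_differentiable_def by blast
  \<comment> \<open>The factor \<open>- partial v g\<close> is smooth and so a generator itself; its
    product with two factors \<open>1 / g\<close> stays in the ring.\<close>
  have p: "partial v (\<lambda>x. inverse (g x)) = (\<lambda>x. - partial v g x * (inverse (g x) * inverse (g x)))"
    if "v \<in> Basis" for v
    by (intro ext partial_eqI d that)
  show "\<And>f v x. f \<in> ?S \<Longrightarrow> v \<in> Basis \<Longrightarrow> (\<lambda>t. f (x + t *\<^sub>R v)) differentiable (at 0)"
    using diff by (auto intro: Cinf_differentiable)
  show "\<And>f. f \<in> ?S \<Longrightarrow> continuous_on UNIV f"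
    by (elim insertE) (simp_all add: nz Cinf_continuous g continuous_on_inverse)
  show "\<And>f v. f \<in> ?S \<Longrightarrow> v \<in> Basis \<Longrightarrow> partial v f \<in> ring_gen ?S"
  proof (elim insertE)
    fix f :: "'a \<Rightarrow> real" and v :: 'a assume v: "v \<in> Basis"
    show "partial v f \<in> ring_gen ?S" if "f = (\<lambda>x. inverse (g x))"
      unfolding that p[OF v] by (intro ring_gen.times ring_gen.gen) (simp_all add: v g Cinf_uminus Cinf_partial)
  qed (simp add: ring_gen.gen Cinf_partial)
  show "(\<lambda>x. inverse (g x)) \<in> ring_gen ?S"
    by (simp add: ring_gen.gen)
qed

lemma Cinf_ln:
  assumes g: "Cinf g" and pos: "\<And>x. g x > 0"
  shows "Cinf (\<lambda>x. ln (g x))"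
proof (rule Cinf_I)
  have d: "((\<lambda>t. ln (g (x + t *\<^sub>R v))) has_real_derivative partial v g x * inverse (g x)) (at 0)"
    if "v \<in> Basis" for x v
    using DERIV_chain2[OF DERIV_ln has_partial[OF Cinf_differentiable[OF g that, of x]]] pos
    by (simp add: mult_ac)
  then show "(\<lambda>t. ln (g (x + t *\<^sub>R v))) differentiable at 0" if "v \<in> Basis" for x v
    using that real_differentiable_def by blast
  have "partial v (\<lambda>x. ln (g x)) = (\<lambda>x. partial v g x * inverse (g x))" if "v \<in> Basis" for v
    by (intro ext partial_eqI d that)
  moreover have "g x \<noteq> 0" for x using pos[of x] by simp
  ultimately show "Cinf (partial v (\<lambda>x. ln (g x)))" if "v \<in> Basis" for v
    using that by (auto intro!: Cinf_times Cinf_inverse Cinf_partial g)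
  show "continuous_on UNIV (\<lambda>x. ln (g x))"
    using pos by (intro continuous_on_ln Cinf_continuous g) (metis less_irrefl)
qed

text \<open>The polynomial parameter makes the family closed under differentiation, which is what
  \<open>Cinf_coinduct\<close> wants. The standard flat function \<open>exp (- 1 / t)\<close> is the
  member \<open>flat 1\<close>.\<close>

definition flat :: "real poly \<Rightarrow> real \<Rightarrow> real" where
  "flat p t = (if t > 0 then poly p (1 / t) * exp (- 1 / t) else 0)"

text \<open>With \<open>s = 1 / t\<close> differentiation in \<open>t\<close> is
  \<open>- s^2\<close> times differentiation in \<open>s\<close>, so \<open>p(s) * exp (- s)\<close>
  becomes \<open>s^2 * (p - p')(s) * exp (- s)\<close>.\<close>

definition flat_deriv :: "real poly \<Rightarrow> real poly" where
  "flat_deriv p = [:0, 0, 1:] * (p - pderiv p)"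

lemma poly_exp_tendsto_0: "((\<lambda>t. poly p t * exp (- t)) \<longlongrightarrow> (0::real)) at_top"
proof (induction p)
  case (pCons a p)
  have *: "((\<lambda>t. t ^ n * poly p t * exp (- t)) \<longlongrightarrow> (0::real)) at_top" for p n
  proof -
    have "(\<lambda>t. t ^ n * poly p t * exp (- t)) = (\<lambda>t. \<Sum>i\<le>degree p. coeff p i * (t ^ (n + i) / exp t))"
      by (rule ext) (simp add: poly_altdef sum_distrib_left sum_distrib_right exp_minus field_simps power_add)
    moreover have "((\<lambda>t. \<Sum>i\<le>degree p. coeff p i * (t ^ (n + i) / exp t)) \<longlongrightarrow> (\<Sum>i\<le>degree p. coeff p i * 0)) at_top"
      by (intro tendsto_intros tendsto_power_div_exp_0)
    ultimately show ?thesis by simp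
  qed
  show ?case using *[of 0 "pCons a p"] by simp
qed simp

lemma flat_has_derivative: "(flat p has_real_derivative flat (flat_deriv p) t) (at t)"
proof -
  consider "t > 0" | "t < 0" | "t = 0" by linarith
  then show ?thesis
  proof cases
    case 1
    have "((\<lambda>t. poly p (1 / t) * exp (- 1 / t)) has_real_derivative flat (flat_deriv p) t) (at t)"
      using 1 by (auto intro!: derivative_eq_intros DERIV_chain'[where g = "poly p", OF _ poly_DERIV]
        simp: flat_def flat_deriv_def field_simps power2_eq_square)
    then show ?thesis
      by (rule has_field_derivative_transform_within_open[of _ _ _ "{0<..}"]) (use 1 in \<open>auto simp: flat_def\<close>)
  next
    case 2
    have "((\<lambda>t. 0) has_real_derivative flat (flat_deriv p) t) (at t)"
      using 2 by (simp add: flat_def)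
    then show ?thesis
      by (rule has_field_derivative_transform_within_open[of _ _ _ "{..<0}"]) (use 2 in \<open>auto simp: flat_def\<close>)
  next
    case 3
    \<comment> \<open>At 0 the difference quotient is \<open>flat p y / y\<close>; dividing by
      \<open>y\<close> multiplies the polynomial in \<open>1 / y\<close> by its variable, which is
      \<open>pCons 0 p\<close>.\<close>
    have "((\<lambda>y. poly (pCons 0 p) (1 / y) * exp (- (1 / y))) \<longlongrightarrow> 0) (at_right 0)"
      using filterlim_compose[OF poly_exp_tendsto_0[of "pCons 0 p"] filterlim_inverse_at_top_right]
      unfolding inverse_eq_divide .
    then have r: "((\<lambda>y. flat p y / y) \<longlongrightarrow> 0) (at_right 0)"
      by (rule Lim_transform_eventually)
        (auto simp: eventually_at_right_field flat_def intro!: exI[of _ 1])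
    have l: "((\<lambda>y. flat p y / y) \<longlongrightarrow> 0) (at_left 0)"
      by (rule Lim_transform_eventually[OF tendsto_const])
        (auto simp: eventually_at_left_field flat_def intro!: exI[of _ "-1"])
    have "((\<lambda>y. flat p y / y) \<longlongrightarrow> 0) (at 0)"
      using l r by (simp add: filterlim_split_at)
    then show ?thesis
      using 3 by (simp add: has_field_derivative_iff flat_def)
  qed
qed

lemma continuous_on_flat: "continuous_on S (flat p)"
  using flat_has_derivative DERIV_isCont by (metis continuous_at_imp_continuous_on)

lemma Cinf_flat:
  assumes g: "Cinf g"
  shows "Cinf (\<lambda>x. flat p (g x))"
proof (rule Cinf_coinduct[where S = "range (\<lambda>p x. flat p (g x)) \<union> {g. Cinf g}"])
  let ?S = "range (\<lambda>p x. flat p (g x)) \<union> {g. Cinf g}"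
  have d: "((\<lambda>t. flat p (g (x + t *\<^sub>R v))) has_real_derivative
      flat (flat_deriv p) (g x) * partial v g x) (at 0)" if "v \<in> Basis" for x v p
    using DERIV_chain2[OF flat_has_derivative has_partial[OF Cinf_differentiable[OF g that, of x]]] by simp
  then have diff: "(\<lambda>t. flat p (g (x + t *\<^sub>R v))) differentiable at 0" if "v \<in> Basis" for x v p
    using that real_differentiable_def by blast
  have p: "partial v (\<lambda>x. flat p (g x)) = (\<lambda>x. flat (flat_deriv p) (g x) * partial v g x)"
    if "v \<in> Basis" for v p
    by (intro ext partial_eqI d that)
  show "\<And>f v x. f \<in> ?S \<Longrightarrow> v \<in> Basis \<Longrightarrow> (\<lambda>t. f (x + t *\<^sub>R v)) differentiable (at 0)"
    using diff by (auto intro: Cinf_differentiable)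
  show "\<And>f. f \<in> ?S \<Longrightarrow> continuous_on UNIV f"
    using continuous_on_compose2[OF continuous_on_flat[of UNIV] Cinf_continuous[OF g], of UNIV]
    by (auto simp: Cinf_continuous)
  show "\<And>f v. f \<in> ?S \<Longrightarrow> v \<in> Basis \<Longrightarrow> partial v f \<in> ring_gen ?S"
  proof (elim UnE rangeE)
    fix f :: "'a \<Rightarrow> real" and v :: 'a and p assume v: "v \<in> Basis"
    show "partial v f \<in> ring_gen ?S" if "f = (\<lambda>x. flat p (g x))"
      unfolding that p[OF v] by (intro ring_gen.times ring_gen.gen) (simp_all add: v g Cinf_partial)
  qed (simp add: ring_gen.gen Cinf_partial)
  show "(\<lambda>x. flat p (g x)) \<in> ring_gen ?S"
    by (simp add: ring_gen.gen)
qed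

section \<open>Weak derivatives\<close>

lemma test_funI:
  assumes "Cinf \<phi>" "compact K" "\<And>x. \<phi> x \<noteq> 0 \<Longrightarrow> x \<in> K"
  shows "test_fun \<phi>"
  unfolding test_fun_def
proof
  have "closure {x. \<phi> x \<noteq> 0} \<subseteq> K"
    using assms by (intro closure_minimal) (auto intro: compact_imp_closed)
  then show "compact (closure {x. \<phi> x \<noteq> 0})"
    using closed_Int_compact[OF closed_closure assms(2), of "{x. \<phi> x \<noteq> 0}"] by (simp add: Int_absorb2)
qed fact

lemma test_fun_Cinf: "test_fun \<phi> \<Longrightarrow> Cinf \<phi>"
  by (simp add: test_fun_def)

lemma test_fun_times: "test_fun \<phi> \<Longrightarrow> Cinf f \<Longrightarrow> test_fun (\<lambda>x. f x * \<phi> x)"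
  using closure_subset[of "{x. \<phi> x \<noteq> 0}"]
  by (intro test_funI[of _ "closure {x. \<phi> x \<noteq> 0}"] Cinf_times) (auto simp: test_fun_def)

lemma test_fun_partial:
  assumes "test_fun \<phi>" "v \<in> Basis"
  shows "test_fun (partial v \<phi>)"
proof (rule test_funI[of _ "closure {x. \<phi> x \<noteq> 0}"])
  fix x assume nz: "partial v \<phi> x \<noteq> 0"
  show "x \<in> closure {x. \<phi> x \<noteq> 0}"
  proof (rule ccontr)
    assume x: "x \<notin> closure {x. \<phi> x \<noteq> 0}"
    have "open ((\<lambda>t. x + t *\<^sub>R v) -` (- closure {x. \<phi> x \<noteq> 0}))"
      by (intro open_vimage continuous_intros open_Compl closed_closure)
    moreover have "\<phi> (x + t *\<^sub>R v) = 0" if "t \<in> (\<lambda>t. x + t *\<^sub>R v) -` (- closure {x. \<phi> x \<noteq> 0})" for t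
      using that closure_subset[of "{x. \<phi> x \<noteq> 0}"] by auto
    ultimately have "((\<lambda>t. \<phi> (x + t *\<^sub>R v)) has_real_derivative 0) (at 0)"
      using x has_field_derivative_transform_within_open[of "\<lambda>_. 0" 0 0 "(\<lambda>t. x + t *\<^sub>R v) -` (- closure {x. \<phi> x \<noteq> 0})" "\<lambda>t. \<phi> (x + t *\<^sub>R v)"]
      by simp
    then have "partial v \<phi> x = 0" by (rule partial_eqI)
    with nz show False ..
  qed
qed (use assms in \<open>simp_all add: test_fun_def Cinf_partial\<close>)

lemma test_fun_measurable: "test_fun \<phi> \<Longrightarrow> \<phi> \<in> borel_measurable borel"
  by (intro borel_measurable_continuous_onI Cinf_continuous test_fun_Cinf)

lemma test_fun_integrable:
  assumes "test_fun \<phi>" shows "integrable lborel \<phi>"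
proof -
  let ?K = "closure {x. \<phi> x \<noteq> 0}"
  have "integrable lborel (\<lambda>x. indicator ?K x *\<^sub>R \<phi> x)"
    using assms by (intro borel_integrable_compact Cinf_continuous) (auto simp: test_fun_def)
  moreover have "(\<lambda>x. indicator ?K x *\<^sub>R \<phi> x) = \<phi>"
    using closure_subset[of "{x. \<phi> x \<noteq> 0}"] by (auto simp: fun_eq_iff indicator_def)
  ultimately show ?thesis by simp
qed

lemma test_fun_bounded:
  assumes "test_fun \<phi>"
  obtains B R where "B > 0" "R > 0" "\<And>x. \<bar>\<phi> x\<bar> \<le> B" "\<And>x. norm x > R \<Longrightarrow> \<phi> x = 0"
proof -
  let ?K = "closure {x. \<phi> x \<noteq> 0}"
  have K: "compact ?K" using assms by (simp add: test_fun_def)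
  have "bounded (\<phi> ` ?K)"
    using assms by (intro compact_imp_bounded compact_continuous_image Cinf_continuous test_fun_Cinf K)
  then obtain B where B: "\<And>x. x \<in> ?K \<Longrightarrow> \<bar>\<phi> x\<bar> \<le> B" "B > 0"
    by (auto simp: bounded_pos)
  obtain R where R: "\<And>x. x \<in> ?K \<Longrightarrow> norm x \<le> R" "R > 0"
    using compact_imp_bounded[OF K] by (auto simp: bounded_pos)
  have out: "\<phi> x = 0" if "x \<notin> ?K" for x
    using that closure_subset[of "{x. \<phi> x \<noteq> 0}"] by auto
  show ?thesis
  proof (rule that[OF B(2) R(2)])
    show "\<bar>\<phi> x\<bar> \<le> B" for x
      using B(1)[of x] B(2) out[of x] by (cases "x \<in> ?K") simp_all
    show "\<phi> x = 0" if "norm x > R" for x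
      using R(1)[of x] out[of x] that by (cases "x \<in> ?K") simp_all
  qed
qed

section \<open>Translation invariance and integration by parts\<close>

lemma integral_lborel_shift:
  fixes f :: "'a::euclidean_space \<Rightarrow> real"
  assumes [measurable]: "f \<in> borel_measurable borel"
  shows "(\<integral>x. f (x + a) \<partial>lborel) = (\<integral>x. f x \<partial>lborel)"
proof -
  have "(\<integral>x. f x \<partial>lborel) = (\<integral>x. f x \<partial>distr lborel borel ((+) a))"
    by (simp add: lborel_distr_plus)
  then show ?thesis by (simp add: integral_distr add.commute)
qed

lemma integrable_lborel_shift:
  fixes f :: "'a::euclidean_space \<Rightarrow> real"
  assumes "integrable lborel f"
  shows "integrable lborel (\<lambda>x. f (x + a))"
proof -
  have "integrable (distr lborel borel ((+) a)) f"
    using assms by (simp add: lborel_distr_plus)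
  then show ?thesis
    by (subst (asm) integrable_distr_eq) (use assms in \<open>auto simp: add.commute\<close>)
qed

text \<open>Difference quotients in direction \<open>v\<close> have integral 0 by translation
  invariance, and dominated convergence passes this on to the derivative.\<close>

lemma integral_partial_test_fun:
  fixes \<phi> :: "'a::euclidean_space \<Rightarrow> real"
  assumes \<phi>: "test_fun \<phi>" and v: "v \<in> Basis"
  shows "(\<integral>x. partial v \<phi> x \<partial>lborel) = 0"
proof -
  define d where "d n x = (\<phi> (x + (1 / real (Suc n)) *\<^sub>R v) - \<phi> x) * real (Suc n)" for n x
  have [measurable]: "\<phi> \<in> borel_measurable borel" "partial v \<phi> \<in> borel_measurable borel"
    using \<phi> v test_fun_partial by (auto intro: test_fun_measurable)
  obtain B where B: "B > 0" "\<And>x. \<bar>partial v \<phi> x\<bar> \<le> B"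
    using test_fun_bounded[OF test_fun_partial[OF \<phi> v]] by metis
  obtain R where R: "R > 0" "\<And>x. norm x > R \<Longrightarrow> \<phi> x = 0"
    using test_fun_bounded[OF \<phi>] by metis
  \<comment> \<open>The mean value theorem bounds the quotients by \<open>B\<close>. The shifts have
    length at most 1, which is why the dominating function lives on the ball of radius
    \<open>R + 1\<close>.\<close>
  have lim: "(\<lambda>n. \<integral>x. d n x \<partial>lborel) \<longlonglongrightarrow> (\<integral>x. partial v \<phi> x \<partial>lborel)"
  proof (rule integral_dominated_convergence[where w = "\<lambda>x. B * indicator (cball 0 (R + 1)) x"])
    show "integrable lborel (\<lambda>x::'a. B * indicator (cball 0 (R + 1)) x)"
      using emeasure_lborel_cball_finite[of "0::'a" "R + 1"] by (auto intro!: integrable_mult_right)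
    show "AE x in lborel. (\<lambda>n. d n x) \<longlonglongrightarrow> partial v \<phi> x"
    proof (rule AE_I2)
      fix x
      have "((\<lambda>h. (\<phi> (x + h *\<^sub>R v) - \<phi> x) / h) \<longlongrightarrow> partial v \<phi> x) (at 0)"
        using Cinf_has_partial[OF test_fun_Cinf[OF \<phi>] v, of x 0] by (simp add: has_field_derivative_iff)
      moreover have "filterlim (\<lambda>n. 1 / real (Suc n)) (at 0) sequentially"
        using LIMSEQ_inverse_real_of_nat by (auto simp: filterlim_at inverse_eq_divide)
      ultimately have "(\<lambda>n. (\<phi> (x + (1 / real (Suc n)) *\<^sub>R v) - \<phi> x) / (1 / real (Suc n))) \<longlonglongrightarrow> partial v \<phi> x"
        by (rule filterlim_compose)
      then show "(\<lambda>n. d n x) \<longlonglongrightarrow> partial v \<phi> x"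
        by (simp add: d_def)
    qed
    show "AE x in lborel. norm (d n x) \<le> B * indicator (cball 0 (R + 1)) x" for n
    proof (rule AE_I2)
      fix x
      let ?t = "1 / real (Suc n)"
      have "\<exists>z. z > 0 \<and> z < ?t \<and> \<phi> (x + ?t *\<^sub>R v) - \<phi> (x + 0 *\<^sub>R v) = (?t - 0) * partial v \<phi> (x + z *\<^sub>R v)"
        by (rule MVT2) (auto intro: Cinf_has_partial test_fun_Cinf \<phi> v)
      then obtain z where "d n x = partial v \<phi> (x + z *\<^sub>R v)"
        by (auto simp: d_def)
      then have 1: "\<bar>d n x\<bar> \<le> B" using B by simp
      have "d n x = 0" if "norm x > R + 1"
      proof -
        have "norm x \<le> norm (x + ?t *\<^sub>R v) + norm (?t *\<^sub>R v)"
          using norm_triangle_ineq4[of "x + ?t *\<^sub>R v" "?t *\<^sub>R v"] by simp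
        moreover have "norm (?t *\<^sub>R v) \<le> 1" using v by (simp add: field_simps)
        ultimately have "norm (x + ?t *\<^sub>R v) > R" "norm x > R" using that by linarith+
        then show ?thesis by (simp add: d_def R)
      qed
      with 1 B show "norm (d n x) \<le> B * indicator (cball 0 (R + 1)) x"
        by (cases "norm x \<le> R + 1") auto
    qed
  qed (simp_all add: d_def)
  have "(\<integral>x. d n x \<partial>lborel) = 0" for n
    using test_fun_integrable[OF \<phi>] by (simp add: d_def integral_lborel_shift integrable_lborel_shift)
  with lim show ?thesis by (simp add: LIMSEQ_const_iff)
qed

lemma weak_deriv_Cinf:
  assumes f: "Cinf f" and v: "v \<in> Basis"
  shows "weak_deriv v f (partial v f)"
  unfolding weak_deriv_def
proof (intro conjI allI impI)
  show "partial v f \<in> borel_measurable lborel"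
    using Cinf_continuous[OF Cinf_partial[OF f v]] by (simp add: borel_measurable_continuous_onI)
  fix \<phi> :: "'a \<Rightarrow> real" assume \<phi>: "test_fun \<phi>"
  show 1: "integrable lborel (\<lambda>x. partial v f x * \<phi> x)"
    by (intro test_fun_integrable test_fun_times Cinf_partial f v \<phi>)
  show 2: "integrable lborel (\<lambda>x. f x * partial v \<phi> x)"
    by (intro test_fun_integrable test_fun_times test_fun_partial f v \<phi>)
  have "partial v (\<lambda>x. f x * \<phi> x) = (\<lambda>x. partial v f x * \<phi> x + f x * partial v \<phi> x)"
    using partial_times[OF Cinf_differentiable[OF f v] Cinf_differentiable[OF test_fun_Cinf[OF \<phi>] v]]
    by (simp add: fun_eq_iff mult.commute)
  then show "(\<integral>x. f x * partial v \<phi> x \<partial>lborel) = - (\<integral>x. partial v f x * \<phi> x \<partial>lborel)"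
    using integral_partial_test_fun[OF test_fun_times[OF \<phi> f] v] 1 2 by simp
qed

lemma flat_1: "flat 1 t = (if t > 0 then exp (- 1 / t) else 0)"
  by (simp add: flat_def)

lemma flat_1_bounds: "0 \<le> flat 1 t" "flat 1 t \<le> 1" "flat 1 t > 0 \<longleftrightarrow> t > 0"
  by (auto simp: flat_1)

text \<open>Boxes form a generator of the Borel sets closed under intersection, and the sets over
  which \<open>F\<close> integrates to 0 form a Dynkin system. The vanishing total integral is what
  makes this family closed under complements.\<close>

lemma integrable_zero_on_boxes:
  fixes F :: "'a::euclidean_space \<Rightarrow> real"
  assumes F: "integrable lborel F" and F0: "(\<integral>x. F x \<partial>lborel) = 0"
    and box: "\<And>l u. (\<integral>x. indicator (box l u) x * F x \<partial>lborel) = 0"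
  shows "AE x in lborel. F x = 0"
proof (rule sigma_finite_measure.density_zero[OF sigma_finite_lborel F])
  fix A :: "'a set" assume "A \<in> sets lborel"
  then have A: "A \<in> sigma_sets UNIV (range (\<lambda>(l, u). box l u))"
    by (simp add: borel_eq_box)
  have s: "S \<in> sigma_sets UNIV (range (\<lambda>(l, u). box l u)) \<Longrightarrow> S \<in> sets lborel" for S :: "'a set"
    by (simp add: borel_eq_box)
  have "Int_stable (range (\<lambda>(l, u). box l u :: 'a set))" "range (\<lambda>(l, u). box l u :: 'a set) \<subseteq> Pow UNIV"
    by (auto simp: Int_stable_def box_Int_box)
  from this A show "set_lebesgue_integral lborel A F = 0"
  proof (induction rule: sigma_sets_induct_disjoint)
    case (basic A)
    then show ?case using box by (auto simp: set_lebesgue_integral_def)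
  next
    case (compl A)
    have "set_lebesgue_integral lborel (UNIV - A) F = (\<integral>x. F x - indicator A x * F x \<partial>lborel)"
      unfolding set_lebesgue_integral_def by (intro Bochner_Integration.integral_cong) (auto split: split_indicator)
    also have "\<dots> = 0"
      using integrable_mult_indicator[OF s[OF compl.hyps] F] F F0 compl.IH
      by (simp add: set_lebesgue_integral_def)
    finally show ?case .
  next
    case (union A)
    have m: "A i \<in> sets lborel" for i using union.hyps(2) by (intro s) auto
    have "set_lebesgue_integral lborel (\<Union>i. A i) F = (\<Sum>i. set_lebesgue_integral lborel (A i) F)"
    proof (rule lebesgue_integral_countable_add[OF m])
      show "A i \<inter> A j = {}" if "i \<noteq> j" for i j
        using union.hyps(1) that by (auto simp: disjoint_family_on_def)
      show "set_integrable lborel (\<Union>i. A i) F"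
        unfolding set_integrable_def using m by (intro integrable_mult_indicator F sets.countable_UN) auto
    qed
    then show ?case using union.IH by simp
  qed (auto simp: set_lebesgue_integral_def)
qed

text \<open>If \<open>0 \<le> s \<le> 1\<close> is smooth and positive exactly on a box, then \<open>1 - (1 - s) ^ k\<close> is smooth and
  increases to the indicator of the box.\<close>

lemma AE_zero_if_test_integrals_zero:
  fixes h :: "'a::euclidean_space \<Rightarrow> real"
  assumes int: "\<And>\<phi>. test_fun \<phi> \<Longrightarrow> integrable lborel (\<lambda>x. h x * \<phi> x)"
    and zero: "\<And>\<phi>. test_fun \<phi> \<Longrightarrow> (\<integral>x. h x * \<phi> x \<partial>lborel) = 0"
  shows "AE x in lborel. h x = 0"
proof -
  \<comment> \<open>\<open>h\<close> is only known to be integrable against test functions. A bump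
    that is positive on the ball of radius \<open>n + 1\<close> makes it globally integrable; these
    balls exhaust the space.\<close>
  have "AE x in lborel. h x * flat 1 ((real (Suc n))\<^sup>2 - x \<bullet> x) = 0" for n
  proof -
    define \<psi> :: "'a \<Rightarrow> real" where "\<psi> x = flat 1 ((real (Suc n))\<^sup>2 - x \<bullet> x)" for x
    have \<psi>: "test_fun \<psi>"
    proof (rule test_funI[of _ "cball 0 (real (Suc n))"])
      have "Cinf (\<lambda>x::'a. flat 1 ((real (Suc n))\<^sup>2 - (x - 0) \<bullet> (x - 0)))"
        by (intro Cinf_flat Cinf_minus Cinf_const Cinf_inner_self)
      then show "Cinf \<psi>" by (simp add: \<psi>_def[abs_def])
      fix x assume "\<psi> x \<noteq> 0"
      then have "x \<bullet> x < (real (Suc n))\<^sup>2" by (auto simp: \<psi>_def flat_1 split: if_splits)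
      then have "norm x < real (Suc n)" by (simp add: norm_lt_square)
      then show "x \<in> cball 0 (real (Suc n))" by simp
    qed simp
    have "AE x in lborel. h x * \<psi> x = 0"
    proof (rule integrable_zero_on_boxes[OF int[OF \<psi>] zero[OF \<psi>]])
      fix l u :: 'a
      \<comment> \<open>Each factor \<open>flat 1\<close> vanishes on the outer side of one face of
        the box, so the product is positive exactly inside.\<close>
      define s where "s x = (\<Prod>b\<in>Basis. flat 1 ((x - l) \<bullet> b) * flat 1 ((x - u) \<bullet> (- b)))" for x :: 'a
      have sC: "Cinf s"
        unfolding s_def by (intro Cinf_prod Cinf_times Cinf_flat Cinf_inner)
      have s01: "0 \<le> s x" "s x \<le> 1" for x
        unfolding s_def by (intro prod_nonneg prod_le_1 conjI mult_le_one mult_nonneg_nonneg flat_1_bounds)+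
      have spos: "s x > 0 \<longleftrightarrow> x \<in> box l u" for x
      proof
        show "s x > 0" if "x \<in> box l u"
          unfolding s_def using that
          by (intro prod_pos) (auto simp: mem_box inner_diff_left flat_1_bounds intro!: mult_pos_pos)
        show "x \<in> box l u" if "s x > 0"
        proof -
          from \<open>s x > 0\<close> have "(\<Prod>b\<in>Basis. flat 1 ((x - l) \<bullet> b) * flat 1 ((x - u) \<bullet> (- b))) \<noteq> 0"
            unfolding s_def by linarith
          then have "flat 1 ((x - l) \<bullet> b) * flat 1 ((x - u) \<bullet> (- b)) \<noteq> 0" if "b \<in> Basis" for b
            using that by (simp del: inner_minus_right mult_eq_0_iff)
          then have "(x - l) \<bullet> b > 0 \<and> (x - u) \<bullet> (- b) > 0" if "b \<in> Basis" for b
            using that by (metis flat_1 mult_zero_left mult_zero_right)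
          then show ?thesis
            by (auto simp: mem_box inner_diff_left)
        qed
      qed
      define \<phi> where "\<phi> k x = (1 - (1 - s x) ^ k) * \<psi> x" for k x
      have \<phi>: "test_fun (\<phi> k)" for k
        unfolding \<phi>_def by (intro test_fun_times \<psi> Cinf_minus Cinf_const Cinf_power sC)
      have "(\<lambda>k. \<integral>x. h x * \<phi> k x \<partial>lborel) \<longlonglongrightarrow> (\<integral>x. indicator (box l u) x * (h x * \<psi> x) \<partial>lborel)"
      proof (rule integral_dominated_convergence[where w = "\<lambda>x. \<bar>h x * \<psi> x\<bar>"])
        show "integrable lborel (\<lambda>x. \<bar>h x * \<psi> x\<bar>)"
          using int[OF \<psi>] by (rule integrable_abs)
        show "(\<lambda>x. h x * \<phi> k x) \<in> borel_measurable lborel" for k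
          using borel_measurable_integrable[OF int[OF \<phi>]] .
        show "(\<lambda>x. indicator (box l u) x * (h x * \<psi> x)) \<in> borel_measurable lborel"
          by (rule borel_measurable_times[OF _ borel_measurable_integrable[OF int[OF \<psi>]]]) simp
        show "AE x in lborel. norm (h x * \<phi> k x) \<le> \<bar>h x * \<psi> x\<bar>" for k
        proof (rule AE_I2)
          fix x
          have "0 \<le> (1 - s x) ^ k" "(1 - s x) ^ k \<le> 1"
            using s01[of x] by (auto intro: power_le_one)
          then have "\<bar>1 - (1 - s x) ^ k\<bar> \<le> 1" by simp
          then have "\<bar>h x * \<psi> x\<bar> * \<bar>1 - (1 - s x) ^ k\<bar> \<le> \<bar>h x * \<psi> x\<bar> * 1"
            by (intro mult_left_mono) auto
          then show "norm (h x * \<phi> k x) \<le> \<bar>h x * \<psi> x\<bar>"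
            by (simp add: \<phi>_def abs_mult mult_ac)
        qed
        show "AE x in lborel. (\<lambda>k. h x * \<phi> k x) \<longlonglongrightarrow> indicator (box l u) x * (h x * \<psi> x)"
        proof (rule AE_I2)
          fix x
          have "(\<lambda>k. (1 - s x) ^ k) \<longlonglongrightarrow> 1 - indicator (box l u) x"
          proof (cases "x \<in> box l u")
            case True
            then have "\<bar>1 - s x\<bar> < 1" using s01[of x] spos[of x] by auto
            then show ?thesis using True by (simp add: LIMSEQ_power_zero)
          next
            case False
            then have "s x = 0" using s01[of x] spos[of x] by linarith
            then show ?thesis using False by simp
          qed
          then have "(\<lambda>k. h x * ((1 - (1 - s x) ^ k) * \<psi> x)) \<longlonglongrightarrow> h x * ((1 - (1 - indicator (box l u) x)) * \<psi> x)"
            by (intro tendsto_intros)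
          then show "(\<lambda>k. h x * \<phi> k x) \<longlonglongrightarrow> indicator (box l u) x * (h x * \<psi> x)"
            by (simp add: \<phi>_def mult_ac)
        qed
      qed
      then show "(\<integral>x. indicator (box l u) x * (h x * \<psi> x) \<partial>lborel) = 0"
        using zero[OF \<phi>] by (simp add: LIMSEQ_const_iff)
    qed
    then show ?thesis by (simp add: \<psi>_def)
  qed
  then have "AE x in lborel. \<forall>n. h x * flat 1 ((real (Suc n))\<^sup>2 - x \<bullet> x) = 0"
    unfolding AE_all_countable by blast
  then show ?thesis
  proof eventually_elim
    case (elim x)
    obtain n where "norm x < real n" using reals_Archimedean2 by blast
    then have "norm x < real (Suc n)" by simp
    then have "x \<bullet> x < (real (Suc n))\<^sup>2"
      using power_strict_mono[of "norm x" "real (Suc n)" 2] by (simp add: power2_norm_eq_inner del: of_nat_Suc)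
    then have "flat 1 ((real (Suc n))\<^sup>2 - x \<bullet> x) > 0" by (subst flat_1_bounds(3)) linarith
    moreover have "h x * flat 1 ((real (Suc n))\<^sup>2 - x \<bullet> x) = 0" using elim by blast
    ultimately show ?case by simp
  qed
qed

lemma weak_deriv_unique:
  assumes g: "weak_deriv v u g" and g': "weak_deriv v u g'"
  shows "AE x in lborel. g x = g' x"
proof -
  have "AE x in lborel. g x - g' x = 0"
    by (rule AE_zero_if_test_integrals_zero) (use g g' in \<open>auto simp: weak_deriv_def left_diff_distrib\<close>)
  then show ?thesis by simp
qed

lemma weak_deriv_wpartial: "weak_deriv v u g \<Longrightarrow> weak_deriv v u (wpartial v u)"
  unfolding wpartial_def by (rule someI[of "weak_deriv v u"])

text \<open>Weak derivatives are fixed only almost everywhere, so before differentiating a second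
  time one must be able to change the representative of the first derivative.\<close>

lemma weak_deriv_cong_AE:
  assumes g: "weak_deriv v u g" and ae: "AE x in lborel. u x = u' x"
    and [measurable]: "u \<in> borel_measurable borel" "u' \<in> borel_measurable borel" and v: "v \<in> Basis"
  shows "weak_deriv v u' g"
proof -
  have *: "integrable lborel (\<lambda>x. u' x * partial v \<phi> x) \<longleftrightarrow> integrable lborel (\<lambda>x. u x * partial v \<phi> x)"
    "(\<integral>x. u' x * partial v \<phi> x \<partial>lborel) = (\<integral>x. u x * partial v \<phi> x \<partial>lborel)" if "test_fun \<phi>" for \<phi>
  proof -
    have [measurable]: "partial v \<phi> \<in> borel_measurable borel"
      using that v by (intro test_fun_measurable test_fun_partial)
    have "AE x in lborel. u' x * partial v \<phi> x = u x * partial v \<phi> x"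
      using ae by eventually_elim simp
    then show "integrable lborel (\<lambda>x. u' x * partial v \<phi> x) \<longleftrightarrow> integrable lborel (\<lambda>x. u x * partial v \<phi> x)"
      "(\<integral>x. u' x * partial v \<phi> x \<partial>lborel) = (\<integral>x. u x * partial v \<phi> x \<partial>lborel)"
      using integrable_cong_AE[of "\<lambda>x. u' x * partial v \<phi> x" lborel "\<lambda>x. u x * partial v \<phi> x"]
        integral_cong_AE[of "\<lambda>x. u' x * partial v \<phi> x" lborel "\<lambda>x. u x * partial v \<phi> x"] by simp_all
  qed
  show ?thesis using g unfolding weak_deriv_def by (auto simp: *)
qed

section \<open>Square-integrable functions and the chosen weak derivatives\<close>

lemma L2_cong_AE:
  assumes "L2 g" "AE x in lborel. g x = g' x" "g' \<in> borel_measurable lborel"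
  shows "L2 g'"
proof -
  have [measurable]: "g \<in> borel_measurable borel" "g' \<in> borel_measurable borel"
    using assms by (auto simp: L2_def)
  have "AE x in lborel. (g x)\<^sup>2 = (g' x)\<^sup>2" using assms(2) by eventually_elim simp
  then have "integrable lborel (\<lambda>x. (g x)\<^sup>2) \<longleftrightarrow> integrable lborel (\<lambda>x. (g' x)\<^sup>2)"
    by (intro integrable_cong_AE) auto
  then show ?thesis using assms by (auto simp: L2_def)
qed

lemma L2_plus: "L2 f \<Longrightarrow> L2 g \<Longrightarrow> L2 (\<lambda>x. f x + g x)"
  unfolding L2_def
proof safe
  assume [measurable]: "f \<in> borel_measurable lborel" "g \<in> borel_measurable lborel"
    and i: "integrable lborel (\<lambda>x. (f x)\<^sup>2)" "integrable lborel (\<lambda>x. (g x)\<^sup>2)"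
  show "(\<lambda>x. f x + g x) \<in> borel_measurable lborel" by measurable
  have "(a + b)\<^sup>2 \<le> 2 * a\<^sup>2 + 2 * b\<^sup>2" for a b :: real
    using sum_squares_bound[of a b] by (simp add: power2_sum)
  then have 1: "AE x in lborel. norm ((f x + g x)\<^sup>2) \<le> norm (2 * (f x)\<^sup>2 + 2 * (g x)\<^sup>2)"
    by (intro AE_I2) (metis abs_of_nonneg order_trans real_norm_def zero_le_power2)
  have 2: "integrable lborel (\<lambda>x. 2 * (f x)\<^sup>2 + 2 * (g x)\<^sup>2)"
    using i by (intro Bochner_Integration.integrable_add integrable_mult_right) simp_all
  have 3: "(\<lambda>x. (f x + g x)\<^sup>2) \<in> borel_measurable lborel" by measurable
  show "integrable lborel (\<lambda>x. (f x + g x)\<^sup>2)"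
    by (rule Bochner_Integration.integrable_bound[OF 2 3 1])
qed

lemma L2_sum: "finite I \<Longrightarrow> (\<And>i. i \<in> I \<Longrightarrow> L2 (f i)) \<Longrightarrow> L2 (\<lambda>x. \<Sum>i\<in>I. f i x)"
proof (induction I rule: finite_induct)
  case empty
  show ?case by (simp add: L2_def)
next
  case (insert a I)
  then show ?case by (simp add: L2_plus)
qed

lemma L2_measurable: "L2 u \<Longrightarrow> u \<in> borel_measurable borel"
  by (simp add: L2_def)

text \<open>Membership in \<open>W22\<close> yields some \<open>g\<close> and \<open>h\<close>,
  whereas \<open>wpartial\<close> is a Hilbert choice made separately. Uniqueness identifies
  \<open>g\<close> with the chosen derivative almost everywhere, and only then can its second
  derivative be compared with \<open>h\<close>.\<close>

lemma W22_wpartial: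
  assumes u: "u \<in> W22" and b: "b \<in> Basis"
  shows "weak_deriv b u (wpartial b u)" "L2 (wpartial b u)"
    "weak_deriv b (wpartial b u) (wpartial b (wpartial b u))" "L2 (wpartial b (wpartial b u))"
proof -
  obtain g h where g: "weak_deriv b u g" "L2 g" and h: "weak_deriv b g h" "L2 h"
    using u b unfolding W22_def by blast
  show 1: "weak_deriv b u (wpartial b u)" using g(1) by (rule weak_deriv_wpartial)
  have ae: "AE x in lborel. g x = wpartial b u x" using weak_deriv_unique[OF g(1) 1] .
  have m: "wpartial b u \<in> borel_measurable lborel" using 1 by (simp add: weak_deriv_def)
  show "L2 (wpartial b u)" using L2_cong_AE[OF g(2) ae m] .
  have "weak_deriv b (wpartial b u) h"
    using weak_deriv_cong_AE[OF h(1) ae _ _ b] g(2) m by (simp add: L2_def)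
  then show 2: "weak_deriv b (wpartial b u) (wpartial b (wpartial b u))" by (rule weak_deriv_wpartial)
  have "AE x in lborel. h x = wpartial b (wpartial b u) x"
    using \<open>weak_deriv b (wpartial b u) h\<close> 2 by (rule weak_deriv_unique)
  then show "L2 (wpartial b (wpartial b u))"
    using L2_cong_AE[OF h(2)] 2 by (simp add: weak_deriv_def)
qed

lemma W22_wlap: "u \<in> W22 \<Longrightarrow> L2 (wlap u)"
  unfolding wlap_def by (intro L2_sum W22_wpartial) auto

lemma W22_L2: "u \<in> W22 \<Longrightarrow> L2 u"
  by (simp add: W22_def)

lemma test_fun_L2: "test_fun f \<Longrightarrow> L2 f"
  using test_fun_integrable[OF test_fun_times[of f f]] by (simp add: L2_def test_fun_measurable test_fun_Cinf power2_eq_square)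

lemma test_fun_W22: "test_fun f \<Longrightarrow> f \<in> W22"
  unfolding W22_def
proof (intro CollectI conjI ballI)
  assume f: "test_fun f"
  show "L2 f" using f by (rule test_fun_L2)
  fix i :: 'a assume i: "i \<in> Basis"
  note g = test_fun_partial[OF f i]
  have "\<exists>h. weak_deriv j (partial i f) h \<and> L2 h" if j: "j \<in> Basis" for j
    using weak_deriv_Cinf[OF test_fun_Cinf[OF g] j] test_fun_L2[OF test_fun_partial[OF g j]] by (intro exI conjI)
  then show "\<exists>g. weak_deriv i f g \<and> L2 g \<and> (\<forall>j\<in>Basis. \<exists>h. weak_deriv j g h \<and> L2 h)"
    using weak_deriv_Cinf[OF test_fun_Cinf[OF f] i] test_fun_L2[OF g] by (intro exI[of _ "partial i f"]) simp
qed

lemma wpartial_test_fun: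
  assumes f: "test_fun f" and b: "b \<in> Basis"
  shows "AE x in lborel. wpartial b f x = partial b f x"
    "AE x in lborel. wpartial b (wpartial b f) x = partial b (partial b f) x"
proof -
  have W: "f \<in> W22" using f by (rule test_fun_W22)
  show ae: "AE x in lborel. wpartial b f x = partial b f x"
    using weak_deriv_unique[OF W22_wpartial(1)[OF W b] weak_deriv_Cinf[OF test_fun_Cinf[OF f] b]] .
  have "weak_deriv b (partial b f) (partial b (partial b f))"
    using f b by (intro weak_deriv_Cinf Cinf_partial test_fun_Cinf)
  then have "weak_deriv b (wpartial b f) (partial b (partial b f))"
    using ae f b W22_wpartial(2)[OF W b]
    by (intro weak_deriv_cong_AE[of b "partial b f" _ "wpartial b f"]) (auto simp: L2_def intro: test_fun_measurable test_fun_partial)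
  then show "AE x in lborel. wpartial b (wpartial b f) x = partial b (partial b f) x"
    using weak_deriv_unique[OF W22_wpartial(3)[OF W b]] by blast
qed

text \<open>This replaces the chosen weak derivatives by classical ones and so makes the energy of
  the explicit functions in the sharpness proof computable.\<close>

lemma energy_test_fun:
  assumes f: "test_fun f"
  shows "energy \<tau> \<sigma> f = (\<integral>x. (\<Sum>b\<in>Basis. partial b (partial b f) x)\<^sup>2
    + \<tau> * (\<Sum>b\<in>Basis. (partial b f x)\<^sup>2) + \<sigma> * (f x)\<^sup>2 \<partial>lborel)"
  unfolding energy_def
proof (rule integral_cong_AE)
  have W: "f \<in> W22" using f by (rule test_fun_W22)
  have [measurable]: "f \<in> borel_measurable borel" "wlap f \<in> borel_measurable borel"
    using f W22_wlap[OF W] by (auto simp: L2_def intro: test_fun_measurable)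
  have "grad_sq f \<in> borel_measurable borel"
    unfolding grad_sq_def using W22_wpartial(2)[OF W]
    by (intro borel_measurable_sum borel_measurable_power) (auto simp: L2_def)
  then show "(\<lambda>x. (wlap f x)\<^sup>2 + \<tau> * grad_sq f x + \<sigma> * (f x)\<^sup>2) \<in> borel_measurable lborel"
    by simp
  have [measurable]: "partial b f \<in> borel_measurable borel" "partial b (partial b f) \<in> borel_measurable borel"
    if "b \<in> Basis" for b
    using f that by (simp_all add: test_fun_measurable test_fun_partial)
  have "(\<lambda>x. \<Sum>b\<in>Basis. partial b (partial b f) x) \<in> borel_measurable borel"
    "(\<lambda>x. \<Sum>b\<in>Basis. (partial b f x)\<^sup>2) \<in> borel_measurable borel"
    by (intro borel_measurable_sum borel_measurable_power; simp)+
  then show "(\<lambda>x. (\<Sum>b\<in>Basis. partial b (partial b f) x)\<^sup>2 + \<tau> * (\<Sum>b\<in>Basis. (partial b f x)\<^sup>2) + \<sigma> * (f x)\<^sup>2) \<in> borel_measurable lborel"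
    by simp
  have "AE x in lborel. \<forall>b\<in>Basis. wpartial b f x = partial b f x \<and> wpartial b (wpartial b f) x = partial b (partial b f) x"
    using wpartial_test_fun[OF f] by (intro AE_finite_allI) auto
  then show "AE x in lborel. (wlap f x)\<^sup>2 + \<tau> * grad_sq f x + \<sigma> * (f x)\<^sup>2 =
     (\<Sum>b\<in>Basis. partial b (partial b f) x)\<^sup>2 + \<tau> * (\<Sum>b\<in>Basis. (partial b f x)\<^sup>2) + \<sigma> * (f x)\<^sup>2"
    by eventually_elim (simp add: wlap_def grad_sq_def)
qed

section \<open>Radial integrals and the logarithmic kernel\<close>

text \<open>This stands in for polar coordinates. The ball of squared radius \<open>a\<close> has
  volume \<open>pi\<^sup>2 / 2 * a\<^sup>2\<close>, and the density is the derivative of this in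
  \<open>a\<close>. Negative \<open>s\<close> carry no mass because \<open>ennreal\<close> truncates
  there.\<close>

lemma distr_inner_self:
  "distr lborel borel (\<lambda>x::real^4. x \<bullet> x) = density lborel (\<lambda>s. ennreal (pi\<^sup>2 * s))" (is "?M = ?N")
proof (rule measure_eqI_generator_eq)
  let ?E = "range (\<lambda>a::real. {..a})"
  show "Int_stable ?E"
    by (auto simp: Int_stable_def)
  show "sets ?M = sigma_sets UNIV ?E" "sets ?N = sigma_sets UNIV ?E"
    by (simp_all add: borel_eq_atMost)
  show "emeasure ?M X = emeasure ?N X" if "X \<in> ?E" for X
  proof -
    from that obtain a where X: "X = {..a}" by auto
    have M: "emeasure ?M X = emeasure lborel {x::real^4. x \<bullet> x \<le> a}"
      by (simp add: X emeasure_distr vimage_def)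
    have N: "emeasure ?N X = (\<integral>\<^sup>+s. ennreal (pi\<^sup>2 * s) * indicator {..a} s \<partial>lborel)"
      by (simp add: X emeasure_density)
    show ?thesis
    proof (cases "a \<ge> 0")
      case True
      have "{x::real^4. x \<bullet> x \<le> a} = cball 0 (sqrt a)"
        by (auto simp: norm_le_square[symmetric] real_le_rsqrt power2_norm_eq_inner norm_eq_sqrt_inner real_le_lsqrt)
      moreover have "sqrt a ^ 4 = a\<^sup>2"
        using True by (metis mult_2 numeral_Bit0 power_mult real_sqrt_pow2 power_add power2_eq_square)
      ultimately have "emeasure ?M X = ennreal (pi\<^sup>2 / 2 * a\<^sup>2)"
        using True unfolding M by (simp add: emeasure_cball eval_unit_ball_vol)
      moreover have "(\<integral>\<^sup>+s. ennreal (pi\<^sup>2 * s) * indicator {..a} s \<partial>lborel) =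
        (\<integral>\<^sup>+s. ennreal (pi\<^sup>2 * s) * indicator {0..a} s \<partial>lborel)"
        by (intro nn_integral_cong) (auto split: split_indicator simp: ennreal_neg mult_nonneg_nonpos)
      moreover have "\<dots> = ennreal (pi\<^sup>2 / 2 * a\<^sup>2 - pi\<^sup>2 / 2 * 0\<^sup>2)"
        using True by (intro nn_integral_FTC_Icc) (auto intro!: derivative_eq_intros)
      ultimately show ?thesis unfolding N by simp
    next
      case False
      have "\<not> (x \<bullet> x \<le> a)" for x :: "real^4"
        using False inner_ge_zero[of x] by linarith
      then have "emeasure ?M X = 0" unfolding M by simp
      moreover have "(\<integral>\<^sup>+s. ennreal (pi\<^sup>2 * s) * indicator {..a} s \<partial>lborel) = (\<integral>\<^sup>+s. 0 \<partial>(lborel :: real measure))"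
        using False by (intro nn_integral_cong) (auto split: split_indicator simp: ennreal_neg mult_nonneg_nonpos)
      ultimately show ?thesis unfolding N by simp
    qed
  qed
  show "range (\<lambda>n::nat. {..real n}) \<subseteq> ?E" by auto
  show "(\<Union>n::nat. {..real n}) = UNIV"
    by (auto intro: real_arch_simple)
  show "emeasure ?M {..real n} \<noteq> \<infinity>" for n
  proof -
    have "emeasure ?M {..real n} = emeasure lborel {x::real^4. x \<bullet> x \<le> real n}"
      by (simp add: emeasure_distr vimage_def)
    also have "\<dots> \<le> emeasure lborel (cball (0::real^4) (sqrt (real n)))"
      by (intro emeasure_mono) (auto simp: norm_eq_sqrt_inner)
    finally show ?thesis using emeasure_lborel_cball_finite[of "0::real^4" "sqrt (real n)"]
      by (auto simp: top_unique less_top)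
  qed
qed auto

lemma nn_integral_radial:
  assumes [measurable]: "h \<in> borel_measurable borel"
  shows "(\<integral>\<^sup>+x. h (x \<bullet> x) \<partial>(lborel :: (real^4) measure)) = (\<integral>\<^sup>+s. ennreal (pi\<^sup>2 * s) * h s \<partial>lborel)"
proof -
  have "(\<integral>\<^sup>+x. h (x \<bullet> x) \<partial>(lborel :: (real^4) measure)) = (\<integral>\<^sup>+s. h s \<partial>distr lborel borel (\<lambda>x::real^4. x \<bullet> x))"
    by (subst nn_integral_distr) auto
  then show ?thesis
    by (simp add: distr_inner_self nn_integral_density)
qed

section \<open>Changes of variables and singular integrals in dimension four\<close>

lemma nn_integral_lborel_shift:
  fixes f :: "'a::euclidean_space \<Rightarrow> ennreal"
  assumes [measurable]: "f \<in> borel_measurable borel"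
  shows "(\<integral>\<^sup>+x. f (x + a) \<partial>lborel) = (\<integral>\<^sup>+x. f x \<partial>lborel)"
proof -
  have "(\<integral>\<^sup>+x. f x \<partial>lborel) = (\<integral>\<^sup>+x. f x \<partial>distr lborel borel ((+) a))"
    by (simp add: lborel_distr_plus)
  then show ?thesis by (simp add: nn_integral_distr add.commute)
qed

lemma nn_integral_lborel_scale:
  fixes f :: "'a::euclidean_space \<Rightarrow> ennreal"
  assumes [measurable]: "f \<in> borel_measurable borel" and "c \<noteq> 0"
  shows "(\<integral>\<^sup>+x. f x \<partial>lborel) = ennreal (\<bar>c\<bar> ^ DIM('a)) * (\<integral>\<^sup>+x. f (t + c *\<^sub>R x) \<partial>lborel)"
  by (subst lborel_affine[OF assms(2), of t]) (simp add: nn_integral_density nn_integral_distr nn_integral_cmult)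

lemma nn_integral_lborel_reflect:
  fixes f :: "'a::euclidean_space \<Rightarrow> ennreal"
  assumes [measurable]: "f \<in> borel_measurable borel"
  shows "(\<integral>\<^sup>+x. f (a - x) \<partial>lborel) = (\<integral>\<^sup>+x. f x \<partial>lborel)"
  using nn_integral_lborel_scale[of f "-1" a] by simp

lemma nn_integral_inverse_square_ball:
  assumes "\<rho> \<ge> 0"
  shows "(\<integral>\<^sup>+x. ennreal (if x \<bullet> x < \<rho> then 1 / (x \<bullet> x) else 0) \<partial>(lborel :: (real^4) measure)) = ennreal (pi\<^sup>2 * \<rho>)"
proof -
  have "(\<integral>\<^sup>+x. ennreal (if x \<bullet> x < \<rho> then 1 / (x \<bullet> x) else 0) \<partial>(lborel :: (real^4) measure)) =
     (\<integral>\<^sup>+s. ennreal (pi\<^sup>2 * s) * ennreal (if s < \<rho> then 1 / s else 0) \<partial>lborel)"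
    by (rule nn_integral_radial) auto
  also have "\<dots> = (\<integral>\<^sup>+s. ennreal (pi\<^sup>2) * indicator {0<..<\<rho>} s \<partial>lborel)"
  proof (intro nn_integral_cong)
    fix s :: real
    show "ennreal (pi\<^sup>2 * s) * ennreal (if s < \<rho> then 1 / s else 0) = ennreal (pi\<^sup>2) * indicator {0<..<\<rho>} s"
      by (cases "s > 0") (auto simp: ennreal_mult'[symmetric] ennreal_neg mult_nonneg_nonpos split: split_indicator)
  qed
  also have "\<dots> = ennreal (pi\<^sup>2 * \<rho>)"
    using assms by (simp add: nn_integral_cmult_indicator ennreal_mult)
  finally show ?thesis .
qed

lemma nn_integral_inverse_fourth_annulus:
  assumes "0 < \<rho>" "\<rho> \<le> 1"
  shows "(\<integral>\<^sup>+x. ennreal (if \<rho> \<le> x \<bullet> x \<and> x \<bullet> x < 1 then 1 / (x \<bullet> x)\<^sup>2 else 0) \<partial>(lborel :: (real^4) measure))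
    \<le> ennreal (pi\<^sup>2 * ln (1 / \<rho>))"
proof -
  have "(\<integral>\<^sup>+x. ennreal (if \<rho> \<le> x \<bullet> x \<and> x \<bullet> x < 1 then 1 / (x \<bullet> x)\<^sup>2 else 0) \<partial>(lborel :: (real^4) measure)) =
     (\<integral>\<^sup>+s. ennreal (pi\<^sup>2 * s) * ennreal (if \<rho> \<le> s \<and> s < 1 then 1 / s\<^sup>2 else 0) \<partial>lborel)"
    by (rule nn_integral_radial) auto
  also have "\<dots> \<le> (\<integral>\<^sup>+s. ennreal (pi\<^sup>2 / s) * indicator {\<rho>..1} s \<partial>lborel)"
  proof (intro nn_integral_mono)
    fix s :: real
    show "ennreal (pi\<^sup>2 * s) * ennreal (if \<rho> \<le> s \<and> s < 1 then 1 / s\<^sup>2 else 0) \<le> ennreal (pi\<^sup>2 / s) * indicator {\<rho>..1} s"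
      using assms by (cases "s > 0") (auto simp: ennreal_mult'[symmetric] ennreal_neg mult_nonneg_nonpos power2_eq_square split: split_indicator)
  qed
  also have "\<dots> = ennreal (pi\<^sup>2 * ln 1 - pi\<^sup>2 * ln \<rho>)"
    using assms by (intro nn_integral_FTC_Icc) (auto intro!: derivative_eq_intros)
  finally show ?thesis using assms by (simp add: ln_div)
qed

text \<open>Split at distance \<open>r\<close> from the pole: the ball contributes at most
  \<open>pi\<^sup>2 * r\<^sup>2\<close> whatever \<open>E\<close> is, and outside it the integrand
  is at most \<open>1 / r\<^sup>2\<close> on a set of measure at most \<open>r ^ 4\<close>. This
  crude bound takes the place of a rearrangement inequality.\<close>

lemma nn_integral_inverse_square_set:
  fixes E :: "(real^4) set"
  assumes [measurable]: "E \<in> sets borel" and E: "emeasure lborel E \<le> ennreal (r ^ 4)" and r: "r > 0"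
  shows "(\<integral>\<^sup>+x. ennreal (1 / ((y - x) \<bullet> (y - x))) * indicator E x \<partial>lborel) \<le> ennreal ((pi\<^sup>2 + 1) * r\<^sup>2)"
proof -
  have "(\<integral>\<^sup>+x. ennreal (1 / ((y - x) \<bullet> (y - x))) * indicator E x \<partial>lborel)
    \<le> (\<integral>\<^sup>+x. ennreal (if (y - x) \<bullet> (y - x) < r\<^sup>2 then 1 / ((y - x) \<bullet> (y - x)) else 0)
        + ennreal (1 / r\<^sup>2) * indicator E x \<partial>lborel)"
  proof (intro nn_integral_mono)
    fix x
    show "ennreal (1 / ((y - x) \<bullet> (y - x))) * indicator E x \<le>
      ennreal (if (y - x) \<bullet> (y - x) < r\<^sup>2 then 1 / ((y - x) \<bullet> (y - x)) else 0) + ennreal (1 / r\<^sup>2) * indicator E x"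
      using r by (auto split: split_indicator intro!: ennreal_leI divide_left_mono mult_pos_pos
          simp del: divide_const_simps simp: not_less intro: less_le_trans[of 0 "r\<^sup>2"])
  qed
  also have "\<dots> = (\<integral>\<^sup>+x. ennreal (if (y - x) \<bullet> (y - x) < r\<^sup>2 then 1 / ((y - x) \<bullet> (y - x)) else 0) \<partial>lborel)
        + ennreal (1 / r\<^sup>2) * emeasure lborel E"
    by (subst nn_integral_add) (auto simp: nn_integral_cmult)
  also have "(\<integral>\<^sup>+x. ennreal (if (y - x) \<bullet> (y - x) < r\<^sup>2 then 1 / ((y - x) \<bullet> (y - x)) else 0) \<partial>lborel) = ennreal (pi\<^sup>2 * r\<^sup>2)"
    using nn_integral_lborel_reflect[of "\<lambda>z::real^4. ennreal (if z \<bullet> z < r\<^sup>2 then 1 / (z \<bullet> z) else 0)" y]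
    by (simp add: nn_integral_inverse_square_ball)
  also have "ennreal (pi\<^sup>2 * r\<^sup>2) + ennreal (1 / r\<^sup>2) * emeasure lborel E \<le> ennreal (pi\<^sup>2 * r\<^sup>2) + ennreal (1 / r\<^sup>2) * ennreal (r ^ 4)"
    by (intro add_left_mono mult_left_mono E) auto
  also have "\<dots> = ennreal ((pi\<^sup>2 + 1) * r\<^sup>2)"
    using r by (simp add: ennreal_mult'[symmetric] ennreal_plus[symmetric] field_simps eval_nat_numeral del: ennreal_plus)
  finally show ?thesis .
qed

text \<open>Division by zero makes \<open>kern 0 = 0\<close>, so bounds by \<open>kern\<close> only hold away from the origin.\<close>

definition kern :: "real^4 \<Rightarrow> real" where
  "kern z = (if z \<bullet> z < 1 then 1 / (4 * pi\<^sup>2 * (z \<bullet> z)) else 0)"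

lemma kern_nonneg: "kern z \<ge> 0"
  by (simp add: kern_def)

lemma measurable_kern [measurable]: "kern \<in> borel_measurable borel"
  unfolding kern_def by measurable

text \<open>The value 1/4 is the price of the bounded part of the Laplacian: if
  \<open>\<bar>\<Delta>u\<bar>\<close> is at most \<open>M\<close>, its convolution with the kernel
  is at most \<open>M / 4\<close>.\<close>

lemma nn_integral_kern: "(\<integral>\<^sup>+z. ennreal (kern z) \<partial>lborel) = ennreal (1 / 4)"
proof -
  have "(\<integral>\<^sup>+z. ennreal (kern z) \<partial>lborel) =
    (\<integral>\<^sup>+z. ennreal (1 / (4 * pi\<^sup>2)) * ennreal (if z \<bullet> z < 1 then 1 / (z \<bullet> z) else 0) \<partial>(lborel :: (real^4) measure))"
    by (intro nn_integral_cong) (simp add: kern_def ennreal_mult'[symmetric])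
  also have "\<dots> = ennreal (1 / (4 * pi\<^sup>2)) * ennreal (pi\<^sup>2 * 1)"
    by (subst nn_integral_cmult) (auto simp: nn_integral_inverse_square_ball)
  finally show ?thesis by (simp add: ennreal_mult'[symmetric])
qed

text \<open>Here \<open>a\<close>, \<open>b\<close> are squared distances to the two poles and
  \<open>r\<close> is a squared radius. The two halves of the arithmetic-geometric mean later
  integrate to the same annulus integral and add up to exactly one of it, so the leading constant is
  not doubled.\<close>

lemma kern_product_split:
  fixes a b r :: real
  assumes "a \<ge> 0" "b \<ge> 0" "r > 0"
  shows "(if a < 1 then 1 / a else 0) * (if b < 1 then 1 / b else 0) \<le>
    (if r \<le> a \<and> a < 1 then 1 / a\<^sup>2 else 0) / 2 + (if r \<le> b \<and> b < 1 then 1 / b\<^sup>2 else 0) / 2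
    + (if a < r then 1 / a else 0) * (1 / b) + (1 / a) * (if b < r then 1 / b else 0)"
proof -
  have "(1 / a) * (1 / b) \<le> (1 / a\<^sup>2) / 2 + (1 / b\<^sup>2) / 2"
    using sum_squares_bound[of "1/a" "1/b"] by (simp add: power_divide)
  moreover have "0 \<le> (1 / a) * (1 / b)" "0 \<le> 1 / a\<^sup>2" "0 \<le> 1 / b\<^sup>2"
    using assms by auto
  ultimately show ?thesis
    using assms by (auto simp: not_less simp del: times_divide_eq_left times_divide_eq_right)
qed

text \<open>The kernels are split at distance \<open>r\<close> from their poles: two factors far from their poles are
  handled by the arithmetic-geometric mean inequality, which keeps the constant sharp, and a factor
  near its pole is harmless because of the averaging over \<open>E\<close>.\<close>

lemma kern_convolution_average:
  fixes E :: "(real^4) set"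
  assumes [measurable]: "E \<in> sets borel" and E: "emeasure lborel E = ennreal (r ^ 4)" and r: "0 < r" "r \<le> 1"
  shows "(\<integral>\<^sup>+x. (\<integral>\<^sup>+y. ennreal (kern (y - x) * kern (y - x')) \<partial>lborel) * indicator E x \<partial>lborel)
    \<le> ennreal (r ^ 4 * (ln (1 / r ^ 4) + 4 * (pi\<^sup>2 + 1)) / (32 * pi\<^sup>2))"
proof -
  \<comment> \<open>\<open>J\<close> is the squared kernel far from its pole, \<open>L\<close> the
    kernel near its pole and \<open>R\<close> the kernel without cut-off, all without the constant
    \<open>1 / (4 * pi\<^sup>2)\<close>; hence the factor \<open>16 * pi ^ 4\<close> below.\<close>
  define J :: "real^4 \<Rightarrow> real" where "J z = (if r\<^sup>2 \<le> z \<bullet> z \<and> z \<bullet> z < 1 then 1 / (z \<bullet> z)\<^sup>2 else 0)" for z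
  define L :: "real^4 \<Rightarrow> real" where "L z = (if z \<bullet> z < r\<^sup>2 then 1 / (z \<bullet> z) else 0)" for z
  define R :: "real^4 \<Rightarrow> real" where "R z = 1 / (z \<bullet> z)" for z
  have [measurable]: "J \<in> borel_measurable borel" "L \<in> borel_measurable borel" "R \<in> borel_measurable borel"
    unfolding J_def L_def R_def by measurable
  have nn: "J z \<ge> 0" "L z \<ge> 0" "R z \<ge> 0" for z by (auto simp: J_def L_def R_def)
  have intJ: "(\<integral>\<^sup>+z. ennreal (J z) \<partial>lborel) \<le> ennreal (pi\<^sup>2 * ln (1 / r\<^sup>2))"
    unfolding J_def using r by (intro nn_integral_inverse_fourth_annulus) (auto simp: power_le_one)
  have intL: "(\<integral>\<^sup>+z. ennreal (L z) \<partial>lborel) = ennreal (pi\<^sup>2 * r\<^sup>2)"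
    unfolding L_def by (intro nn_integral_inverse_square_ball) auto
  have intR: "(\<integral>\<^sup>+x. ennreal (R (y - x)) * indicator E x \<partial>lborel) \<le> ennreal ((pi\<^sup>2 + 1) * r\<^sup>2)" for y
    unfolding R_def using E r by (intro nn_integral_inverse_square_set) auto
  have shift: "(\<integral>\<^sup>+y. f (y - x) \<partial>lborel) = (\<integral>\<^sup>+y. f y \<partial>lborel)"
    if "f \<in> borel_measurable borel" for f :: "real^4 \<Rightarrow> ennreal" and x
    using nn_integral_lborel_shift[OF that, of "-x"] by simp
  have pw: "16 * pi ^ 4 * (kern (y - x) * kern (y - x')) \<le>
     J (y - x) / 2 + J (y - x') / 2 + L (y - x) * R (y - x') + R (y - x) * L (y - x')" for x y
  proof -
    let ?a = "(y - x) \<bullet> (y - x)" and ?b = "(y - x') \<bullet> (y - x')"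
    have "16 * pi ^ 4 * (kern (y - x) * kern (y - x')) =
      (if ?a < 1 then 1 / ?a else 0) * (if ?b < 1 then 1 / ?b else 0)"
      by (auto simp: kern_def eval_nat_numeral)
    then show ?thesis
      using kern_product_split[of ?a ?b "r\<^sup>2"] r by (simp add: J_def L_def R_def)
  qed
  have half: "a / 2 + a / 2 = a" for a :: ennreal
    by (cases a) (auto simp: ennreal_divide_numeral ennreal_plus[symmetric] ennreal_top_divide simp del: ennreal_plus)
  have pull: "ennreal C * (\<integral>\<^sup>+x. (\<integral>\<^sup>+y. ennreal (kern (y - x) * kern (y - x')) \<partial>lborel) * indicator E x \<partial>lborel)
    = (\<integral>\<^sup>+x. (\<integral>\<^sup>+y. ennreal (C * (kern (y - x) * kern (y - x'))) \<partial>lborel) * indicator E x \<partial>lborel)"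
    if "C \<ge> 0" for C
    using that by (simp add: nn_integral_cmult ennreal_mult' mult.assoc)
  have "ennreal (16 * pi ^ 4) * (\<integral>\<^sup>+x. (\<integral>\<^sup>+y. ennreal (kern (y - x) * kern (y - x')) \<partial>lborel) * indicator E x \<partial>lborel)
    = (\<integral>\<^sup>+x. (\<integral>\<^sup>+y. ennreal (16 * pi ^ 4 * (kern (y - x) * kern (y - x'))) \<partial>lborel) * indicator E x \<partial>lborel)"
    by (rule pull) simp
  also have "\<dots> \<le> (\<integral>\<^sup>+x. (\<integral>\<^sup>+y. ennreal (J (y - x)) / 2 + ennreal (J (y - x')) / 2
       + ennreal (L (y - x)) * ennreal (R (y - x')) + ennreal (R (y - x)) * ennreal (L (y - x')) \<partial>lborel) * indicator E x \<partial>lborel)"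
    by (intro nn_integral_mono mult_right_mono order_trans[OF ennreal_leI[OF pw]])
      (simp_all add: nn ennreal_mult' ennreal_divide_numeral)
  also have "\<dots> = (\<integral>\<^sup>+x. ((\<integral>\<^sup>+y. ennreal (J (y - x)) \<partial>lborel) / 2 + (\<integral>\<^sup>+y. ennreal (J (y - x')) \<partial>lborel) / 2) * indicator E x
     + (\<integral>\<^sup>+y. ennreal (L (y - x)) * ennreal (R (y - x')) * indicator E x \<partial>lborel)
     + (\<integral>\<^sup>+y. ennreal (R (y - x)) * ennreal (L (y - x')) * indicator E x \<partial>lborel) \<partial>lborel)"
    by (intro nn_integral_cong) (simp add: nn_integral_add nn_integral_divide nn_integral_multc distrib_right)
  also have "\<dots> = (\<integral>\<^sup>+z. ennreal (J z) \<partial>lborel) * emeasure lborel E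
     + (\<integral>\<^sup>+x. (\<integral>\<^sup>+y. ennreal (L (y - x)) * ennreal (R (y - x')) * indicator E x \<partial>lborel) \<partial>lborel)
     + (\<integral>\<^sup>+x. (\<integral>\<^sup>+y. ennreal (R (y - x)) * ennreal (L (y - x')) * indicator E x \<partial>lborel) \<partial>lborel)"
    using shift[of "\<lambda>z. ennreal (J z)"] half
    by (subst nn_integral_add, measurable, subst nn_integral_add) (simp_all add: nn_integral_cmult)
  finally have split: "ennreal (16 * pi ^ 4) * (\<integral>\<^sup>+x. (\<integral>\<^sup>+y. ennreal (kern (y - x) * kern (y - x')) \<partial>lborel) * indicator E x \<partial>lborel)
    \<le> \<dots>" .
  have far: "(\<integral>\<^sup>+z. ennreal (J z) \<partial>lborel) * emeasure lborel E \<le> ennreal (pi\<^sup>2 * ln (1 / r\<^sup>2) * r ^ 4)"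
    unfolding E using r by (subst ennreal_mult'') (auto intro!: mult_right_mono intJ)
  have near: "(\<integral>\<^sup>+x. (\<integral>\<^sup>+y. ennreal (L (y - x)) * ennreal (R (y - x')) * indicator E x \<partial>lborel) \<partial>lborel)
    \<le> ennreal (pi\<^sup>2 * r\<^sup>2 * ((pi\<^sup>2 + 1) * r\<^sup>2))"
  proof -
    \<comment> \<open>Translating \<open>y\<close> by \<open>x\<close> frees the singular factor
      \<open>L\<close> of \<open>x\<close>. After the exchange of integrals, \<open>x\<close> occurs
      only in \<open>R (x' - y - x)\<close>, and \<open>intR\<close> applies with centre
      \<open>x' - y\<close>.\<close>
    have "(\<integral>\<^sup>+y. ennreal (L (y - x)) * ennreal (R (y - x')) * indicator E x \<partial>lborel)
      = (\<integral>\<^sup>+y. ennreal (L y) * (ennreal (R (x' - y - x)) * indicator E x) \<partial>lborel)" for x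
    proof -
      have "R (x' - y) = R (y - x')" for y
        unfolding R_def by (simp add: inner_diff_left inner_diff_right algebra_simps)
      then show ?thesis
        using shift[of "\<lambda>y. ennreal (L y) * (ennreal (R (x' - y - x)) * indicator E x)" x]
        by (simp add: mult_ac)
    qed
    then have "(\<integral>\<^sup>+x. (\<integral>\<^sup>+y. ennreal (L (y - x)) * ennreal (R (y - x')) * indicator E x \<partial>lborel) \<partial>lborel)
      = (\<integral>\<^sup>+x. (\<integral>\<^sup>+y. ennreal (L y) * (ennreal (R (x' - y - x)) * indicator E x) \<partial>lborel) \<partial>lborel)"
      by simp
    also have "\<dots> = (\<integral>\<^sup>+y. (\<integral>\<^sup>+x. ennreal (L y) * (ennreal (R (x' - y - x)) * indicator E x) \<partial>lborel) \<partial>lborel)"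
      by (rule lborel_pair.Fubini') measurable
    also have "\<dots> \<le> (\<integral>\<^sup>+y. ennreal (L y) * ennreal ((pi\<^sup>2 + 1) * r\<^sup>2) \<partial>lborel)"
      by (intro nn_integral_mono) (auto simp: nn_integral_cmult intro!: mult_left_mono intR)
    also have "\<dots> = ennreal (pi\<^sup>2 * r\<^sup>2 * ((pi\<^sup>2 + 1) * r\<^sup>2))"
      by (simp add: nn_integral_multc intL ennreal_mult'[symmetric])
    finally show ?thesis .
  qed
  have near': "(\<integral>\<^sup>+x. (\<integral>\<^sup>+y. ennreal (R (y - x)) * ennreal (L (y - x')) * indicator E x \<partial>lborel) \<partial>lborel)
    \<le> ennreal (pi\<^sup>2 * r\<^sup>2 * ((pi\<^sup>2 + 1) * r\<^sup>2))"
  proof -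
    have "(\<integral>\<^sup>+x. (\<integral>\<^sup>+y. ennreal (R (y - x)) * ennreal (L (y - x')) * indicator E x \<partial>lborel) \<partial>lborel)
      = (\<integral>\<^sup>+x. (\<integral>\<^sup>+y. ennreal (L (y - x')) * (ennreal (R (y - x)) * indicator E x) \<partial>lborel) \<partial>lborel)"
      by (simp add: mult_ac)
    also have "\<dots> = (\<integral>\<^sup>+y. (\<integral>\<^sup>+x. ennreal (L (y - x')) * (ennreal (R (y - x)) * indicator E x) \<partial>lborel) \<partial>lborel)"
      by (rule lborel_pair.Fubini') measurable
    also have "\<dots> \<le> (\<integral>\<^sup>+y. ennreal (L (y - x')) * ennreal ((pi\<^sup>2 + 1) * r\<^sup>2) \<partial>lborel)"
      by (intro nn_integral_mono) (auto simp: nn_integral_cmult intro!: mult_left_mono intR)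
    also have "\<dots> = ennreal (pi\<^sup>2 * r\<^sup>2 * ((pi\<^sup>2 + 1) * r\<^sup>2))"
      using shift[of "\<lambda>y. ennreal (L y)" x'] by (simp add: nn_integral_multc intL ennreal_mult'[symmetric])
    finally show ?thesis .
  qed
  note order_trans[OF split add_mono[OF add_mono[OF far near] near']]
  \<comment> \<open>Division by \<open>16 * pi ^ 4\<close> sends the far part to
    \<open>r ^ 4 * ln (1 / r ^ 4) / (32 * pi\<^sup>2)\<close>, because
    \<open>2 * ln (1 / r\<^sup>2) = ln (1 / r ^ 4)\<close>. The two near parts together give the
    term with \<open>4 * (pi\<^sup>2 + 1)\<close>.\<close>
  also have "ennreal (pi\<^sup>2 * ln (1 / r\<^sup>2) * r ^ 4) + ennreal (pi\<^sup>2 * r\<^sup>2 * ((pi\<^sup>2 + 1) * r\<^sup>2))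
      + ennreal (pi\<^sup>2 * r\<^sup>2 * ((pi\<^sup>2 + 1) * r\<^sup>2))
    = ennreal (16 * pi ^ 4) * ennreal (r ^ 4 * (ln (1 / r ^ 4) + 4 * (pi\<^sup>2 + 1)) / (32 * pi\<^sup>2))"
  proof -
    have "ln (1 / r\<^sup>2) \<ge> 0" using r by (simp add: ln_div power_le_one)
    moreover have "ln (1 / r ^ 4) = 2 * ln (1 / r\<^sup>2)"
      using r by (simp add: ln_div ln_realpow)
    ultimately show ?thesis
      by (simp add: ennreal_plus[symmetric] ennreal_mult'[symmetric] del: ennreal_plus)
        (simp add: field_simps eval_nat_numeral)
  qed
  finally show ?thesis
    by (subst (asm) ennreal_mult_le_mult_iff) (auto simp: ennreal_mult_eq_top_iff)
qed

section \<open>Level sets\<close>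

text \<open>If \<open>a\<close> and \<open>b\<close> are within a factor 2 of each other, then
  \<open>a + b\<close> is at most three times the smaller one; otherwise
  \<open>\<bar>b - a\<bar>\<close> is already at least \<open>b / 2\<close>. It is applied to square
  roots of indices, so that the first alternative measures the distance of the indices.\<close>

lemma min_sqrt_gap:
  fixes a b :: real
  assumes "a \<ge> 1" "b \<ge> 1"
  shows "min \<bar>b\<^sup>2 - a\<^sup>2\<bar> b / 3 \<le> min a b * \<bar>b - a\<bar>"
proof -
  have sq: "\<bar>b\<^sup>2 - a\<^sup>2\<bar> = \<bar>b - a\<bar> * (a + b)"
    using assms by (simp add: power2_eq_square square_diff_square_factored abs_mult mult.commute add.commute)
  show ?thesis
  proof (cases "max a b \<le> 2 * min a b")
    case True
    then have "\<bar>b - a\<bar> * ((a + b) / 3) \<le> \<bar>b - a\<bar> * min a b"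
      using assms by (intro mult_left_mono) (auto simp: min_def max_def split: if_splits)
    then show ?thesis
      using sq by (simp add: min_def[of "\<bar>b\<^sup>2 - a\<^sup>2\<bar>"] mult.commute)
  next
    case False
    then have "b / 2 \<le> \<bar>b - a\<bar>"
      by (auto simp: min_def max_def split: if_splits)
    also have "\<dots> \<le> min a b * \<bar>b - a\<bar>"
      using mult_right_mono[of 1 "min a b" "\<bar>b - a\<bar>"] assms by simp
    finally have "b / 2 \<le> min a b * \<bar>b - a\<bar>" .
    then show ?thesis
      using assms by (simp add: min_def[of "\<bar>b\<^sup>2 - a\<^sup>2\<bar>"])
  qed
qed

text \<open>This is the fourth power of \<open>y \<le> exp y\<close> at
  \<open>y = sqrt j / 24\<close>, where 24 = 4 * 6; the resulting bound is summable in
  \<open>j\<close>.\<close>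

lemma exp_minus_sqrt_le:
  assumes "j > 0"
  shows "exp (- sqrt (real j) / 6) \<le> 24 ^ 4 / (real j)\<^sup>2"
proof -
  let ?y = "sqrt (real j) / 24"
  have "?y \<le> exp ?y" using exp_ge_add_one_self[of ?y] by linarith
  then have "?y ^ 4 \<le> exp ?y ^ 4" by (intro power_mono) auto
  also have "exp ?y ^ 4 = exp (sqrt (real j) / 6)"
    by (simp add: exp_of_nat_mult[symmetric])
  finally have "?y ^ 4 \<le> exp (sqrt (real j) / 6)" .
  moreover have "sqrt (real j) ^ 4 = (real j)\<^sup>2"
    using power_mult[of "sqrt (real j)" 2 2] by simp
  ultimately have "(real j)\<^sup>2 / 24 ^ 4 \<le> exp (sqrt (real j) / 6)"
    by (simp add: power_divide)
  then show ?thesis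
    using assms by (simp add: exp_minus field_simps)
qed

text \<open>Two geometric series, one to each side of \<open>p\<close>. The point of the bound is
  that it is uniform in \<open>p\<close>, since the index at which the level function is minimal is
  not under control.\<close>

lemma sum_exp_minus_dist_le:
  fixes p :: nat
  assumes "finite S"
  shows "(\<Sum>j\<in>S. exp (- \<bar>real j - real p\<bar> / 6)) \<le> 2 / (1 - exp (- 1 / 6))"
proof -
  define q :: real where "q = exp (- 1 / 6)"
  have q: "0 < q" "q < 1" by (auto simp: q_def)
  have e: "exp (- \<bar>real j - real p\<bar> / 6) = (if j \<ge> p then q ^ (j - p) else q ^ (p - j))" for j
    by (auto simp: q_def exp_of_nat_mult[symmetric] of_nat_diff)
  have geo: "(\<Sum>j\<in>T. q ^ f j) \<le> 1 / (1 - q)" if "finite T" "inj_on f T" for f :: "nat \<Rightarrow> nat" and T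
  proof -
    have "(\<Sum>j\<in>T. q ^ f j) = (\<Sum>i\<in>f ` T. q ^ i)"
      using that by (simp add: sum.reindex)
    also have "\<dots> \<le> (\<Sum>i. q ^ i)"
      using q that by (intro sum_le_suminf) (auto intro: summable_geometric)
    finally show ?thesis using q by (simp add: suminf_geometric)
  qed
  have "(\<Sum>j\<in>S. exp (- \<bar>real j - real p\<bar> / 6)) \<le> (\<Sum>j\<in>S \<inter> {p..}. q ^ (j - p)) + (\<Sum>j\<in>S \<inter> {..p}. q ^ (p - j))"
  proof -
    have "(\<Sum>j\<in>S. exp (- \<bar>real j - real p\<bar> / 6)) \<le>
       (\<Sum>j\<in>S. (if j \<in> {p..} then q ^ (j - p) else 0) + (if j \<in> {..p} then q ^ (p - j) else 0))"
      using q by (intro sum_mono) (simp only: e, auto)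
    then show ?thesis
      using assms by (simp only: sum.distrib sum.inter_restrict)
  qed
  also have "\<dots> \<le> 1 / (1 - q) + 1 / (1 - q)"
    using assms by (intro add_mono geo) (auto simp: inj_on_def)
  finally show ?thesis by (simp add: q_def)
qed

text \<open>With \<open>F j = ln (1 / m j) - j\<close> the hypothesis reads
  \<open>2 * sqrt i * (sqrt j - sqrt i) \<le> 3 * F i + F j + C\<close>. Comparing every index with the one
  minimising \<open>F\<close> shows that \<open>F\<close> grows away from its minimum fast enough.\<close>

lemma level_sum_bounded:
  fixes C :: real
  obtains B where "\<And>m J n. J \<ge> 1 \<Longrightarrow> (\<And>j. m j \<ge> 0) \<Longrightarrow>
    (\<And>i j. J \<le> i \<Longrightarrow> i \<le> j \<Longrightarrow> m i > 0 \<Longrightarrow> m j > 0 \<Longrightarrow>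
       (sqrt (real i) + sqrt (real j))\<^sup>2 \<le> 3 * ln (1 / m i) + ln (1 / m j) + C) \<Longrightarrow>
    (\<Sum>j\<in>{J..n}. exp (real j) * m j) \<le> B"
proof -
  \<comment> \<open>\<open>B\<close> depends on \<open>C\<close> alone. This uniformity is what
    turns the estimate for one function into a finite supremum.\<close>
  define B where "B = exp (C / 4) * (2 / (1 - exp (- 1 / 6)) + (\<Sum>j. 24 ^ 4 * (1 / (real (Suc j))\<^sup>2)))"
  have summ: "summable (\<lambda>j. 24 ^ 4 * (1 / (real (Suc j))\<^sup>2))"
    using inverse_power_summable[of 2, where 'a = real] 
    by (intro summable_mult) (subst summable_Suc_iff, simp add: inverse_eq_divide power_divide)
  have B0: "B \<ge> 0"
    unfolding B_def by (intro mult_nonneg_nonneg add_nonneg_nonneg suminf_nonneg summ) auto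
  have "(\<Sum>j\<in>{J..n}. exp (real j) * m j) \<le> B" if J: "J \<ge> 1" and m: "\<And>j. m j \<ge> 0" and
    h: "\<And>i j. J \<le> i \<Longrightarrow> i \<le> j \<Longrightarrow> m i > 0 \<Longrightarrow> m j > 0 \<Longrightarrow>
       (sqrt (real i) + sqrt (real j))\<^sup>2 \<le> 3 * ln (1 / m i) + ln (1 / m j) + C" for m J n
  proof -
    define S where "S = {j \<in> {J..n}. m j > 0}"
    define F where "F j = ln (1 / m j) - real j" for j
    have fin: "finite S" by (simp add: S_def)
    have "(\<Sum>j\<in>{J..n}. exp (real j) * m j) = (\<Sum>j\<in>S. exp (real j) * m j)"
      using m by (intro sum.mono_neutral_right) (auto simp: S_def order.order_iff_strict)
    also have "\<dots> \<le> B"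
    proof (cases "S = {}")
      case False
      then obtain p where p: "p \<in> S" "\<And>j. j \<in> S \<Longrightarrow> F p \<le> F j"
        using arg_min_if_finite(1)[OF fin, of F] arg_min_least[OF fin, of _ F] by blast
      have key: "exp (real j) * m j \<le> exp (C / 4) * (exp (- \<bar>real j - real p\<bar> / 6) + exp (- sqrt (real j) / 6))"
        if j: "j \<in> S" for j
      proof -
        define a b where "a = sqrt (real p)" and "b = sqrt (real j)"
        have ab: "a \<ge> 1" "b \<ge> 1" "a\<^sup>2 = real p" "b\<^sup>2 = real j"
          using p j J by (auto simp: a_def b_def S_def)
        have eq: "exp (real j) * m j = exp (- F j)"
          using j by (simp add: F_def S_def exp_diff exp_minus ln_div field_simps exp_add)
        \<comment> \<open>The smaller of the two indices takes the place of \<open>i\<close> in the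
          hypothesis. In either order the minimality of \<open>F p\<close> allows both values of
          \<open>F\<close> to be replaced by \<open>F j\<close>, which gives
          \<open>4 * F j\<close>.\<close>
        have "2 * (min a b * \<bar>b - a\<bar>) \<le> 4 * F j + C"
        proof (cases "p \<le> j")
          case True
          have "(a + b)\<^sup>2 \<le> 3 * ln (1 / m p) + ln (1 / m j) + C"
            using h[of p j] p j True by (auto simp: a_def b_def S_def)
          then have "2 * a * b - 2 * a\<^sup>2 \<le> 3 * F p + F j + C"
            using ab by (simp add: F_def power2_sum)
          moreover have "a \<le> b" using True by (simp add: a_def b_def)
          ultimately show ?thesis
            using p(2)[OF j] by (simp add: min_def algebra_simps power2_eq_square)
        next
          case False
          have "(b + a)\<^sup>2 \<le> 3 * ln (1 / m j) + ln (1 / m p) + C"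
            using h[of j p] p j False by (auto simp: a_def b_def S_def)
          then have "2 * a * b - 2 * b\<^sup>2 \<le> 3 * F j + F p + C"
            using ab by (simp add: F_def power2_sum algebra_simps)
          moreover have "b < a" using False by (simp add: a_def b_def)
          ultimately show ?thesis
            using p(2)[OF j] by (simp add: min_def algebra_simps power2_eq_square)
        qed
        \<comment> \<open>The gap carries the factor 2, loses 3 in \<open>min_sqrt_gap\<close>, and
          \<open>F j\<close> carries 4: hence \<open>2 / (3 * 4) = 1 / 6\<close>.\<close>
        with min_sqrt_gap[OF ab(1,2)] have "min \<bar>b\<^sup>2 - a\<^sup>2\<bar> b / 6 - C / 4 \<le> F j"
          by linarith
        then have "exp (- F j) \<le> exp (C / 4 - min \<bar>b\<^sup>2 - a\<^sup>2\<bar> b / 6)"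
          by simp
        also have "\<dots> = exp (C / 4) * exp (- min \<bar>b\<^sup>2 - a\<^sup>2\<bar> b / 6)"
          by (simp add: exp_add[symmetric])
        also have "\<dots> \<le> exp (C / 4) * (exp (- \<bar>b\<^sup>2 - a\<^sup>2\<bar> / 6) + exp (- b / 6))"
          by (intro mult_left_mono) (auto simp: min_def)
        finally show ?thesis
          using eq ab by (simp add: b_def)
      qed
      have "(\<Sum>j\<in>S. exp (real j) * m j) \<le> (\<Sum>j\<in>S. exp (C / 4) * (exp (- \<bar>real j - real p\<bar> / 6) + exp (- sqrt (real j) / 6)))"
        by (intro sum_mono key)
      also have "\<dots> = exp (C / 4) * ((\<Sum>j\<in>S. exp (- \<bar>real j - real p\<bar> / 6)) + (\<Sum>j\<in>S. exp (- sqrt (real j) / 6)))"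
        by (simp only: sum_distrib_left[symmetric] sum.distrib)
      also have "\<dots> \<le> B"
        unfolding B_def
      proof (intro mult_left_mono add_mono sum_exp_minus_dist_le fin)
        have pos: "j > 0" if "j \<in> S" for j using that J by (auto simp: S_def)
        have "(\<Sum>j\<in>S. exp (- sqrt (real j) / 6)) \<le> (\<Sum>j\<in>S. 24 ^ 4 * (1 / (real j)\<^sup>2))"
          using exp_minus_sqrt_le pos by (intro sum_mono) simp
        also have "\<dots> = (\<Sum>i\<in>(\<lambda>j. j - 1) ` S. 24 ^ 4 * (1 / (real (Suc i))\<^sup>2))"
        proof (subst sum.reindex)
          show "inj_on (\<lambda>j. j - 1) S"
            by (rule inj_onI) (metis One_nat_def Suc_pred pos)
        qed (use pos in \<open>auto intro!: sum.cong simp: of_nat_diff Suc_leI\<close>)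
        also have "\<dots> \<le> (\<Sum>i. 24 ^ 4 * (1 / (real (Suc i))\<^sup>2))"
          by (intro sum_le_suminf summ) (auto simp: fin)
        finally show "(\<Sum>j\<in>S. exp (- sqrt (real j) / 6)) \<le> (\<Sum>i. 24 ^ 4 * (1 / (real (Suc i))\<^sup>2))" .
      qed simp
      finally show ?thesis .
    qed (simp add: B0)
    finally show ?thesis .
  qed
  then show ?thesis using that by blast
qed

text \<open>Chebyshev's inequality for the square of \<open>u\<close>.\<close>

lemma emeasure_superlevel_le:
  fixes u :: "'a::euclidean_space \<Rightarrow> real"
  assumes [measurable]: "u \<in> borel_measurable borel" and A: "(\<integral>\<^sup>+x. ennreal ((u x)\<^sup>2) \<partial>lborel) \<le> ennreal A" "A \<ge> 0" and s: "s > 0"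
  shows "emeasure lborel {x. u x > s} \<le> ennreal (A / s\<^sup>2)"
proof -
  have "emeasure lborel {x. u x > s} = (\<integral>\<^sup>+x. indicator {x. u x > s} x \<partial>lborel)"
    by simp
  also have "\<dots> \<le> (\<integral>\<^sup>+x. ennreal (1 / s\<^sup>2) * ennreal ((u x)\<^sup>2) \<partial>lborel)"
  proof (intro nn_integral_mono)
    fix x
    have "1 \<le> 1 / s\<^sup>2 * (u x)\<^sup>2" if "u x > s"
      using that s power_mono[of s "u x" 2] by (simp add: field_simps)
    then show "indicator {x. u x > s} x \<le> ennreal (1 / s\<^sup>2) * ennreal ((u x)\<^sup>2)"
      by (auto simp: ennreal_mult'[symmetric] split: split_indicator intro: order_trans[OF _ ennreal_leI[of 1]])
  qed
  also have "\<dots> = ennreal (1 / s\<^sup>2) * (\<integral>\<^sup>+x. ennreal ((u x)\<^sup>2) \<partial>lborel)"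
    by (simp add: nn_integral_cmult)
  also have "\<dots> \<le> ennreal (1 / s\<^sup>2) * ennreal A"
    by (intro mult_left_mono A) auto
  finally show ?thesis using A by (simp add: ennreal_mult'[symmetric])
qed

text \<open>Put \<open>w = \<beta> * u\<^sup>2\<close>. Where \<open>w\<close> is at most
  \<open>J\<close>, \<open>exp w - 1 \<le> w * exp w\<close> bounds the integrand by a multiple of
  \<open>u\<^sup>2\<close>; elsewhere \<open>w\<close> lies between some \<open>j\<close> and
  \<open>j + 1\<close> and the integrand is at most \<open>exp (j + 1)\<close>. The rounding costs
  \<open>exp 1\<close>, and the two signs of \<open>u\<close> cost 2.\<close>

lemma exp_int_le_level_sums:
  fixes u :: "'a::euclidean_space \<Rightarrow> real"
  assumes u[measurable]: "u \<in> borel_measurable borel" and A: "(\<integral>\<^sup>+x. ennreal ((u x)\<^sup>2) \<partial>lborel) \<le> ennreal A" "A \<ge> 0"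
    and \<beta>: "\<beta> > 0" and J: "J \<ge> 1"
    and B: "\<And>n. (\<Sum>j\<in>{J..n}. exp (real j) * measure lborel {x. u x > sqrt (real j / \<beta>)}) \<le> B"
      "\<And>n. (\<Sum>j\<in>{J..n}. exp (real j) * measure lborel {x. - u x > sqrt (real j / \<beta>)}) \<le> B"
  shows "exp_int \<beta> u \<le> ennreal (\<beta> * exp (real J) * A + 2 * exp 1 * B)"
proof -
  define P where "P j = {x. u x > sqrt (real j / \<beta>)}" for j :: nat
  define N where "N j = {x. - u x > sqrt (real j / \<beta>)}" for j :: nat
  have [measurable]: "P j \<in> sets borel" "N j \<in> sets borel" for j
    unfolding P_def N_def by measurable
  have finP: "emeasure lborel (P j) < \<infinity>" and finN: "emeasure lborel (N j) < \<infinity>" if "j \<ge> J" for j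
    using emeasure_superlevel_le[OF u A, of "sqrt (real j / \<beta>)"]
      emeasure_superlevel_le[of "\<lambda>x. - u x" A "sqrt (real j / \<beta>)"] A \<beta> that J
    by (auto simp: P_def N_def intro: le_less_trans)
  have B0: "B \<ge> 0"
    using order_trans[OF sum_nonneg B(1)[of 0]] by (simp add: zero_le_mult_iff)
  let ?g = "\<lambda>x j. ennreal (exp (real j + 1)) * (indicator {J..} j * (indicator (P j) x + indicator (N j) x))"
  have pw: "ennreal (exp (\<beta> * (u x)\<^sup>2) - 1) \<le> ennreal (\<beta> * exp (real J)) * ennreal ((u x)\<^sup>2) + (\<Sum>j. ?g x j)" for x
  proof -
    define w where "w = \<beta> * (u x)\<^sup>2"
    have w0: "w \<ge> 0" using \<beta> by (simp add: w_def)
    show ?thesis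
    proof (cases "w \<le> real J")
      case True
      have "exp w * (1 - w) \<le> exp w * exp (- w)"
        using exp_ge_add_one_self[of "- w"] by (intro mult_left_mono) auto
      then have "exp w - 1 \<le> exp w * w"
        by (simp add: algebra_simps exp_minus)
      also have "\<dots> \<le> exp (real J) * w"
        using True w0 by (intro mult_right_mono) auto
      finally have "ennreal (exp w - 1) \<le> ennreal (\<beta> * exp (real J)) * ennreal ((u x)\<^sup>2)"
        using \<beta> by (simp add: w_def ennreal_mult'[symmetric] mult_ac ennreal_leI)
      then show ?thesis
        unfolding w_def by (rule order_trans) simp
    next
      case False
      \<comment> \<open>The ceiling minus one, not the floor: this makes \<open>j < w\<close>
        strict, as the strict superlevel sets require, while \<open>J \<le> j\<close> still holds
        because \<open>w > J\<close>.\<close>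
      define j where "j = nat (\<lceil>w\<rceil> - 1)"
      have j: "real j < w" "w \<le> real j + 1" "J \<le> j"
        using False w0 unfolding j_def by linarith+
      have "sqrt (real j / \<beta>) < \<bar>u x\<bar>"
        using j(1) \<beta> real_sqrt_less_mono[of "real j / \<beta>" "(u x)\<^sup>2"] by (simp add: w_def field_simps)
      then have "x \<in> P j \<or> x \<in> N j"
        by (auto simp: P_def N_def abs_if split: if_splits)
      then have one: "1 \<le> (indicator {J..} j * (indicator (P j) x + indicator (N j) x) :: ennreal)"
        using j(3) by (auto simp: indicator_def)
      have "exp w \<le> exp (real j + 1)" using j(2) by simp
      then have "exp w - 1 \<le> exp (real j + 1)" by linarith
      then have "ennreal (exp w - 1) \<le> ennreal (exp (real j + 1)) * 1"
        by (simp add: ennreal_leI)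
      also have "\<dots> \<le> ?g x j"
        by (intro mult_left_mono one) simp
      also have "\<dots> \<le> (\<Sum>j. ?g x j)"
        using sum_le_suminf[of "?g x" "{j}"] by (simp add: summableI)
      finally show ?thesis
        unfolding w_def by (rule order_trans) simp
    qed
  qed
  have "exp_int \<beta> u \<le> (\<integral>\<^sup>+x. ennreal (\<beta> * exp (real J)) * ennreal ((u x)\<^sup>2) + (\<Sum>j. ?g x j) \<partial>lborel)"
    unfolding exp_int_def by (intro nn_integral_mono pw)
  also have "\<dots> = ennreal (\<beta> * exp (real J)) * (\<integral>\<^sup>+x. ennreal ((u x)\<^sup>2) \<partial>lborel) + (\<Sum>j. \<integral>\<^sup>+x. ?g x j \<partial>lborel)"
    by (subst nn_integral_add) (simp_all add: nn_integral_cmult nn_integral_suminf)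
  also have "\<dots> = ennreal (\<beta> * exp (real J)) * (\<integral>\<^sup>+x. ennreal ((u x)\<^sup>2) \<partial>lborel)
      + (\<Sum>j. ennreal (exp (real j + 1)) * (indicator {J..} j * (emeasure lborel (P j) + emeasure lborel (N j))))"
    by (simp add: nn_integral_cmult nn_integral_add)
  finally have le: "exp_int \<beta> u \<le> \<dots>" .
  have low: "ennreal (\<beta> * exp (real J)) * (\<integral>\<^sup>+x. ennreal ((u x)\<^sup>2) \<partial>lborel) \<le> ennreal (\<beta> * exp (real J)) * ennreal A"
    by (intro mult_left_mono A) auto
  have high: "(\<Sum>j. ennreal (exp (real j + 1)) * (indicator {J..} j * (emeasure lborel (P j) + emeasure lborel (N j)))) \<le> ennreal (2 * exp 1 * B)"
  proof (rule suminf_le_const[OF summableI])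
    fix n
    have "(\<Sum>j<n. ennreal (exp (real j + 1)) * (indicator {J..} j * (emeasure lborel (P j) + emeasure lborel (N j))))
      \<le> (\<Sum>j\<in>{..n}. ennreal (exp (real j + 1)) * (indicator {J..} j * (emeasure lborel (P j) + emeasure lborel (N j))))"
      by (intro sum_mono2) auto
    also have "\<dots> = (\<Sum>j\<in>{J..n}. ennreal (exp (real j + 1)) * (indicator {J..} j * (emeasure lborel (P j) + emeasure lborel (N j))))"
      by (intro sum.mono_neutral_right) auto
    also have "\<dots> = (\<Sum>j\<in>{J..n}. ennreal (exp 1 * (exp (real j) * measure lborel (P j)) + exp 1 * (exp (real j) * measure lborel (N j))))"
    proof (intro sum.cong refl)
      fix j assume j: "j \<in> {J..n}"
      have "emeasure lborel (P j) = ennreal (measure lborel (P j))" "emeasure lborel (N j) = ennreal (measure lborel (N j))"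
        using finP finN j by (auto intro!: emeasure_eq_ennreal_measure simp: less_top[symmetric] dest: less_imp_neq)
      then show "ennreal (exp (real j + 1)) * (indicator {J..} j * (emeasure lborel (P j) + emeasure lborel (N j))) =
        ennreal (exp 1 * (exp (real j) * measure lborel (P j)) + exp 1 * (exp (real j) * measure lborel (N j)))"
        using j by (simp add: ennreal_plus[symmetric] ennreal_mult'[symmetric] exp_add algebra_simps del: ennreal_plus)
    qed
    also have "\<dots> = ennreal (exp 1 * (\<Sum>j\<in>{J..n}. exp (real j) * measure lborel (P j)) + exp 1 * (\<Sum>j\<in>{J..n}. exp (real j) * measure lborel (N j)))"
      by (subst sum_ennreal) (auto simp: sum.distrib sum_distrib_left)
    also have "\<dots> \<le> ennreal (exp 1 * B + exp 1 * B)"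
      unfolding P_def N_def by (intro ennreal_leI add_mono mult_left_mono B) auto
    finally show "(\<Sum>j<n. ennreal (exp (real j + 1)) * (indicator {J..} j * (emeasure lborel (P j) + emeasure lborel (N j)))) \<le> ennreal (2 * exp 1 * B)"
      by (simp add: mult_ac)
  qed
  from order_trans[OF le add_mono[OF low high]] show ?thesis
    using \<beta> A B0 by (simp add: ennreal_plus[symmetric] ennreal_mult'[symmetric] del: ennreal_plus)
qed

section \<open>Cut-off fundamental solution of the Laplacian\<close>

text \<open>Radial functions are written in the squared distance, a polynomial in the coordinates.
  The centre \<open>x = a\<close> is then no exceptional point, and \<open>h\<close> matters only at
  arguments \<open>s \<ge> 0\<close>.\<close>

lemma has_partial_radial:
  assumes h: "\<And>s. s \<ge> 0 \<Longrightarrow> (h has_real_derivative h1 s) (at s)" and "v \<in> Basis"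
  shows "((\<lambda>t. h ((x + t *\<^sub>R v - a) \<bullet> (x + t *\<^sub>R v - a))) has_real_derivative
    2 * ((x - a) \<bullet> v) * h1 ((x - a) \<bullet> (x - a))) (at 0)"
proof -
  have e: "(x + t *\<^sub>R v - a) \<bullet> (x + t *\<^sub>R v - a) = (x - a) \<bullet> (x - a) + 2 * t * ((x - a) \<bullet> v) + t\<^sup>2" for t
    using assms(2) by (simp add: inner_diff_left inner_diff_right inner_add_left inner_add_right power2_eq_square
      inner_commute algebra_simps)
  have "((\<lambda>t. h ((x - a) \<bullet> (x - a) + 2 * t * ((x - a) \<bullet> v) + t\<^sup>2)) has_real_derivative
     h1 ((x - a) \<bullet> (x - a)) * (2 * ((x - a) \<bullet> v))) (at 0)"
    by (rule DERIV_chain2[of h]) (auto intro!: derivative_eq_intros h)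
  then show ?thesis by (simp only: e) (simp add: mult_ac)
qed

lemma partial_radial:
  assumes "\<And>s. s \<ge> 0 \<Longrightarrow> (h has_real_derivative h1 s) (at s)" and "v \<in> Basis"
  shows "partial v (\<lambda>x. h ((x - a) \<bullet> (x - a))) = (\<lambda>x. 2 * ((x - a) \<bullet> v) * h1 ((x - a) \<bullet> (x - a)))"
  by (intro ext partial_eqI has_partial_radial assms)

lemma partial_partial_radial:
  assumes h: "\<And>s. s \<ge> 0 \<Longrightarrow> (h has_real_derivative h1 s) (at s)"
    and h1: "\<And>s. s \<ge> 0 \<Longrightarrow> (h1 has_real_derivative h2 s) (at s)" and v: "v \<in> Basis"
  shows "partial v (partial v (\<lambda>x. h ((x - a) \<bullet> (x - a)))) x
    = 2 * h1 ((x - a) \<bullet> (x - a)) + 4 * ((x - a) \<bullet> v)\<^sup>2 * h2 ((x - a) \<bullet> (x - a))"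
proof -
  have d: "((\<lambda>t. 2 * ((x + t *\<^sub>R v - a) \<bullet> v)) has_real_derivative 2) (at 0)"
    using v by (auto simp: inner_diff_left inner_add_left intro!: derivative_eq_intros)
  have eq: "partial v (\<lambda>x. h ((x - a) \<bullet> (x - a))) = (\<lambda>x. 2 * ((x - a) \<bullet> v) * h1 ((x - a) \<bullet> (x - a)))"
    by (rule partial_radial[OF h v])
  show ?thesis
    unfolding eq
    by (rule partial_eqI, rule DERIV_cong[OF DERIV_mult[OF d has_partial_radial[OF h1 v, of x a]]])
      (simp_all add: power2_eq_square)
qed

lemma laplacian_radial:
  fixes a x :: "'a::euclidean_space"
  assumes "\<And>s. s \<ge> 0 \<Longrightarrow> (h has_real_derivative h1 s) (at s)"
    and "\<And>s. s \<ge> 0 \<Longrightarrow> (h1 has_real_derivative h2 s) (at s)"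
  shows "(\<Sum>b\<in>Basis. partial b (partial b (\<lambda>x. h ((x - a) \<bullet> (x - a)))) x)
    = 2 * real DIM('a) * h1 ((x - a) \<bullet> (x - a)) + 4 * ((x - a) \<bullet> (x - a)) * h2 ((x - a) \<bullet> (x - a))"
proof -
  have "(\<Sum>b\<in>Basis. partial b (partial b (\<lambda>x. h ((x - a) \<bullet> (x - a)))) x) =
    (\<Sum>b\<in>Basis. 2 * h1 ((x - a) \<bullet> (x - a)) + 4 * ((x - a) \<bullet> b)\<^sup>2 * h2 ((x - a) \<bullet> (x - a)))"
    using assms by (intro sum.cong refl partial_partial_radial)
  also have "\<dots> = 2 * real DIM('a) * h1 ((x - a) \<bullet> (x - a)) + 4 * (\<Sum>b\<in>Basis. ((x - a) \<bullet> b)\<^sup>2) * h2 ((x - a) \<bullet> (x - a))"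
    by (simp add: sum.distrib sum_distrib_left sum_distrib_right)
  also have "(\<Sum>b\<in>Basis. ((x - a) \<bullet> b)\<^sup>2) = (x - a) \<bullet> (x - a)"
    by (subst euclidean_inner) (simp add: power2_eq_square)
  finally show ?thesis .
qed

lemma gradient_sq_radial:
  fixes a x :: "'a::euclidean_space"
  assumes "\<And>s. s \<ge> 0 \<Longrightarrow> (h has_real_derivative h1 s) (at s)"
  shows "(\<Sum>b\<in>Basis. (partial b (\<lambda>x. h ((x - a) \<bullet> (x - a))) x)\<^sup>2)
    = 4 * ((x - a) \<bullet> (x - a)) * (h1 ((x - a) \<bullet> (x - a)))\<^sup>2"
proof -
  have "(\<Sum>b\<in>Basis. (partial b (\<lambda>x. h ((x - a) \<bullet> (x - a))) x)\<^sup>2) =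
    (\<Sum>b\<in>Basis. 4 * ((x - a) \<bullet> b)\<^sup>2 * (h1 ((x - a) \<bullet> (x - a)))\<^sup>2)"
  proof (intro sum.cong refl)
    fix b :: 'a assume b: "b \<in> Basis"
    have eq: "partial b (\<lambda>x. h ((x - a) \<bullet> (x - a))) = (\<lambda>x. 2 * ((x - a) \<bullet> b) * h1 ((x - a) \<bullet> (x - a)))"
      by (rule partial_radial[OF assms b])
    show "(partial b (\<lambda>x. h ((x - a) \<bullet> (x - a))) x)\<^sup>2 = 4 * ((x - a) \<bullet> b)\<^sup>2 * (h1 ((x - a) \<bullet> (x - a)))\<^sup>2"
      unfolding eq by (simp add: power_mult_distrib)
  qed
  also have "\<dots> = 4 * (\<Sum>b\<in>Basis. ((x - a) \<bullet> b)\<^sup>2) * (h1 ((x - a) \<bullet> (x - a)))\<^sup>2"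
    by (simp add: sum_distrib_left sum_distrib_right)
  also have "(\<Sum>b\<in>Basis. ((x - a) \<bullet> b)\<^sup>2) = (x - a) \<bullet> (x - a)"
    by (subst euclidean_inner) (simp add: power2_eq_square)
  finally show ?thesis .
qed

text \<open>A cut-off in the squared distance: \<open>exp (1 - 1 / (1 - s))\<close> for
  \<open>s < 1\<close> and 0 beyond, normalised to 1 at 0. It has no plateau around 0, so its
  derivatives also act near the pole of the kernel.\<close>

definition eta :: "real \<Rightarrow> real" where "eta s = exp 1 * flat 1 (1 - s)"
definition eta1 :: "real \<Rightarrow> real" where "eta1 s = - exp 1 * flat (flat_deriv 1) (1 - s)"
definition eta2 :: "real \<Rightarrow> real" where "eta2 s = exp 1 * flat (flat_deriv (flat_deriv 1)) (1 - s)"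

lemma flat_reflected_deriv:
  "((\<lambda>s. c * flat p (1 - s)) has_real_derivative - c * flat (flat_deriv p) (1 - s)) (at s)"
proof -
  have "((\<lambda>s. flat p (1 - s)) has_real_derivative flat (flat_deriv p) (1 - s) * (- 1)) (at s)"
    by (rule DERIV_chain2[OF flat_has_derivative]) (auto intro!: derivative_eq_intros)
  from DERIV_cmult[OF this, of c] show ?thesis by simp
qed

lemma eta_deriv: "(eta has_real_derivative eta1 s) (at s)"
  unfolding eta_def[abs_def] eta1_def by (rule flat_reflected_deriv)

lemma eta1_deriv: "(eta1 has_real_derivative eta2 s) (at s)"
  unfolding eta1_def[abs_def] eta2_def
  using flat_reflected_deriv[of "- exp 1" "flat_deriv 1" s] by simp

lemma eta_outside: "s \<ge> 1 \<Longrightarrow> eta s = 0" "s \<ge> 1 \<Longrightarrow> eta1 s = 0" "s \<ge> 1 \<Longrightarrow> eta2 s = 0"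
  by (simp_all add: eta_def eta1_def eta2_def flat_def)

lemma eta_nonneg: "eta s \<ge> 0"
  by (simp add: eta_def flat_1)

lemma eta_le_1: "s \<ge> 0 \<Longrightarrow> eta s \<le> 1"
  by (cases "s < 1") (auto simp: eta_def flat_1 exp_add[symmetric] field_simps)

lemma eta_0: "eta 0 = 1"
  by (simp add: eta_def flat_1 exp_add[symmetric])

lemma eta_continuous: "continuous_on A eta" "continuous_on A eta1" "continuous_on A eta2"
proof -
  have c: "continuous_on A (\<lambda>s. flat p (1 - s))" for p
    by (rule continuous_on_compose2[OF continuous_on_flat[of UNIV]]) (auto intro!: continuous_intros)
  show "continuous_on A eta" "continuous_on A eta1" "continuous_on A eta2"
    unfolding eta_def[abs_def] eta1_def[abs_def] eta2_def[abs_def] by (intro continuous_intros c)+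
qed

lemma eta_bound:
  obtains H where "H \<ge> 1" "\<And>s. s \<ge> 0 \<Longrightarrow> \<bar>eta1 s\<bar> \<le> H" "\<And>s. s \<ge> 0 \<Longrightarrow> \<bar>eta2 s\<bar> \<le> H"
proof -
  have "bounded (eta1 ` {0..1})" "bounded (eta2 ` {0..1})"
    by (intro compact_imp_bounded compact_continuous_image eta_continuous compact_Icc)+
  then obtain A B where A: "\<And>s. s \<in> {0..1} \<Longrightarrow> \<bar>eta1 s\<bar> \<le> A" and B: "\<And>s. s \<in> {0..1} \<Longrightarrow> \<bar>eta2 s\<bar> \<le> B"
    unfolding bounded_iff by (metis image_eqI real_norm_def)
  show ?thesis
  proof (rule that[of "max 1 (max A B)"])
    show "\<bar>eta1 s\<bar> \<le> max 1 (max A B)" "\<bar>eta2 s\<bar> \<le> max 1 (max A B)" if "s \<ge> 0" for s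
      using A[of s] B[of s] eta_outside[of s] that by (cases "s \<le> 1"; force)+
  qed simp
qed

lemma Cinf_eta: "Cinf (\<lambda>x. eta ((x - a) \<bullet> (x - a)))"
  unfolding eta_def by (intro Cinf_times Cinf_const Cinf_flat Cinf_minus Cinf_inner_self)

lemma test_fun_eta: "test_fun (\<lambda>x. eta ((x - a) \<bullet> (x - a)))"
proof (rule test_funI[OF Cinf_eta])
  show "compact (cball a 1)" by simp
  fix x assume "eta ((x - a) \<bullet> (x - a)) \<noteq> 0"
  then have "(x - a) \<bullet> (x - a) < 1" using eta_outside(1) not_le by blast
  then show "x \<in> cball a 1"
    by (subst mem_cball, subst dist_commute) (simp add: dist_norm norm_eq_sqrt_inner)
qed

lemma Cinf_inverse_radial:
  assumes "e > 0"
  shows "Cinf (\<lambda>x. inverse ((x - a) \<bullet> (x - a) + e\<^sup>2))"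
proof (rule Cinf_inverse)
  show "(x - a) \<bullet> (x - a) + e\<^sup>2 \<noteq> 0" for x
    using inner_ge_zero[of "x - a"] assms by (metis add_nonneg_pos less_irrefl zero_less_power)
qed (intro Cinf_plus Cinf_inner_self Cinf_const)

text \<open>The fundamental solution with its pole smoothed at scale \<open>e\<close> and cut off at
  distance 1, which makes it a test function.\<close>

definition cutkern :: "real \<Rightarrow> real^4 \<Rightarrow> real" where
  "cutkern e z = eta (z \<bullet> z) / (4 * pi\<^sup>2 * (z \<bullet> z + e\<^sup>2))"
text \<open>Minus the Laplacian of
  \<open>1 / (4 * pi\<^sup>2 * (z \<bullet> z + e\<^sup>2))\<close>, times the cut-off. It is an
  approximate identity at scale \<open>e\<close>.\<close>

definition cutbubble :: "real \<Rightarrow> real^4 \<Rightarrow> real" where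
  "cutbubble e z = 2 * e\<^sup>2 * eta (z \<bullet> z) / (pi\<^sup>2 * (z \<bullet> z + e\<^sup>2) ^ 3)"
text \<open>The terms of the Laplacian of \<open>cutkern\<close> in which a derivative falls on the
  cut-off. The factors \<open>z \<bullet> z\<close> and \<open>e\<^sup>2\<close> in the numerators
  tame the pole.\<close>

definition cutrest :: "real \<Rightarrow> real^4 \<Rightarrow> real" where
  "cutrest e z = (4 * (z \<bullet> z) * eta2 (z \<bullet> z) / (z \<bullet> z + e\<^sup>2) + 8 * e\<^sup>2 * eta1 (z \<bullet> z) / (z \<bullet> z + e\<^sup>2)\<^sup>2) / (4 * pi\<^sup>2)"

lemma test_fun_cutkern:
  assumes "e > 0" shows "test_fun (\<lambda>y. cutkern e (y - x))"
proof -
  have eq: "(\<lambda>y. cutkern e (y - x)) = (\<lambda>y. (1 / (4 * pi\<^sup>2) * inverse ((y - x) \<bullet> (y - x) + e\<^sup>2)) * eta ((y - x) \<bullet> (y - x)))"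
    by (rule ext) (simp add: cutkern_def inverse_eq_divide)
  show ?thesis
    unfolding eq by (rule test_fun_times[OF test_fun_eta]) (intro Cinf_times Cinf_const Cinf_inverse_radial assms)
qed

lemma test_fun_cutbubble:
  assumes "e > 0" shows "test_fun (\<lambda>y. cutbubble e (y - x))"
proof -
  have eq: "(\<lambda>y. cutbubble e (y - x)) = (\<lambda>y. (2 * e\<^sup>2 / pi\<^sup>2 * (inverse ((y - x) \<bullet> (y - x) + e\<^sup>2)) ^ 3) * eta ((y - x) \<bullet> (y - x)))"
    by (rule ext) (simp add: cutbubble_def inverse_eq_divide power_one_over)
  show ?thesis
    unfolding eq by (rule test_fun_times[OF test_fun_eta]) (intro Cinf_times Cinf_const Cinf_power Cinf_inverse_radial assms)
qed

lemma laplacian_cutkern: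
  fixes x y :: "real^4"
  assumes e: "e > 0"
  shows "(\<Sum>b\<in>Basis. partial b (partial b (\<lambda>y. cutkern e (y - x))) y) = cutrest e (y - x) - cutbubble e (y - x)"
proof -
  let ?c = "1 / (4 * pi\<^sup>2)"
  define h where "h s = ?c * (eta s / (s + e\<^sup>2))" for s
  define h1 where "h1 s = ?c * (eta1 s / (s + e\<^sup>2) - eta s / (s + e\<^sup>2)\<^sup>2)" for s
  define h2 where "h2 s = ?c * (eta2 s / (s + e\<^sup>2) - 2 * eta1 s / (s + e\<^sup>2)\<^sup>2 + 2 * eta s / (s + e\<^sup>2) ^ 3)" for s
  have q: "s + e\<^sup>2 > 0" if "s \<ge> 0" for s using e that by (simp add: add_nonneg_pos)
  have d1: "(h has_real_derivative h1 s) (at s)" if "s \<ge> 0" for s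
  proof -
    have "((\<lambda>s. ?c * (eta s / (s + e\<^sup>2))) has_real_derivative ?c * ((eta1 s * (s + e\<^sup>2) - eta s * 1) / ((s + e\<^sup>2) * (s + e\<^sup>2)))) (at s)"
      using q[OF that] by (intro DERIV_cmult DERIV_divide eta_deriv) (auto intro!: derivative_eq_intros)
    moreover have "(eta1 s * (s + e\<^sup>2) - eta s * 1) / ((s + e\<^sup>2) * (s + e\<^sup>2)) = eta1 s / (s + e\<^sup>2) - eta s / (s + e\<^sup>2)\<^sup>2"
      using q[OF that] by (simp add: diff_divide_distrib power2_eq_square)
    ultimately show ?thesis unfolding h_def[abs_def] h1_def by (simp only:)
  qed
  have d2: "(h1 has_real_derivative h2 s) (at s)" if "s \<ge> 0" for s
  proof -
    let ?q = "s + e\<^sup>2"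
    have "((\<lambda>s. ?c * (eta1 s / (s + e\<^sup>2) - eta s / (s + e\<^sup>2)\<^sup>2)) has_real_derivative
       ?c * ((eta2 s * ?q - eta1 s * 1) / (?q * ?q) - (eta1 s * ?q\<^sup>2 - eta s * (2 * ?q)) / (?q\<^sup>2 * ?q\<^sup>2))) (at s)"
      using q[OF that] by (intro DERIV_cmult DERIV_diff DERIV_divide eta_deriv eta1_deriv) (auto intro!: derivative_eq_intros)
    moreover have "(eta2 s * ?q - eta1 s * 1) / (?q * ?q) - (eta1 s * ?q\<^sup>2 - eta s * (2 * ?q)) / (?q\<^sup>2 * ?q\<^sup>2)
      = eta2 s / ?q - 2 * eta1 s / ?q\<^sup>2 + 2 * eta s / ?q ^ 3"
    proof -
      define w where "w = ?q"
      have "w \<noteq> 0" using q[OF that] by (simp add: w_def)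
      then have "(eta2 s * w - eta1 s * 1) / (w * w) - (eta1 s * w\<^sup>2 - eta s * (2 * w)) / (w\<^sup>2 * w\<^sup>2)
        = eta2 s / w - 2 * eta1 s / w\<^sup>2 + 2 * eta s / w ^ 3"
        by (simp add: divide_simps) (simp add: algebra_simps eval_nat_numeral)
      then show ?thesis by (simp only: w_def)
    qed
    ultimately show ?thesis unfolding h1_def[abs_def] h2_def by (simp only:)
  qed
  define s where "s = (y - x) \<bullet> (y - x)"
  have s: "s \<ge> 0" by (simp add: s_def)
  have "(\<lambda>y. cutkern e (y - x)) = (\<lambda>y. h ((y - x) \<bullet> (y - x)))"
    by (simp add: fun_eq_iff cutkern_def h_def)
  then have "(\<Sum>b\<in>Basis. partial b (partial b (\<lambda>y. cutkern e (y - x))) y) = 8 * h1 s + 4 * s * h2 s"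
    using laplacian_radial[of h h1 h2 x y, OF d1 d2] by (simp add: s_def)
  also have "\<dots> = cutrest e (y - x) - cutbubble e (y - x)"
  proof -
    \<comment> \<open>Replacing \<open>e\<^sup>2\<close> by \<open>w - s\<close> makes the identity
      polynomial in \<open>s\<close> and \<open>1 / w\<close>; the two terms with \<open>eta\<close>
      merge into the bubble, and the two terms with \<open>eta1\<close> into one.\<close>
    define w where "w = s + e\<^sup>2"
    have w: "w \<noteq> 0" "e\<^sup>2 = w - s" using q[OF s] by (auto simp: w_def)
    have "8 * (eta1 s / w - eta s / w\<^sup>2) + 4 * s * (eta2 s / w - 2 * eta1 s / w\<^sup>2 + 2 * eta s / w ^ 3)
      = 4 * s * eta2 s / w + 8 * (w - s) * eta1 s / w\<^sup>2 - 8 * (w - s) * eta s / w ^ 3"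
      using w(1) by (simp add: divide_simps) (simp add: algebra_simps eval_nat_numeral)
    then have "?c * (8 * (eta1 s / w - eta s / w\<^sup>2) + 4 * s * (eta2 s / w - 2 * eta1 s / w\<^sup>2 + 2 * eta s / w ^ 3))
      = ?c * (4 * s * eta2 s / w + 8 * (w - s) * eta1 s / w\<^sup>2 - 8 * (w - s) * eta s / w ^ 3)"
      by simp
    moreover have "8 * h1 s + 4 * s * h2 s = ?c * (8 * (eta1 s / w - eta s / w\<^sup>2) + 4 * s * (eta2 s / w - 2 * eta1 s / w\<^sup>2 + 2 * eta s / w ^ 3))"
      unfolding h1_def h2_def w_def by (simp add: field_simps)
    moreover have "cutrest e (y - x) = ?c * (4 * s * eta2 s / w + 8 * (w - s) * eta1 s / w\<^sup>2)"
      unfolding cutrest_def s_def[symmetric] w_def[symmetric] w(2) by simp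
    moreover have "cutbubble e (y - x) = ?c * (8 * (w - s) * eta s / w ^ 3)"
      unfolding cutbubble_def s_def[symmetric] w_def[symmetric] w(2) using w(1) by (simp add: field_simps)
    moreover have "cutrest e (y - x) - cutbubble e (y - x) = ?c * (4 * s * eta2 s / w + 8 * (w - s) * eta1 s / w\<^sup>2 - 8 * (w - s) * eta s / w ^ 3)"
      by (simp only: calculation right_diff_distrib)
    ultimately show ?thesis by simp
  qed
  finally show ?thesis .
qed

lemma test_fun_cutrest:
  assumes "e > 0" shows "test_fun (\<lambda>y. cutrest e (y - x))"
proof (rule test_funI[of _ "cball x 1"])
  \<comment> \<open>The Laplacian identity exhibits \<open>cutrest\<close> as a sum of smooth
    functions, which spares a separate treatment of \<open>eta1\<close> and
    \<open>eta2\<close>.\<close>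
  have "Cinf (\<lambda>y. (\<Sum>b\<in>Basis. partial b (partial b (\<lambda>y. cutkern e (y - x))) y) + cutbubble e (y - x))"
    using test_fun_cutkern[OF assms] test_fun_cutbubble[OF assms] by (intro Cinf_plus Cinf_sum Cinf_partial test_fun_Cinf) auto
  then show "Cinf (\<lambda>y. cutrest e (y - x))" by (simp add: laplacian_cutkern[OF assms])
  fix y assume "cutrest e (y - x) \<noteq> 0"
  then have "(y - x) \<bullet> (y - x) < 1" using eta_outside[of "(y - x) \<bullet> (y - x)"] by (force simp: cutrest_def)
  then show "y \<in> cball x 1"
    by (subst mem_cball, subst dist_commute) (simp add: dist_norm norm_eq_sqrt_inner)
qed simp

section \<open>Representation of Sobolev functions by the regularised kernel\<close>

lemma L2_times_integrable:
  assumes "L2 f" "L2 g" shows "integrable lborel (\<lambda>x. f x * g x)"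
proof -
  have [measurable]: "f \<in> borel_measurable lborel" "g \<in> borel_measurable lborel"
    using assms by (auto simp: L2_def)
  have i: "integrable lborel (\<lambda>x. (f x)\<^sup>2 + (g x)\<^sup>2)"
    using assms by (auto simp: L2_def)
  have le: "\<bar>a * b\<bar> \<le> a\<^sup>2 + b\<^sup>2" for a b :: real
  proof -
    have "2 * \<bar>a * b\<bar> \<le> a\<^sup>2 + b\<^sup>2"
      using sum_squares_bound[of "\<bar>a\<bar>" "\<bar>b\<bar>"] by (simp add: abs_mult mult.assoc)
    then show ?thesis using abs_ge_zero[of "a * b"] by linarith
  qed
  have "AE x in lborel. norm (f x * g x) \<le> norm ((f x)\<^sup>2 + (g x)\<^sup>2)"
    by (rule AE_I2) (metis abs_of_nonneg le real_norm_def sum_power2_ge_zero)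
  then show ?thesis
    by (rule Bochner_Integration.integrable_bound[OF i, rotated]) measurable
qed

text \<open>Two integrations by parts against the test function \<open>cutkern e (y - x)\<close>.
  The left side is a mollification of \<open>u\<close> at \<open>x\<close>, so this is the
  representation of \<open>u\<close> through its Laplacian before the limit
  \<open>e \<longlonglongrightarrow> 0\<close>.\<close>

lemma representation_W22:
  fixes u :: "real^4 \<Rightarrow> real"
  assumes u: "u \<in> W22" and e: "e > 0"
  shows "(\<integral>y. u y * cutbubble e (y - x) \<partial>lborel) = (\<integral>y. u y * cutrest e (y - x) \<partial>lborel) - (\<integral>y. wlap u y * cutkern e (y - x) \<partial>lborel)"
proof -
  define \<phi> where "\<phi> y = cutkern e (y - x)" for y
  have \<phi>: "test_fun \<phi>" unfolding \<phi>_def using e by (rule test_fun_cutkern)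
  have wd: "integrable lborel (\<lambda>y. wpartial b (wpartial b u) y * \<phi> y)"
    "integrable lborel (\<lambda>y. u y * partial b (partial b \<phi>) y)"
    "(\<integral>y. wpartial b (wpartial b u) y * \<phi> y \<partial>lborel) = (\<integral>y. u y * partial b (partial b \<phi>) y \<partial>lborel)"
    if b: "b \<in> Basis" for b
    using W22_wpartial(1,3)[OF u b] \<phi> test_fun_partial[OF \<phi> b] unfolding weak_deriv_def by auto
  have "(\<integral>y. wlap u y * \<phi> y \<partial>lborel) = (\<Sum>b\<in>Basis. \<integral>y. wpartial b (wpartial b u) y * \<phi> y \<partial>lborel)"
    unfolding wlap_def sum_distrib_right by (intro Bochner_Integration.integral_sum wd)
  also have "\<dots> = (\<Sum>b\<in>Basis. \<integral>y. u y * partial b (partial b \<phi>) y \<partial>lborel)"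
    by (intro sum.cong refl wd)
  also have "\<dots> = (\<integral>y. u y * (\<Sum>b\<in>Basis. partial b (partial b \<phi>) y) \<partial>lborel)"
    unfolding sum_distrib_left by (intro Bochner_Integration.integral_sum[symmetric] wd)
  also have "\<dots> = (\<integral>y. u y * cutrest e (y - x) - u y * cutbubble e (y - x) \<partial>lborel)"
    unfolding \<phi>_def laplacian_cutkern[OF e] by (simp add: right_diff_distrib)
  also have "\<dots> = (\<integral>y. u y * cutrest e (y - x) \<partial>lborel) - (\<integral>y. u y * cutbubble e (y - x) \<partial>lborel)"
    using e by (intro Bochner_Integration.integral_diff L2_times_integrable W22_L2 u test_fun_L2 test_fun_cutrest test_fun_cutbubble)
  finally show ?thesis by (simp add: \<phi>_def)
qed

lemma cutkern_le_kern:
  assumes "z \<noteq> 0"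
  shows "0 \<le> cutkern e z" "cutkern e z \<le> kern z"
proof -
  have s: "z \<bullet> z > 0" using assms by simp
  show "0 \<le> cutkern e z" using s eta_nonneg by (simp add: cutkern_def)
  show "cutkern e z \<le> kern z"
  proof (cases "z \<bullet> z < 1")
    case True
    have "eta (z \<bullet> z) / (4 * pi\<^sup>2 * (z \<bullet> z + e\<^sup>2)) \<le> 1 / (4 * pi\<^sup>2 * (z \<bullet> z))"
      using s by (intro frac_le eta_le_1 mult_left_mono) auto
    then show ?thesis using True by (simp add: cutkern_def kern_def)
  qed (simp add: cutkern_def kern_def eta_outside)
qed

text \<open>Since \<open>eta\<close> has nonzero slope at 0, the remainder is not supported away
  from the pole. Its worst term is of size \<open>e\<^sup>2 / q\<^sup>2\<close> with
  \<open>q = s + e\<^sup>2\<close>; its square is at most \<open>e\<^sup>2 / q ^ 3\<close>, and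
  against the radial weight \<open>s\<close> this integrates to at most 1, uniformly in
  \<open>e\<close>.\<close>

lemma nn_integral_cutrest_sq_bounded:
  obtains R where "R > 0" "\<And>e. 0 < e \<Longrightarrow> (\<integral>\<^sup>+z. ennreal ((cutrest e z)\<^sup>2) \<partial>lborel) \<le> ennreal R"
proof -
  obtain H where H: "H \<ge> 1" "\<And>s. s \<ge> 0 \<Longrightarrow> \<bar>eta1 s\<bar> \<le> H" "\<And>s. s \<ge> 0 \<Longrightarrow> \<bar>eta2 s\<bar> \<le> H"
    using eta_bound by metis
  have "(\<integral>\<^sup>+z. ennreal ((cutrest e z)\<^sup>2) \<partial>lborel) \<le> ennreal (H\<^sup>2 / pi\<^sup>2 * 10)" if e: "0 < e" for e
  proof -
    let ?g = "\<lambda>s. if 0 \<le> s \<and> s < 1 then H\<^sup>2 / pi ^ 4 * (2 + 8 * e\<^sup>2 / (s + e\<^sup>2) ^ 3) else 0"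
    have "(cutrest e z)\<^sup>2 \<le> ?g (z \<bullet> z)" for z
    proof (cases "z \<bullet> z < 1")
      case True
      define s where "s = z \<bullet> z"
      define q where "q = s + e\<^sup>2"
      have s: "s \<ge> 0" by (simp add: s_def)
      have q: "q > 0" "s \<le> q" "e\<^sup>2 \<le> q" using e s by (auto simp: q_def add_nonneg_pos)
      have "\<bar>4 * s * eta2 s / q\<bar> \<le> 4 * H"
      proof -
        have "s * \<bar>eta2 s\<bar> \<le> q * H" using s q H by (intro mult_mono) auto
        then show ?thesis using q s by (simp add: abs_mult field_simps)
      qed
      moreover have "\<bar>8 * e\<^sup>2 * eta1 s / q\<^sup>2\<bar> \<le> 8 * H * (e\<^sup>2 / q\<^sup>2)"
        using H(2)[OF s] q mult_left_mono[of "\<bar>eta1 s\<bar>" H "8 * e\<^sup>2 / q\<^sup>2"] by (simp add: abs_mult mult_ac)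
      ultimately have "\<bar>4 * s * eta2 s / q + 8 * e\<^sup>2 * eta1 s / q\<^sup>2\<bar> \<le> 4 * H + 8 * H * (e\<^sup>2 / q\<^sup>2)"
        by linarith
      also have "\<dots> = 4 * H * (1 + 2 * (e\<^sup>2 / q\<^sup>2))"
        by (simp add: algebra_simps)
      finally have "\<bar>4 * s * eta2 s / q + 8 * e\<^sup>2 * eta1 s / q\<^sup>2\<bar> \<le> 4 * H * (1 + 2 * (e\<^sup>2 / q\<^sup>2))" .
      then have "\<bar>cutrest e z\<bar> \<le> H / pi\<^sup>2 * (1 + 2 * (e\<^sup>2 / q\<^sup>2))"
        unfolding cutrest_def s_def[symmetric] q_def[symmetric] by (simp add: field_simps)
      then have "(cutrest e z)\<^sup>2 \<le> (H / pi\<^sup>2 * (1 + 2 * (e\<^sup>2 / q\<^sup>2)))\<^sup>2"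
        by (metis abs_ge_zero power2_abs power_mono)
      also have "\<dots> = H\<^sup>2 / pi ^ 4 * (1 + 2 * (e\<^sup>2 / q\<^sup>2))\<^sup>2"
        by (simp add: power_mult_distrib power_divide)
      also have "(1 + 2 * (e\<^sup>2 / q\<^sup>2))\<^sup>2 \<le> 2 + 8 * (e\<^sup>2 / q\<^sup>2)\<^sup>2"
        using zero_le_power2[of "1 - 2 * (e\<^sup>2 / q\<^sup>2)"] unfolding power2_sum power2_diff power_mult_distrib
        by simp
      also have "(e\<^sup>2 / q\<^sup>2)\<^sup>2 \<le> e\<^sup>2 / q ^ 3"
      proof -
        have "(e\<^sup>2 / q\<^sup>2)\<^sup>2 = e\<^sup>2 * e\<^sup>2 / q ^ 4" by (simp add: power_divide power2_eq_square eval_nat_numeral mult_ac)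
        also have "\<dots> \<le> e\<^sup>2 * q / q ^ 4" using q by (intro divide_right_mono mult_left_mono) auto
        also have "\<dots> = e\<^sup>2 / q ^ 3" using q by (simp add: eval_nat_numeral)
        finally show ?thesis .
      qed
      finally have "(cutrest e z)\<^sup>2 \<le> H\<^sup>2 / pi ^ 4 * (2 + 8 * (e\<^sup>2 / q ^ 3))"
        using H(1) by (simp add: mult_left_mono divide_right_mono)
      then show ?thesis using True by (simp add: s_def q_def)
    qed (simp add: cutrest_def eta_outside)
    then have "(\<integral>\<^sup>+z. ennreal ((cutrest e z)\<^sup>2) \<partial>lborel) \<le> (\<integral>\<^sup>+z. ennreal (?g (z \<bullet> z)) \<partial>(lborel :: (real^4) measure))"
      by (intro nn_integral_mono ennreal_leI)
    also have "\<dots> = (\<integral>\<^sup>+s. ennreal (pi\<^sup>2 * s) * ennreal (?g s) \<partial>lborel)"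
      by (rule nn_integral_radial) measurable
    also have "\<dots> \<le> (\<integral>\<^sup>+s. ennreal (H\<^sup>2 / pi\<^sup>2 * (2 + 8 * e\<^sup>2 / (s + e\<^sup>2)\<^sup>2)) * indicator {0..1} s \<partial>lborel)"
    proof (intro nn_integral_mono)
      fix s :: real
      show "ennreal (pi\<^sup>2 * s) * ennreal (?g s) \<le> ennreal (H\<^sup>2 / pi\<^sup>2 * (2 + 8 * e\<^sup>2 / (s + e\<^sup>2)\<^sup>2)) * indicator {0..1} s"
      proof (cases "0 \<le> s \<and> s < 1")
        case True
        define q where "q = s + e\<^sup>2"
        have q: "q > 0" "s \<le> q" using e True by (auto simp: q_def add_nonneg_pos)
        have "s * (2 + 8 * e\<^sup>2 / q ^ 3) \<le> 2 + 8 * e\<^sup>2 / q\<^sup>2"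
        proof -
          have "s * (8 * e\<^sup>2 / q ^ 3) \<le> q * (8 * e\<^sup>2 / q ^ 3)" using q by (intro mult_right_mono) auto
          also have "\<dots> = 8 * e\<^sup>2 / q\<^sup>2" using q by (simp add: eval_nat_numeral)
          finally show ?thesis using True by (simp add: distrib_left)
        qed
        then have "pi\<^sup>2 * s * (H\<^sup>2 / pi ^ 4 * (2 + 8 * e\<^sup>2 / q ^ 3)) \<le> H\<^sup>2 / pi\<^sup>2 * (2 + 8 * e\<^sup>2 / q\<^sup>2)"
          using mult_left_mono[of "s * (2 + 8 * e\<^sup>2 / q ^ 3)" "2 + 8 * e\<^sup>2 / q\<^sup>2" "H\<^sup>2 / pi\<^sup>2"]
          by (simp add: eval_nat_numeral mult_ac)
        then show ?thesis
          using True by (simp add: q_def ennreal_mult'[symmetric] ennreal_leI del: ennreal_plus)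
      qed auto
    qed
    also have "\<dots> = ennreal (H\<^sup>2 / pi\<^sup>2 * (2 * 1 - 8 * e\<^sup>2 / (1 + e\<^sup>2)) - H\<^sup>2 / pi\<^sup>2 * (2 * 0 - 8 * e\<^sup>2 / (0 + e\<^sup>2)))"
    proof (intro nn_integral_FTC_Icc)
      fix s :: real assume "s \<in> {0..1}"
      then have "s + e\<^sup>2 > 0" using e by (simp add: add_nonneg_pos)
      then show "((\<lambda>s. H\<^sup>2 / pi\<^sup>2 * (2 * s - 8 * e\<^sup>2 / (s + e\<^sup>2))) has_real_derivative H\<^sup>2 / pi\<^sup>2 * (2 + 8 * e\<^sup>2 / (s + e\<^sup>2)\<^sup>2)) (at s)"
        by (auto intro!: derivative_eq_intros simp: power2_eq_square)
    qed (auto intro!: mult_nonneg_nonneg add_nonneg_nonneg)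
    also have "\<dots> \<le> ennreal (H\<^sup>2 / pi\<^sup>2 * 10)"
    proof (intro ennreal_leI)
      have "8 * e\<^sup>2 / (1 + e\<^sup>2) \<ge> 0" by simp
      moreover have "8 * e\<^sup>2 / (0 + e\<^sup>2) = 8" using e by simp
      ultimately have "(2 * 1 - 8 * e\<^sup>2 / (1 + e\<^sup>2)) - (2 * 0 - 8 * e\<^sup>2 / (0 + e\<^sup>2)) \<le> 10" by linarith
      then show "H\<^sup>2 / pi\<^sup>2 * (2 * 1 - 8 * e\<^sup>2 / (1 + e\<^sup>2)) - H\<^sup>2 / pi\<^sup>2 * (2 * 0 - 8 * e\<^sup>2 / (0 + e\<^sup>2)) \<le> H\<^sup>2 / pi\<^sup>2 * 10"
        unfolding right_diff_distrib[symmetric] by (intro mult_left_mono) auto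
    qed
    finally show ?thesis .
  qed
  then show ?thesis using H(1) by (intro that[of "H\<^sup>2 / pi\<^sup>2 * 10"]) auto
qed

section \<open>Approximation of averages\<close>

lemma integral_lborel_scale:
  fixes f :: "'a::euclidean_space \<Rightarrow> real"
  assumes [measurable]: "f \<in> borel_measurable borel" and "c \<noteq> 0"
  shows "(\<integral>x. f x \<partial>lborel) = \<bar>c\<bar> ^ DIM('a) * (\<integral>x. f (c *\<^sub>R x) \<partial>lborel)"
  using assms(2)
  by (subst lborel_affine[OF assms(2), of 0]) (simp add: integral_density integral_distr)

text \<open>Outer regularity gives an open \<open>U\<close> around \<open>E\<close> with
  \<open>U - E\<close> small. A point of \<open>E\<close> stays in \<open>U\<close> under small
  shifts, and what falls into \<open>U - E\<close> has measure at most that of \<open>U - E\<close>,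
  for every shift.\<close>

lemma indicator_shift_tendsto:
  fixes E :: "'a::euclidean_space set"
  assumes [measurable]: "E \<in> sets borel" and fin: "emeasure lborel E < \<infinity>" and h: "h \<longlonglongrightarrow> 0"
  shows "(\<lambda>n. \<integral>x. indicator E x * (1 - indicator E (x + h n)) \<partial>lborel) \<longlonglongrightarrow> (0::real)"
proof (rule LIMSEQ_I)
  fix r :: real assume r: "r > 0"
  obtain U where U: "open U" "E \<subseteq> U" "emeasure lborel (U - E) < ennreal (r / 2)"
    using outer_regular_lborel[OF assms(1), of "r / 2"] r by auto
  have [measurable]: "U \<in> sets borel" using U by auto
  have iE: "integrable lborel (indicator E :: 'a \<Rightarrow> real)"
    using fin by (intro integrable_real_indicator) auto
  have iU: "integrable lborel (indicator (U - E) :: 'a \<Rightarrow> real)"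
    using U(3) by (intro integrable_real_indicator) (auto intro: less_trans)
  have "(\<lambda>n. \<integral>x. indicator E x * (1 - indicator U (x + h n)) \<partial>lborel) \<longlonglongrightarrow> (\<integral>x. 0 \<partial>(lborel :: 'a measure)::real)"
  proof (rule integral_dominated_convergence[where w = "indicator E"])
    show "AE x in lborel. (\<lambda>n. indicator E x * (1 - indicator U (x + h n))) \<longlonglongrightarrow> (0::real)"
    proof (rule AE_I2)
      fix x
      show "(\<lambda>n. indicator E x * (1 - indicator U (x + h n))) \<longlonglongrightarrow> (0::real)"
      proof (cases "x \<in> E")
        case True
        have "(\<lambda>n. x + h n) \<longlonglongrightarrow> x + 0" using h by (intro tendsto_intros)
        then have "eventually (\<lambda>n. x + h n \<in> U) sequentially"
          using U True by (intro topological_tendstoD) auto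
        then have "eventually (\<lambda>n. 0 = indicator E x * (1 - indicator U (x + h n) :: real)) sequentially"
          by eventually_elim simp
        then show ?thesis by (rule Lim_transform_eventually[OF tendsto_const])
      qed simp
    qed
  qed (use iE in \<open>auto split: split_indicator\<close>)
  then have "eventually (\<lambda>n. (\<integral>x. indicator E x * (1 - indicator U (x + h n)) \<partial>lborel) < r / 2) sequentially"
    using r by (intro order_tendstoD(2)) auto
  then obtain N where N: "\<And>n. n \<ge> N \<Longrightarrow> (\<integral>x. indicator E x * (1 - indicator U (x + h n)) \<partial>lborel) < r / 2"
    by (auto simp: eventually_sequentially)
  show "\<exists>N. \<forall>n\<ge>N. norm ((\<integral>x. indicator E x * (1 - indicator E (x + h n)) \<partial>lborel) - (0::real)) < r"
  proof (intro exI allI impI)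
    fix n assume n: "n \<ge> N"
    have i1: "integrable lborel (\<lambda>x. indicator E x * (1 - indicator V (x + h n)) :: real)" if "V \<in> sets borel" for V
      using that by (intro Bochner_Integration.integrable_bound[OF iE]) (auto split: split_indicator)
    have i2: "integrable lborel (\<lambda>x. indicator (U - E) (x + h n) :: real)"
      by (rule integrable_lborel_shift[OF iU])
    have "(\<integral>x. indicator E x * (1 - indicator E (x + h n)) \<partial>lborel) \<le>
      (\<integral>x. indicator E x * (1 - indicator U (x + h n)) + indicator (U - E) (x + h n) \<partial>lborel :: real)"
      using U by (intro integral_mono Bochner_Integration.integrable_add i1 i2) (auto split: split_indicator)
    also have "\<dots> = (\<integral>x. indicator E x * (1 - indicator U (x + h n)) \<partial>lborel) + (\<integral>x. indicator (U - E) (x + h n) \<partial>lborel)"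
      by (intro Bochner_Integration.integral_add i1 i2) simp
    also have "(\<integral>x. indicator (U - E) (x + h n) \<partial>lborel) = measure lborel (U - E)"
      using integral_lborel_shift[of "indicator (U - E)" "h n"] by simp
    also have "measure lborel (U - E) \<le> r / 2"
      unfolding measure_def using U(3) r by (intro enn2real_leI) (auto intro: less_imp_le)
    finally have "(\<integral>x. indicator E x * (1 - indicator E (x + h n)) \<partial>lborel) < r"
      using N[OF n] by simp
    moreover have "(\<integral>x. indicator E x * (1 - indicator E (x + h n)) \<partial>lborel) \<ge> (0::real)"
      by (intro integral_nonneg_AE AE_I2) (auto split: split_indicator)
    ultimately show "norm ((\<integral>x. indicator E x * (1 - indicator E (x + h n)) \<partial>lborel) - (0::real)) < r"
      unfolding real_norm_def diff_0_right by linarith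
  qed
qed

lemma L2_integrable_on_set:
  assumes "L2 u" "E \<in> sets borel" "emeasure lborel E < \<infinity>"
  shows "integrable lborel (\<lambda>x. indicator E x * u x)"
proof (rule L2_times_integrable[OF _ assms(1)])
  have "(\<lambda>x. (indicator E x :: real)\<^sup>2) = indicator E"
    by (auto simp: fun_eq_iff indicator_def)
  then show "L2 (indicator E)"
    using assms by (simp add: L2_def integrable_real_indicator)
qed

lemma L2_shift:
  assumes "L2 u" shows "L2 (\<lambda>x. u (x + a))"
proof -
  have [measurable]: "u \<in> borel_measurable borel" using assms by (rule L2_measurable)
  have "(\<lambda>x. u (x + a)) \<in> borel_measurable borel" by measurable
  then show ?thesis
    using integrable_lborel_shift[of "\<lambda>x. (u x)\<^sup>2" a] assms by (simp add: L2_def)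
qed

text \<open>Moving the shift from \<open>u\<close> to \<open>E\<close> leaves \<open>u\<close>
  integrated over the symmetric difference of \<open>E\<close> and a translate. Its measure tends to
  0, and there \<open>\<bar>u\<bar>\<close> is at most
  \<open>1 / (2 * \<theta>) + \<theta> / 2 * u\<^sup>2\<close> with \<open>\<theta>\<close>
  free.\<close>

lemma set_correlation_tendsto:
  fixes u :: "'a::euclidean_space \<Rightarrow> real"
  assumes E[measurable]: "E \<in> sets borel" and fin: "emeasure lborel E < \<infinity>" and u: "L2 u" and h: "h \<longlonglongrightarrow> 0"
  shows "(\<lambda>n. \<integral>x. indicator E x * u (x + h n) \<partial>lborel) \<longlonglongrightarrow> (\<integral>x. indicator E x * u x \<partial>lborel)"
proof (rule LIMSEQ_I)
  fix r :: real assume r: "r > 0"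
  have um[measurable]: "u \<in> borel_measurable borel" using u by (rule L2_measurable)
  have iu: "integrable lborel (\<lambda>x. (u x)\<^sup>2)" using u by (simp add: L2_def)
  define A where "A = (\<integral>x. (u x)\<^sup>2 \<partial>lborel) + 1"
  have A: "A > 0" unfolding A_def by (intro add_nonneg_pos integral_nonneg_AE AE_I2) auto
  \<comment> \<open>With this choice the term with \<open>u\<^sup>2\<close> costs at most
    \<open>r / 2\<close>, and the measure term costs less than \<open>r / 2\<close> once the two
    gaps sum to less than \<open>r * \<theta>\<close>. The summand 1 in \<open>A\<close> keeps
    \<open>A\<close> positive.\<close>
  define \<theta> where "\<theta> = r / A"
  have \<theta>: "\<theta> > 0" using r A by (simp add: \<theta>_def)
  define G where "G a = (\<integral>x. indicator E x * (1 - indicator E (x + a)) \<partial>lborel :: real)" for a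
  have "(\<lambda>n. G (h n) + G (- h n)) \<longlonglongrightarrow> 0 + 0"
    unfolding G_def using tendsto_minus[OF h] by (intro tendsto_add indicator_shift_tendsto E fin h) simp
  then have "eventually (\<lambda>n. G (h n) + G (- h n) < r * \<theta>) sequentially"
    using r \<theta> by (intro order_tendstoD(2)) auto
  then obtain N where N: "\<And>n. n \<ge> N \<Longrightarrow> G (h n) + G (- h n) < r * \<theta>"
    by (auto simp: eventually_sequentially)
  have iE: "integrable lborel (indicator E :: 'a \<Rightarrow> real)"
    using fin by (intro integrable_real_indicator) auto
  have iG: "integrable lborel (\<lambda>x. indicator E x * (1 - indicator E (x + a)) :: real)" for a
    by (intro Bochner_Integration.integrable_bound[OF iE]) (auto split: split_indicator)
  show "\<exists>N. \<forall>n\<ge>N. norm ((\<integral>x. indicator E x * u (x + h n) \<partial>lborel) - (\<integral>x. indicator E x * u x \<partial>lborel)) < r"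
  proof (intro exI allI impI)
    fix n assume n: "n \<ge> N"
    define a where "a = h n"
    have i1: "integrable lborel (\<lambda>x. indicator E x * u (x + a))"
      by (intro L2_integrable_on_set L2_shift u E fin)
    have i1': "integrable lborel (\<lambda>x. indicator E (x - a) * u x)"
      using integrable_lborel_shift[OF i1, of "- a"] by simp
    have s1: "(\<integral>x. indicator E x * u (x + a) \<partial>lborel) = (\<integral>x. indicator E (x - a) * u x \<partial>lborel)"
      using integral_lborel_shift[of "\<lambda>x. indicator E x * u (x + a)" "- a"] by simp
    have i0: "integrable lborel (\<lambda>x. indicator E x * u x)"
      by (intro L2_integrable_on_set u E fin)
    have ig: "integrable lborel (\<lambda>x. indicator E (x - a) * (1 - indicator E x) :: real)"
      using integrable_lborel_shift[OF iG[of a], of "- a"] by simp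
    have sg: "(\<integral>x. indicator E (x - a) * (1 - indicator E x) \<partial>lborel) = G a"
      unfolding G_def using integral_lborel_shift[of "\<lambda>x. indicator E x * (1 - indicator E (x + a)) :: real" "- a"] by simp
    let ?m = "\<lambda>x. (indicator E (x - a) * (1 - indicator E x) + indicator E x * (1 - indicator E (x + - a))) / (2 * \<theta>) + \<theta> / 2 * (u x)\<^sup>2"
    have "norm ((\<integral>x. indicator E x * u (x + a) \<partial>lborel) - (\<integral>x. indicator E x * u x \<partial>lborel))
      = norm (\<integral>x. indicator E (x - a) * u x - indicator E x * u x \<partial>lborel)"
      unfolding s1 by (subst Bochner_Integration.integral_diff[OF i1' i0]) simp
    also have "\<dots> \<le> (\<integral>x. ?m x \<partial>lborel)"
    proof (rule order_trans[OF integral_norm_bound], rule integral_mono)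
      show "integrable lborel (\<lambda>x. norm (indicator E (x - a) * u x - indicator E x * u x))"
        by (intro integrable_norm Bochner_Integration.integrable_diff i1' i0)
      show "integrable lborel ?m"
        by (intro Bochner_Integration.integrable_add integrable_divide integrable_mult_right ig iG iu)
      fix x
      have key: "\<bar>u x\<bar> \<le> 1 / (2 * \<theta>) + \<theta> / 2 * (u x)\<^sup>2"
      proof -
        have "0 \<le> (1 - \<theta> * \<bar>u x\<bar>)\<^sup>2" by simp
        then have "2 * \<theta> * \<bar>u x\<bar> \<le> 1 + \<theta>\<^sup>2 * (u x)\<^sup>2"
          by (simp add: power2_diff power_mult_distrib)
        then show ?thesis using \<theta> by (simp add: field_simps power2_eq_square)
      qed
      have nn: "\<theta> / 2 * (u x)\<^sup>2 \<ge> 0" using \<theta> by simp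
      show "norm (indicator E (x - a) * u x - indicator E x * u x) \<le> ?m x"
        using key nn by (auto split: split_indicator)
    qed
    also have "\<dots> = (G a + G (- a)) / (2 * \<theta>) + \<theta> / 2 * (A - 1)"
    proof -
      have "(\<integral>x. ?m x \<partial>lborel) = ((\<integral>x. indicator E (x - a) * (1 - indicator E x) \<partial>lborel) +
        (\<integral>x. indicator E x * (1 - indicator E (x + - a)) \<partial>lborel)) / (2 * \<theta>) + \<theta> / 2 * (\<integral>x. (u x)\<^sup>2 \<partial>lborel)"
        using ig iG[of "- a"] iu
        by (subst Bochner_Integration.integral_add) (auto intro!: integrable_divide Bochner_Integration.integrable_add)
      then show ?thesis unfolding sg by (simp add: G_def A_def)
    qed
    also have "\<dots> < r * \<theta> / (2 * \<theta>) + \<theta> / 2 * A"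
      using N[OF n] \<theta> A by (intro add_strict_mono divide_strict_right_mono mult_strict_left_mono) (auto simp: a_def)
    also have "\<dots> = r" using \<theta> A by (simp add: \<theta>_def)
    finally show "norm ((\<integral>x. indicator E x * u (x + h n) \<partial>lborel) - (\<integral>x. indicator E x * u x \<partial>lborel)) < r"
      by (simp add: a_def)
  qed
qed

text \<open>The radial integrand \<open>2 * s / (s + 1) ^ 3\<close> is the derivative of
  \<open>(1 - 1 / (s + 1))\<^sup>2\<close>, which climbs from 0 to 1.\<close>

lemma nn_integral_bubble: "(\<integral>\<^sup>+v. ennreal (2 / (pi\<^sup>2 * (v \<bullet> v + 1) ^ 3)) \<partial>(lborel :: (real^4) measure)) = 1"
proof -
  have "(\<integral>\<^sup>+v. ennreal (2 / (pi\<^sup>2 * (v \<bullet> v + 1) ^ 3)) \<partial>(lborel :: (real^4) measure)) =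
    (\<integral>\<^sup>+s. ennreal (pi\<^sup>2 * s) * ennreal (2 / (pi\<^sup>2 * (s + 1) ^ 3)) \<partial>lborel)"
    by (rule nn_integral_radial) measurable
  also have "\<dots> = (\<integral>\<^sup>+s. ennreal (2 * s / (s + 1) ^ 3) * indicator {0..} s \<partial>lborel)"
  proof (intro nn_integral_cong)
    fix s :: real
    show "ennreal (pi\<^sup>2 * s) * ennreal (2 / (pi\<^sup>2 * (s + 1) ^ 3)) = ennreal (2 * s / (s + 1) ^ 3) * indicator {0..} s"
      by (cases "s \<ge> 0") (auto simp: ennreal_mult'[symmetric] ennreal_neg mult_le_0_iff mult_ac)
  qed
  also have "\<dots> = ennreal (1 - (1 - inverse (0 + 1))\<^sup>2)"
  proof (rule nn_integral_FTC_atLeast)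
    have "filterlim (\<lambda>s::real. s + 1) at_top at_top"
      using filterlim_tendsto_add_at_top[OF tendsto_const[of "1::real"] filterlim_ident] by (simp add: add.commute)
    then have "((\<lambda>s::real. inverse (s + 1)) \<longlongrightarrow> 0) at_top"
      by (rule tendsto_inverse_0_at_top)
    then have "((\<lambda>s::real. (1 - inverse (s + 1))\<^sup>2) \<longlongrightarrow> (1 - 0)\<^sup>2) at_top"
      by (intro tendsto_intros)
    then show "((\<lambda>s::real. (1 - inverse (s + 1))\<^sup>2) \<longlongrightarrow> 1) at_top" by simp
    fix s :: real assume s: "0 \<le> s"
    define w where "w = s + 1"
    have w: "w \<noteq> 0" "s = w - 1" using s by (auto simp: w_def)
    have "((\<lambda>s. (1 - inverse (s + 1))\<^sup>2) has_real_derivative 2 * (1 - inverse w) * (inverse w * inverse w)) (at s)"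
      unfolding w_def using s by (auto intro!: derivative_eq_intros)
    moreover have "2 * (1 - inverse w) * (inverse w * inverse w) = 2 * s / w ^ 3"
      unfolding w(2) using w(1) by (simp add: field_simps eval_nat_numeral)
    ultimately show "((\<lambda>s. (1 - inverse (s + 1))\<^sup>2) has_real_derivative 2 * s / (s + 1) ^ 3) (at s)"
      by (simp add: w_def)
    show "0 \<le> 2 * s / (s + 1) ^ 3" using s by simp
  qed measurable
  finally show ?thesis by simp
qed

text \<open>Only averages over \<open>E\<close> are needed in the limit, not pointwise values. After
  rescaling, Fubini moves the average inside and produces the correlation \<open>c\<close> of
  \<open>E\<close> with translates of \<open>u\<close>; it is bounded and converges by
  \<open>set_correlation_tendsto\<close>, so dominated convergence applies.\<close>

lemma mollified_average_tendsto:
  fixes u :: "real^4 \<Rightarrow> real"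
  assumes E[measurable]: "E \<in> sets borel" and fin: "emeasure lborel E < \<infinity>" and u: "L2 u"
    and e: "\<And>n. e n > 0" "e \<longlonglongrightarrow> 0"
  shows "(\<lambda>n. \<integral>x. indicator E x * (\<integral>y. u y * cutbubble (e n) (y - x) \<partial>lborel) \<partial>lborel)
    \<longlonglongrightarrow> (\<integral>x. indicator E x * u x \<partial>lborel)"
proof -
  have um[measurable]: "u \<in> borel_measurable borel" using u by (rule L2_measurable)
  have etam[measurable]: "eta \<in> borel_measurable borel"
    by (intro borel_measurable_continuous_onI eta_continuous)
  have betm[measurable]: "cutbubble a \<in> borel_measurable borel" for a
    unfolding cutbubble_def[abs_def] by measurable
  have iu: "integrable lborel (\<lambda>x. (u x)\<^sup>2)" using u by (simp add: L2_def)
  define b where "b v = 2 / (pi\<^sup>2 * (v \<bullet> v + 1) ^ 3)" for v :: "real^4"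
  have [measurable]: "b \<in> borel_measurable borel" unfolding b_def[abs_def] by measurable
  have b0: "b v \<ge> 0" for v by (simp add: b_def)
  have b1: "(\<integral>\<^sup>+v. ennreal (b v) \<partial>lborel) = 1" unfolding b_def by (rule nn_integral_bubble)
  have ib: "integrable lborel b" using b0 b1 by (intro integrableI_nonneg) auto
  have ib1: "(\<integral>v. b v \<partial>lborel) = 1"
    using b0 b1 by (subst integral_eq_nn_integral) auto
  \<comment> \<open>This is \<open>a ^ 4 * cutbubble a (a *\<^sub>R v)\<close>: the Jacobian absorbs
    every power of \<open>a\<close>, and only the cut-off still depends on it.\<close>
  define be where "be a v = b v * eta (a\<^sup>2 * (v \<bullet> v))" for a v
  have [measurable]: "be a \<in> borel_measurable borel" for a unfolding be_def[abs_def] by measurable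
  have be: "0 \<le> be a v" "be a v \<le> b v" for a v
    using b0[of v] eta_nonneg eta_le_1[of "a\<^sup>2 * (v \<bullet> v)"] by (auto simp: be_def mult_left_le)
  define c where "c a = (\<integral>x. indicator E x * u (x + a) \<partial>lborel)" for a
  have [measurable]: "c \<in> borel_measurable borel"
    unfolding c_def[abs_def] by measurable
  define M where "M = measure lborel E + (\<integral>x. (u x)\<^sup>2 \<partial>lborel)"
  have M0: "M \<ge> 0" unfolding M_def by (intro add_nonneg_nonneg integral_nonneg_AE AE_I2) auto
  have le: "\<bar>t\<bar> \<le> 1 + t\<^sup>2" for t :: real
    using sum_squares_bound[of 1 "\<bar>t\<bar>"] zero_le_power2[of t] by simp
  have iE: "integrable lborel (indicator E :: _ \<Rightarrow> real)"
    using fin by (intro integrable_real_indicator) auto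
  \<comment> \<open>The inequality \<open>\<bar>t\<bar> \<le> 1 + t\<^sup>2\<close> gives a bound
    that does not depend on the shift, as both Fubini and dominated convergence require.\<close>
  have absM: "(\<integral>\<^sup>+x. ennreal \<bar>indicator E x * u (x + a)\<bar> \<partial>lborel) \<le> ennreal M" for a
  proof -
    have iua: "integrable lborel (\<lambda>x. (u (x + a))\<^sup>2)" using integrable_lborel_shift[OF iu] .
    have "(\<integral>\<^sup>+x. ennreal \<bar>indicator E x * u (x + a)\<bar> \<partial>lborel) \<le> (\<integral>\<^sup>+x. ennreal (indicator E x + (u (x + a))\<^sup>2) \<partial>lborel)"
      using le by (intro nn_integral_mono ennreal_leI) (auto split: split_indicator)
    also have "\<dots> = ennreal (\<integral>x. indicator E x + (u (x + a))\<^sup>2 \<partial>lborel)"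
      by (intro nn_integral_eq_integral Bochner_Integration.integrable_add iE iua AE_I2) auto
    also have "(\<integral>x. indicator E x + (u (x + a))\<^sup>2 \<partial>lborel) = M"
      using integral_lborel_shift[of "\<lambda>x. (u x)\<^sup>2" a] by (simp add: Bochner_Integration.integral_add[OF iE iua] M_def)
    finally show ?thesis .
  qed
  have cM: "\<bar>c a\<bar> \<le> M" for a
  proof -
    have "ennreal \<bar>c a\<bar> \<le> (\<integral>\<^sup>+x. ennreal \<bar>indicator E x * u (x + a)\<bar> \<partial>lborel)"
      unfolding c_def using integral_norm_bound_ennreal[OF L2_integrable_on_set[OF L2_shift[OF u] E fin, of a]] by simp
    from order_trans[OF this absM] show ?thesis using M0 by simp
  qed
  have eq: "(\<integral>x. indicator E x * (\<integral>y. u y * cutbubble a (y - x) \<partial>lborel) \<partial>lborel) = (\<integral>v. be a v * c (a *\<^sub>R v) \<partial>lborel)"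
    if a: "a > 0" for a
  proof -
    have inner: "(\<integral>y. u y * cutbubble a (y - x) \<partial>lborel) = (\<integral>v. u (x + a *\<^sub>R v) * be a v \<partial>lborel)" for x
    proof -
      have "(\<integral>y. u y * cutbubble a (y - x) \<partial>lborel) = (\<integral>h. u (x + h) * cutbubble a h \<partial>lborel)"
        using integral_lborel_shift[of "\<lambda>y. u y * cutbubble a (y - x)" x] by (simp add: add.commute)
      also have "\<dots> = a ^ 4 * (\<integral>v. u (x + a *\<^sub>R v) * cutbubble a (a *\<^sub>R v) \<partial>lborel)"
        using a integral_lborel_scale[of "\<lambda>h. u (x + h) * cutbubble a h" a] by simp
      also have "\<dots> = (\<integral>v. a ^ 4 * (u (x + a *\<^sub>R v) * cutbubble a (a *\<^sub>R v)) \<partial>lborel)"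
        by simp
      also have "\<dots> = (\<integral>v. u (x + a *\<^sub>R v) * be a v \<partial>lborel)"
      proof (intro Bochner_Integration.integral_cong refl)
        fix v :: "real^4"
        have pos: "v \<bullet> v + 1 > 0" by (simp add: add_nonneg_pos)
        have inn: "a *\<^sub>R v \<bullet> a *\<^sub>R v = a\<^sup>2 * (v \<bullet> v)" by (simp add: power2_eq_square)
        have fac: "a\<^sup>2 * (v \<bullet> v) + a\<^sup>2 = a\<^sup>2 * (v \<bullet> v + 1)" by (simp add: algebra_simps)
        have scale: "a ^ 4 * (2 * a\<^sup>2 * t / (pi\<^sup>2 * (a\<^sup>2 * w) ^ 3)) = 2 / (pi\<^sup>2 * w ^ 3) * t"
          if "w > 0" for t w :: real
        proof -
          have "(a\<^sup>2 * w) ^ 3 = (a ^ 4 * a\<^sup>2) * w ^ 3"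
            by (simp add: power_mult_distrib eval_nat_numeral)
          then show ?thesis using a that by (simp add: field_simps)
        qed
        have "a ^ 4 * cutbubble a (a *\<^sub>R v) = be a v"
          unfolding cutbubble_def be_def b_def inn fac by (rule scale[OF pos])
        then show "a ^ 4 * (u (x + a *\<^sub>R v) * cutbubble a (a *\<^sub>R v)) = u (x + a *\<^sub>R v) * be a v"
          by (metis mult.left_commute)
      qed
      finally show ?thesis .
    qed
    define F where "F x v = indicator E x * u (x + a *\<^sub>R v) * be a v" for x v
    have [measurable]: "(\<lambda>(x, v). F x v) \<in> borel_measurable (lborel \<Otimes>\<^sub>M lborel)"
      unfolding F_def by measurable
    have "(\<integral>\<^sup>+z. norm (case z of (x, v) \<Rightarrow> F x v) \<partial>(lborel \<Otimes>\<^sub>M lborel)) = (\<integral>\<^sup>+v. \<integral>\<^sup>+x. ennreal \<bar>F x v\<bar> \<partial>lborel \<partial>lborel)"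
      by (subst lborel_pair.nn_integral_snd[symmetric]) (auto simp: split_beta')
    also have "\<dots> \<le> (\<integral>\<^sup>+v. ennreal M * ennreal (b v) \<partial>lborel)"
    proof (intro nn_integral_mono)
      fix v
      have "(\<integral>\<^sup>+x. ennreal \<bar>F x v\<bar> \<partial>lborel) = (\<integral>\<^sup>+x. ennreal \<bar>indicator E x * u (x + a *\<^sub>R v)\<bar> \<partial>lborel) * ennreal (be a v)"
        using be by (subst nn_integral_multc[symmetric]) (auto simp: F_def abs_mult ennreal_mult')
      also have "\<dots> \<le> ennreal M * ennreal (b v)"
        using be by (intro mult_mono absM ennreal_leI) auto
      finally show "(\<integral>\<^sup>+x. ennreal \<bar>F x v\<bar> \<partial>lborel) \<le> ennreal M * ennreal (b v)" .
    qed
    also have "\<dots> < \<infinity>" by (simp add: nn_integral_cmult b1)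
    finally have iF: "integrable (lborel \<Otimes>\<^sub>M lborel) (\<lambda>(x, v). F x v)"
      by (intro integrableI_bounded) auto
    have "(\<integral>x. indicator E x * (\<integral>y. u y * cutbubble a (y - x) \<partial>lborel) \<partial>lborel) = (\<integral>x. \<integral>v. F x v \<partial>lborel \<partial>lborel)"
      unfolding inner F_def by (simp add: mult.assoc)
    also have "\<dots> = (\<integral>v. \<integral>x. F x v \<partial>lborel \<partial>lborel)"
      using lborel_pair.Fubini_integral[OF iF] by simp
    also have "\<dots> = (\<integral>v. be a v * c (a *\<^sub>R v) \<partial>lborel)"
      unfolding F_def c_def by (simp add: mult.commute)
    finally show ?thesis .
  qed
  have "(\<lambda>n. \<integral>v. be (e n) v * c (e n *\<^sub>R v) \<partial>lborel) \<longlonglongrightarrow> (\<integral>v. b v * c 0 \<partial>lborel)"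
  proof (rule integral_dominated_convergence[where w = "\<lambda>v. b v * M"])
    show "integrable lborel (\<lambda>v. b v * M)" using ib by simp
    show "AE v in lborel. (\<lambda>n. be (e n) v * c (e n *\<^sub>R v)) \<longlonglongrightarrow> b v * c 0"
    proof (rule AE_I2)
      fix v :: "real^4"
      have "(\<lambda>n. (e n)\<^sup>2 * (v \<bullet> v)) \<longlonglongrightarrow> 0\<^sup>2 * (v \<bullet> v)" by (intro tendsto_intros e)
      then have "(\<lambda>n. eta ((e n)\<^sup>2 * (v \<bullet> v))) \<longlonglongrightarrow> eta 0"
        using isCont_tendsto_compose[of 0 eta] eta_continuous(1)[of UNIV]
        by (simp add: continuous_on_eq_continuous_at)
      then have "(\<lambda>n. be (e n) v) \<longlonglongrightarrow> b v * 1"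
        unfolding be_def eta_0 by (intro tendsto_intros)
      moreover have "(\<lambda>n. c (e n *\<^sub>R v)) \<longlonglongrightarrow> c 0"
      proof -
        have "(\<lambda>n. e n *\<^sub>R v) \<longlonglongrightarrow> 0 *\<^sub>R v" by (intro tendsto_intros e)
        then show ?thesis
          unfolding c_def using set_correlation_tendsto[OF E fin u, of "\<lambda>n. e n *\<^sub>R v"] by simp
      qed
      ultimately show "(\<lambda>n. be (e n) v * c (e n *\<^sub>R v)) \<longlonglongrightarrow> b v * c 0"
        by (auto intro: tendsto_mult)
    qed
    show "AE v in lborel. norm (be (e n) v * c (e n *\<^sub>R v)) \<le> b v * M" for n
      using be cM b0 by (intro AE_I2) (auto simp: abs_mult intro!: mult_mono)
  qed auto
  moreover have "(\<integral>v. b v * c 0 \<partial>lborel) = (\<integral>x. indicator E x * u x \<partial>lborel)"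
    using ib ib1 by (simp add: c_def)
  ultimately show ?thesis using eq[OF e(1)] by simp
qed

section \<open>Averages of Sobolev functions over two sets\<close>

lemma ennreal_le_sqrtI:
  assumes "X\<^sup>2 \<le> ennreal a" "a \<ge> 0"
  shows "X \<le> ennreal (sqrt a)"
proof (cases X)
  case (real x)
  then have "x\<^sup>2 \<le> a" using assms by (simp add: ennreal_power)
  then show ?thesis using real by (simp add: real_le_rsqrt ennreal_leI)
next
  case top
  then show ?thesis using assms by (simp add: top_unique)
qed

text \<open>This is the averaged kernel multiplied by the measure of \<open>E\<close>. Values in
  \<open>ennreal\<close> allow integrals to be exchanged without integrability proofs.\<close>

definition kern_pot :: "(real^4) set \<Rightarrow> real^4 \<Rightarrow> ennreal" where
  "kern_pot E y = (\<integral>\<^sup>+x. ennreal (kern (y - x)) * indicator E x \<partial>lborel)"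

lemma measurable_kern_pot [measurable]:
  assumes [measurable]: "E \<in> sets borel" shows "kern_pot E \<in> borel_measurable borel"
  unfolding kern_pot_def[abs_def] by measurable

text \<open>Averaging over \<open>E\<close> with the point of \<open>E'\<close> held fixed already
  gives the bound, uniformly in that point. Hence the logarithm involves the measure of
  \<open>E\<close> alone, and one may let the larger set play this role.\<close>

lemma nn_integral_kern_pot_kern_pot:
  assumes [measurable]: "E \<in> sets borel" "E' \<in> sets borel"
    and E: "emeasure lborel E = ennreal m" "0 < m" "m \<le> 1" and E': "emeasure lborel E' = ennreal m'" "0 \<le> m'"
  shows "(\<integral>\<^sup>+y. kern_pot E y * kern_pot E' y \<partial>lborel) \<le> ennreal (m * m' * ((ln (1 / m) + 4 * (pi\<^sup>2 + 1)) / (32 * pi\<^sup>2)))"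
proof -
  define r where "r = root 4 m"
  have r: "0 < r" "r \<le> 1" "r ^ 4 = m"
    using E by (auto simp: r_def)
  have "kern_pot E y * kern_pot E' y = (\<integral>\<^sup>+x'. kern_pot E y * (ennreal (kern (y - x')) * indicator E' x') \<partial>lborel)" for y
    by (simp add: kern_pot_def[of E'] nn_integral_cmult)
  then have "(\<integral>\<^sup>+y. kern_pot E y * kern_pot E' y \<partial>lborel) = (\<integral>\<^sup>+y. \<integral>\<^sup>+x'. kern_pot E y * (ennreal (kern (y - x')) * indicator E' x') \<partial>lborel \<partial>lborel)"
    by simp
  also have "\<dots> = (\<integral>\<^sup>+x'. \<integral>\<^sup>+y. kern_pot E y * (ennreal (kern (y - x')) * indicator E' x') \<partial>lborel \<partial>lborel)"
    by (rule lborel_pair.Fubini') measurable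
  also have "\<dots> \<le> (\<integral>\<^sup>+x'. ennreal (m * ((ln (1 / m) + 4 * (pi\<^sup>2 + 1)) / (32 * pi\<^sup>2))) * indicator E' x' \<partial>lborel)"
  proof (intro nn_integral_mono)
    fix x'
    have "(\<integral>\<^sup>+y. kern_pot E y * (ennreal (kern (y - x')) * indicator E' x') \<partial>lborel)
      = (\<integral>\<^sup>+y. kern_pot E y * ennreal (kern (y - x')) \<partial>lborel) * indicator E' x'"
      by (simp add: nn_integral_multc[symmetric] mult.assoc)
    also have "(\<integral>\<^sup>+y. kern_pot E y * ennreal (kern (y - x')) \<partial>lborel)
      = (\<integral>\<^sup>+y. \<integral>\<^sup>+x. ennreal (kern (y - x) * kern (y - x')) * indicator E x \<partial>lborel \<partial>lborel)"
    proof (intro nn_integral_cong)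
      fix y
      have eq: "ennreal (kern (y - x) * kern (y - x')) * indicator E x = ennreal (kern (y - x)) * indicator E x * ennreal (kern (y - x'))" for x
        by (simp add: ennreal_mult kern_nonneg mult_ac)
      show "kern_pot E y * ennreal (kern (y - x')) = (\<integral>\<^sup>+x. ennreal (kern (y - x) * kern (y - x')) * indicator E x \<partial>lborel)"
        unfolding eq kern_pot_def by (rule nn_integral_multc[symmetric]) measurable
    qed
    also have "\<dots> = (\<integral>\<^sup>+x. \<integral>\<^sup>+y. ennreal (kern (y - x) * kern (y - x')) * indicator E x \<partial>lborel \<partial>lborel)"
      by (rule lborel_pair.Fubini') measurable
    also have "\<dots> = (\<integral>\<^sup>+x. (\<integral>\<^sup>+y. ennreal (kern (y - x) * kern (y - x')) \<partial>lborel) * indicator E x \<partial>lborel)"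
      by (simp add: nn_integral_multc)
    also have "\<dots> \<le> ennreal (r ^ 4 * (ln (1 / r ^ 4) + 4 * (pi\<^sup>2 + 1)) / (32 * pi\<^sup>2))"
      using E r by (intro kern_convolution_average) auto
    finally show "(\<integral>\<^sup>+y. kern_pot E y * (ennreal (kern (y - x')) * indicator E' x') \<partial>lborel)
      \<le> ennreal (m * ((ln (1 / m) + 4 * (pi\<^sup>2 + 1)) / (32 * pi\<^sup>2))) * indicator E' x'"
      unfolding r(3) by (simp add: mult_right_mono)
  qed
  also have "\<dots> = ennreal (m * m' * ((ln (1 / m) + 4 * (pi\<^sup>2 + 1)) / (32 * pi\<^sup>2)))"
  proof -
    have "ln (1 / m) \<ge> 0" using E by simp
    then have "0 \<le> m * ((ln (1 / m) + 4 * (pi\<^sup>2 + 1)) / (32 * pi\<^sup>2))"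
      using E by (intro mult_nonneg_nonneg divide_nonneg_nonneg add_nonneg_nonneg) auto
    then show ?thesis
      using E' by (subst nn_integral_cmult_indicator) (simp_all only: ennreal_mult'[symmetric] mult_ac sets_lborel assms)
  qed
  finally show ?thesis .
qed

text \<open>In the expanded square the mixed term occurs twice and is estimated through
  \<open>E1\<close>. This gives 1 + 2 logarithms of \<open>m1\<close> against one of
  \<open>m2\<close>; the constant \<open>4 * (pi\<^sup>2 + 1)\<close> is collected four
  times.\<close>

lemma nn_integral_kern_pot_sum_sq:
  assumes [measurable]: "E1 \<in> sets borel" "E2 \<in> sets borel"
    and m1: "emeasure lborel E1 = ennreal m1" "0 < m1" "m1 \<le> 1"
    and m2: "emeasure lborel E2 = ennreal m2" "0 < m2" "m2 \<le> 1"
  shows "(\<integral>\<^sup>+y. (ennreal (1 / m1) * kern_pot E1 y + ennreal (1 / m2) * kern_pot E2 y)\<^sup>2 \<partial>lborel)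
    \<le> ennreal ((3 * ln (1 / m1) + ln (1 / m2) + 16 * (pi\<^sup>2 + 1)) / (32 * pi\<^sup>2))"
proof -
  let ?a = "ennreal (1 / m1)" and ?b = "ennreal (1 / m2)"
  let ?f = "\<lambda>m. (ln (1 / m) + 4 * (pi\<^sup>2 + 1)) / (32 * pi\<^sup>2)"
  have f: "?f m1 \<ge> 0" "?f m2 \<ge> 0"
    using m1 m2 by (auto intro!: divide_nonneg_nonneg add_nonneg_nonneg)
  have "(?a * kern_pot E1 y + ?b * kern_pot E2 y)\<^sup>2 = ?a\<^sup>2 * (kern_pot E1 y * kern_pot E1 y) + 2 * ?a * ?b * (kern_pot E1 y * kern_pot E2 y) + ?b\<^sup>2 * (kern_pot E2 y * kern_pot E2 y)" for y
    by (simp only: power2_sum) (simp add: power2_eq_square mult_ac add_ac)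
  then have "(\<integral>\<^sup>+y. (?a * kern_pot E1 y + ?b * kern_pot E2 y)\<^sup>2 \<partial>lborel) =
    ?a\<^sup>2 * (\<integral>\<^sup>+y. kern_pot E1 y * kern_pot E1 y \<partial>lborel) + 2 * ?a * ?b * (\<integral>\<^sup>+y. kern_pot E1 y * kern_pot E2 y \<partial>lborel) + ?b\<^sup>2 * (\<integral>\<^sup>+y. kern_pot E2 y * kern_pot E2 y \<partial>lborel)"
    by (simp add: nn_integral_add nn_integral_cmult)
  also have "\<dots> \<le> ?a\<^sup>2 * ennreal (m1 * m1 * ?f m1) + 2 * ?a * ?b * ennreal (m1 * m2 * ?f m1) + ?b\<^sup>2 * ennreal (m2 * m2 * ?f m2)"
    using m1 m2 by (intro add_mono mult_left_mono nn_integral_kern_pot_kern_pot) auto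
  also have "?a\<^sup>2 * ennreal (m1 * m1 * ?f m1) = ennreal (?f m1)"
    using m1 f by (simp add: ennreal_power ennreal_mult'[symmetric] power2_eq_square del: times_divide_eq_right)
  also have "2 * ?a * ?b * ennreal (m1 * m2 * ?f m1) = ennreal (2 * ?f m1)"
  proof -
    have "2 * ?a * ?b * ennreal (m1 * m2 * ?f m1) = ennreal 2 * ennreal (1 / m1) * ennreal (1 / m2) * ennreal (m1 * m2 * ?f m1)"
      by simp
    also have "\<dots> = ennreal (2 * (1 / m1) * (1 / m2) * (m1 * m2 * ?f m1))"
    proof -
      have "ennreal 2 * ennreal a * ennreal b * ennreal t = ennreal (2 * a * b * t)" if "a \<ge> 0" "b \<ge> 0" for a b t :: real
        using that by (simp add: ennreal_mult' mult.assoc)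
      then show ?thesis using m1 m2 by simp
    qed
    finally show ?thesis using m1 m2 by simp
  qed
  also have "?b\<^sup>2 * ennreal (m2 * m2 * ?f m2) = ennreal (?f m2)"
    using m2 f by (simp add: ennreal_power ennreal_mult'[symmetric] power2_eq_square del: times_divide_eq_right)
  also have "ennreal (?f m1) + ennreal (2 * ?f m1) + ennreal (?f m2) = ennreal (?f m1 + 2 * ?f m1 + ?f m2)"
  proof -
    have "ennreal a + ennreal (2 * a) + ennreal b = ennreal (a + 2 * a + b)" if "a \<ge> 0" "b \<ge> 0" for a b :: real
      using that by (simp add: ennreal_plus[symmetric] del: ennreal_plus)
    from this[OF f] show ?thesis .
  qed
  also have "?f m1 + 2 * ?f m1 + ?f m2 = (3 * ln (1 / m1) + ln (1 / m2) + 16 * (pi\<^sup>2 + 1)) / (32 * pi\<^sup>2)"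
    by (simp add: add_divide_distrib[symmetric] distrib_left)
  finally show ?thesis .
qed

lemma nn_integral_times_le_sqrt:
  assumes [measurable]: "f \<in> borel_measurable M" "g \<in> borel_measurable M"
    and "(\<integral>\<^sup>+x. f x ^ 2 \<partial>M) \<le> ennreal a" "(\<integral>\<^sup>+x. g x ^ 2 \<partial>M) \<le> ennreal b" "a \<ge> 0" "b \<ge> 0"
  shows "(\<integral>\<^sup>+x. f x * g x \<partial>M) \<le> ennreal (sqrt (a * b))"
proof (rule ennreal_le_sqrtI)
  have "(\<integral>\<^sup>+x. f x * g x \<partial>M)\<^sup>2 \<le> (\<integral>\<^sup>+x. f x ^ 2 \<partial>M) * (\<integral>\<^sup>+x. g x ^ 2 \<partial>M)"
    by (rule Cauchy_Schwarz_nn_integral) measurable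
  also have "\<dots> \<le> ennreal a * ennreal b"
    using assms by (intro mult_mono) auto
  finally show "(\<integral>\<^sup>+x. f x * g x \<partial>M)\<^sup>2 \<le> ennreal (a * b)"
    using assms by (simp add: ennreal_mult)
qed (use assms in simp)

lemma L2_nn_integral:
  assumes "L2 u" shows "(\<integral>\<^sup>+x. ennreal \<bar>u x\<bar> ^ 2 \<partial>lborel) = ennreal (\<integral>x. (u x)\<^sup>2 \<partial>lborel)"
  using assms by (subst nn_integral_eq_integral[symmetric]) (auto simp: L2_def ennreal_power)

text \<open>\<open>D\<close> is a bound for what the Laplacian has beyond the bounded part
  \<open>M\<close>. The remainder kernel is handled by Cauchy-Schwarz and \<open>M\<close> by the
  mass 1/4 of \<open>kern\<close>, both uniformly in \<open>e\<close> and \<open>x\<close>; only the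
  contribution of \<open>D\<close> has to wait for the averaging.\<close>

lemma mollified_pointwise_bound:
  fixes u D :: "real^4 \<Rightarrow> real"
  assumes u: "u \<in> W22" and D: "L2 D" "\<And>x. D x \<ge> 0" "\<And>x. \<bar>wlap u x\<bar> \<le> M + D x" "M \<ge> 0"
    and R: "R \<ge> 0" "\<And>e. 0 < e \<Longrightarrow> (\<integral>\<^sup>+z. ennreal ((cutrest e z)\<^sup>2) \<partial>lborel) \<le> ennreal R"
    and e: "e > 0"
  shows "ennreal \<bar>\<integral>y. u y * cutbubble e (y - x) \<partial>lborel\<bar> \<le>
    ennreal (sqrt (R * (\<integral>x. (u x)\<^sup>2 \<partial>lborel)) + M / 4) + (\<integral>\<^sup>+y. ennreal (D y) * ennreal (kern (y - x)) \<partial>lborel)"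
proof -
  define U where "U = (\<integral>x. (u x)\<^sup>2 \<partial>lborel)"
  have U0: "U \<ge> 0" unfolding U_def by (intro integral_nonneg_AE AE_I2) simp
  have Lu: "L2 u" using u by (rule W22_L2)
  have [measurable]: "u \<in> borel_measurable borel" "D \<in> borel_measurable borel" "wlap u \<in> borel_measurable borel"
    using Lu D(1) W22_wlap[OF u] by (auto intro: L2_measurable)
  have remm: "(\<lambda>y. cutrest e (y - x)) \<in> borel_measurable borel" "cutrest e \<in> borel_measurable borel"
    using test_fun_measurable[OF test_fun_cutrest[OF e]] test_fun_measurable[OF test_fun_cutrest[OF e, of 0]] by auto
  have kapm: "(\<lambda>y. cutkern e (y - x)) \<in> borel_measurable borel"
    using test_fun_measurable[OF test_fun_cutkern[OF e]] by auto
  note [measurable] = remm kapm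
  have 1: "ennreal \<bar>\<integral>y. u y * cutrest e (y - x) \<partial>lborel\<bar> \<le> ennreal (sqrt (R * U))"
  proof -
    have i: "integrable lborel (\<lambda>y. u y * cutrest e (y - x))"
      by (intro L2_times_integrable Lu test_fun_L2 test_fun_cutrest e)
    have "ennreal \<bar>\<integral>y. u y * cutrest e (y - x) \<partial>lborel\<bar> \<le> (\<integral>\<^sup>+y. ennreal \<bar>cutrest e (y - x)\<bar> * ennreal \<bar>u y\<bar> \<partial>lborel)"
      using integral_norm_bound_ennreal[OF i] by (simp add: abs_mult ennreal_mult mult.commute)
    also have "\<dots> \<le> ennreal (sqrt (R * U))"
    proof (rule nn_integral_times_le_sqrt)
      show "(\<integral>\<^sup>+y. ennreal \<bar>cutrest e (y - x)\<bar> ^ 2 \<partial>lborel) \<le> ennreal R"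
        using R(2)[OF e] nn_integral_lborel_shift[of "\<lambda>z. ennreal ((cutrest e z)\<^sup>2)" "- x"] remm(2)
        by (simp add: ennreal_power)
      show "(\<integral>\<^sup>+y. ennreal \<bar>u y\<bar> ^ 2 \<partial>lborel) \<le> ennreal U"
        unfolding U_def L2_nn_integral[OF Lu] ..
    qed (use R U0 in auto)
    finally show ?thesis .
  qed
  have 2: "ennreal \<bar>\<integral>y. wlap u y * cutkern e (y - x) \<partial>lborel\<bar> \<le> ennreal (M / 4) + (\<integral>\<^sup>+y. ennreal (D y) * ennreal (kern (y - x)) \<partial>lborel)"
  proof -
    have i: "integrable lborel (\<lambda>y. wlap u y * cutkern e (y - x))"
      by (intro L2_times_integrable W22_wlap u test_fun_L2 test_fun_cutkern e)
    have "ennreal \<bar>\<integral>y. wlap u y * cutkern e (y - x) \<partial>lborel\<bar> \<le> (\<integral>\<^sup>+y. ennreal \<bar>wlap u y * cutkern e (y - x)\<bar> \<partial>lborel)"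
      using integral_norm_bound_ennreal[OF i] by simp
    also have "\<dots> \<le> (\<integral>\<^sup>+y. ennreal M * ennreal (kern (y - x)) + ennreal (D y) * ennreal (kern (y - x)) \<partial>lborel)"
    proof (rule nn_integral_mono_AE)
      have "AE y in lborel. y \<noteq> x" by (rule AE_lborel_singleton)
      then show "AE y in lborel. ennreal \<bar>wlap u y * cutkern e (y - x)\<bar> \<le> ennreal M * ennreal (kern (y - x)) + ennreal (D y) * ennreal (kern (y - x))"
      proof eventually_elim
        case (elim y)
        then have k: "0 \<le> cutkern e (y - x)" "cutkern e (y - x) \<le> kern (y - x)" by (auto intro: cutkern_le_kern)
        have "\<bar>wlap u y * cutkern e (y - x)\<bar> \<le> (M + D y) * kern (y - x)"
          using k D(2,3)[of y] D(4) by (simp add: abs_mult mult_mono)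
        then show ?case
          using D(2,4) kern_nonneg by (simp add: ennreal_mult[symmetric] ennreal_plus[symmetric] distrib_right ennreal_leI del: ennreal_plus)
      qed
    qed
    also have "\<dots> = ennreal M * (\<integral>\<^sup>+y. ennreal (kern (y - x)) \<partial>lborel) + (\<integral>\<^sup>+y. ennreal (D y) * ennreal (kern (y - x)) \<partial>lborel)"
      by (simp add: nn_integral_add nn_integral_cmult)
    also have "(\<integral>\<^sup>+y. ennreal (kern (y - x)) \<partial>lborel) = ennreal (1 / 4)"
      using nn_integral_lborel_shift[of "\<lambda>y. ennreal (kern y)" "- x"] nn_integral_kern by simp
    also have "ennreal M * ennreal (1 / 4) = ennreal (M / 4)"
      using D(4) by (simp add: ennreal_mult'[symmetric])
    finally show ?thesis .
  qed
  have "ennreal \<bar>\<integral>y. u y * cutbubble e (y - x) \<partial>lborel\<bar> \<le> ennreal \<bar>\<integral>y. u y * cutrest e (y - x) \<partial>lborel\<bar> + ennreal \<bar>\<integral>y. wlap u y * cutkern e (y - x) \<partial>lborel\<bar>"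
    unfolding representation_W22[OF u e] using ennreal_leI[OF abs_triangle_ineq4] by simp
  also have "\<dots> \<le> ennreal (sqrt (R * U)) + (ennreal (M / 4) + (\<integral>\<^sup>+y. ennreal (D y) * ennreal (kern (y - x)) \<partial>lborel))"
    by (intro add_mono 1 2)
  also have "\<dots> = ennreal (sqrt (R * U) + M / 4) + (\<integral>\<^sup>+y. ennreal (D y) * ennreal (kern (y - x)) \<partial>lborel)"
    using R U0 D(4) by (simp add: add.assoc)
  finally show ?thesis unfolding U_def .
qed

text \<open>The pointwise bound is uniform in \<open>e\<close>, so it can be averaged over both sets
  for each \<open>e\<close> and then passed to the limit. The two averages share one function
  \<open>D\<close>, which is why they are estimated together.\<close>

theorem set_average_bound:
  fixes u D :: "real^4 \<Rightarrow> real"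
  assumes u: "u \<in> W22" and D: "L2 D" "\<And>x. D x \<ge> 0" "\<And>x. \<bar>wlap u x\<bar> \<le> M + D x" "M \<ge> 0"
    and R: "R \<ge> 0" "\<And>e. 0 < e \<Longrightarrow> (\<integral>\<^sup>+z. ennreal ((cutrest e z)\<^sup>2) \<partial>lborel) \<le> ennreal R"
    and E[measurable]: "E1 \<in> sets borel" "E2 \<in> sets borel"
    and m1: "emeasure lborel E1 = ennreal m1" "0 < m1" "m1 \<le> 1"
    and m2: "emeasure lborel E2 = ennreal m2" "0 < m2" "m2 \<le> 1"
  shows "\<bar>(\<integral>x. indicator E1 x * u x \<partial>lborel) / m1 + (\<integral>x. indicator E2 x * u x \<partial>lborel) / m2\<bar>
    \<le> M / 2 + 2 * sqrt (R * (\<integral>x. (u x)\<^sup>2 \<partial>lborel))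
      + sqrt ((\<integral>x. (D x)\<^sup>2 \<partial>lborel) * ((3 * ln (1 / m1) + ln (1 / m2) + 16 * (pi\<^sup>2 + 1)) / (32 * pi\<^sup>2)))"
proof -
  define c where "c = sqrt (R * (\<integral>x. (u x)\<^sup>2 \<partial>lborel)) + M / 4"
  define Q where "Q = (3 * ln (1 / m1) + ln (1 / m2) + 16 * (pi\<^sup>2 + 1)) / (32 * pi\<^sup>2)"
  define V where "V = (\<integral>x. (D x)\<^sup>2 \<partial>lborel)"
  have U0: "(\<integral>x. (u x)\<^sup>2 \<partial>lborel) \<ge> 0" and V0: "V \<ge> 0"
    unfolding V_def by (intro integral_nonneg_AE AE_I2; simp)+
  have c0: "c \<ge> 0" using R D(4) U0 by (simp add: c_def)
  have Q0: "Q \<ge> 0" unfolding Q_def using m1 m2 by (intro divide_nonneg_nonneg add_nonneg_nonneg) auto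
  have Lu: "L2 u" using u by (rule W22_L2)
  have [measurable]: "u \<in> borel_measurable borel" "D \<in> borel_measurable borel"
    using Lu D(1) by (auto intro: L2_measurable)
  have [measurable]: "eta \<in> borel_measurable borel"
    by (intro borel_measurable_continuous_onI eta_continuous)
  have [measurable]: "cutbubble a \<in> borel_measurable borel" for a
    unfolding cutbubble_def[abs_def] by measurable
  define A where "A e x = (\<integral>y. u y * cutbubble e (y - x) \<partial>lborel)" for e x
  have [measurable]: "A e \<in> borel_measurable borel" for e
    unfolding A_def[abs_def] by measurable
  have T: "(\<integral>\<^sup>+x. ennreal \<bar>A e x\<bar> * indicator E x \<partial>lborel) \<le> ennreal (c * m) + (\<integral>\<^sup>+y. ennreal (D y) * kern_pot E y \<partial>lborel)"
    if "e > 0" and [measurable]: "E \<in> sets borel" and m: "emeasure lborel E = ennreal m" "m > 0" for e E m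
  proof -
    have "(\<integral>\<^sup>+x. ennreal \<bar>A e x\<bar> * indicator E x \<partial>lborel) \<le>
      (\<integral>\<^sup>+x. (ennreal c + (\<integral>\<^sup>+y. ennreal (D y) * ennreal (kern (y - x)) \<partial>lborel)) * indicator E x \<partial>lborel)"
      unfolding A_def c_def by (intro nn_integral_mono mult_right_mono mollified_pointwise_bound u D R that) auto
    also have "\<dots> = ennreal c * emeasure lborel E + (\<integral>\<^sup>+x. \<integral>\<^sup>+y. ennreal (D y) * ennreal (kern (y - x)) * indicator E x \<partial>lborel \<partial>lborel)"
      by (simp add: distrib_right nn_integral_add nn_integral_cmult nn_integral_multc)
    also have "(\<integral>\<^sup>+x. \<integral>\<^sup>+y. ennreal (D y) * ennreal (kern (y - x)) * indicator E x \<partial>lborel \<partial>lborel)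
      = (\<integral>\<^sup>+y. \<integral>\<^sup>+x. ennreal (D y) * ennreal (kern (y - x)) * indicator E x \<partial>lborel \<partial>lborel)"
      by (rule lborel_pair.Fubini') measurable
    also have "\<dots> = (\<integral>\<^sup>+y. ennreal (D y) * kern_pot E y \<partial>lborel)"
      by (simp add: kern_pot_def nn_integral_cmult mult.assoc)
    finally show ?thesis using m c0 by (simp add: ennreal_mult)
  qed
  have bound: "\<bar>(\<integral>x. indicator E1 x * A e x \<partial>lborel) / m1 + (\<integral>x. indicator E2 x * A e x \<partial>lborel) / m2\<bar> \<le> 2 * c + sqrt (V * Q)"
    if e: "e > 0" for e
  proof -
    have int_le: "ennreal \<bar>\<integral>x. indicator E x * A e x \<partial>lborel\<bar> \<le> (\<integral>\<^sup>+x. ennreal \<bar>A e x\<bar> * indicator E x \<partial>lborel)"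
      if [measurable]: "E \<in> sets borel" for E
    \<comment> \<open>Without integrability the Bochner integral is 0 by convention and the claim is
      trivial.\<close>
    proof (cases "integrable lborel (\<lambda>x. indicator E x * A e x)")
      case True
      have "ennreal \<bar>\<integral>x. indicator E x * A e x \<partial>lborel\<bar> \<le> (\<integral>\<^sup>+x. ennreal \<bar>indicator E x * A e x\<bar> \<partial>lborel)"
        using integral_norm_bound_ennreal[OF True] by simp
      also have "\<dots> = (\<integral>\<^sup>+x. ennreal \<bar>A e x\<bar> * indicator E x \<partial>lborel)"
        by (intro nn_integral_cong) (auto split: split_indicator)
      finally show ?thesis .
    qed (simp add: not_integrable_integral_eq)
    have "ennreal \<bar>(\<integral>x. indicator E1 x * A e x \<partial>lborel) / m1 + (\<integral>x. indicator E2 x * A e x \<partial>lborel) / m2\<bar>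
      \<le> ennreal (1 / m1 * \<bar>\<integral>x. indicator E1 x * A e x \<partial>lborel\<bar> + 1 / m2 * \<bar>\<integral>x. indicator E2 x * A e x \<partial>lborel\<bar>)"
      using m1 m2 abs_triangle_ineq[of "(\<integral>x. indicator E1 x * A e x \<partial>lborel) / m1" "(\<integral>x. indicator E2 x * A e x \<partial>lborel) / m2"]
      by (intro ennreal_leI) simp
    also have "\<dots> = ennreal (1 / m1) * ennreal \<bar>\<integral>x. indicator E1 x * A e x \<partial>lborel\<bar> + ennreal (1 / m2) * ennreal \<bar>\<integral>x. indicator E2 x * A e x \<partial>lborel\<bar>"
      using m1 m2 by (subst (1 2) ennreal_mult[symmetric]) auto
    also have "\<dots> \<le> ennreal (1 / m1) * (ennreal (c * m1) + (\<integral>\<^sup>+y. ennreal (D y) * kern_pot E1 y \<partial>lborel))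
       + ennreal (1 / m2) * (ennreal (c * m2) + (\<integral>\<^sup>+y. ennreal (D y) * kern_pot E2 y \<partial>lborel))"
      by (intro add_mono mult_left_mono order_trans[OF int_le T] e E m1 m2) auto
    also have "\<dots> = (ennreal (1 / m1) * ennreal (c * m1) + ennreal (1 / m2) * ennreal (c * m2))
       + (ennreal (1 / m1) * (\<integral>\<^sup>+y. ennreal (D y) * kern_pot E1 y \<partial>lborel) + ennreal (1 / m2) * (\<integral>\<^sup>+y. ennreal (D y) * kern_pot E2 y \<partial>lborel))"
      by (simp add: distrib_left add_ac)
    finally have le: "ennreal \<bar>(\<integral>x. indicator E1 x * A e x \<partial>lborel) / m1 + (\<integral>x. indicator E2 x * A e x \<partial>lborel) / m2\<bar> \<le> \<dots>" .
    \<comment> \<open>The potentials are added before Cauchy-Schwarz. If each were estimated by its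
      own norm, the mixed term would become the product of the two norms, and the gain from the
      larger set would be lost.\<close>
    have "ennreal (1 / m1) * (\<integral>\<^sup>+y. ennreal (D y) * kern_pot E1 y \<partial>lborel) + ennreal (1 / m2) * (\<integral>\<^sup>+y. ennreal (D y) * kern_pot E2 y \<partial>lborel)
      = (\<integral>\<^sup>+y. ennreal (D y) * (ennreal (1 / m1) * kern_pot E1 y + ennreal (1 / m2) * kern_pot E2 y) \<partial>lborel)"
      by (simp add: nn_integral_cmult[symmetric] nn_integral_add[symmetric] distrib_left mult_ac)
    also have "\<dots> \<le> ennreal (sqrt (V * Q))"
    proof (rule nn_integral_times_le_sqrt)
      show "(\<integral>\<^sup>+y. (ennreal (1 / m1) * kern_pot E1 y + ennreal (1 / m2) * kern_pot E2 y)\<^sup>2 \<partial>lborel) \<le> ennreal Q"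
        unfolding Q_def by (intro nn_integral_kern_pot_sum_sq E m1 m2)
      have "(\<integral>\<^sup>+y. ennreal (D y) ^ 2 \<partial>lborel) = ennreal V"
        using L2_nn_integral[OF D(1)] D(2) by (simp add: V_def)
      then show "(\<integral>\<^sup>+y. ennreal (D y) ^ 2 \<partial>lborel) \<le> ennreal V" by simp
    qed (use V0 Q0 in auto)
    finally have tail: "ennreal (1 / m1) * (\<integral>\<^sup>+y. ennreal (D y) * kern_pot E1 y \<partial>lborel) + ennreal (1 / m2) * (\<integral>\<^sup>+y. ennreal (D y) * kern_pot E2 y \<partial>lborel)
      \<le> ennreal (sqrt (V * Q))" .
    have head: "ennreal (1 / m1) * ennreal (c * m1) + ennreal (1 / m2) * ennreal (c * m2) = ennreal (2 * c)"
      using m1 m2 c0 by (simp add: ennreal_mult'[symmetric] ennreal_plus[symmetric] del: ennreal_plus)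
    have "ennreal (2 * c) + ennreal (sqrt (V * Q)) = ennreal (2 * c + sqrt (V * Q))"
      using c0 V0 Q0 by (subst ennreal_plus) auto
    with order_trans[OF le add_left_mono[OF tail]]
    have "ennreal \<bar>(\<integral>x. indicator E1 x * A e x \<partial>lborel) / m1 + (\<integral>x. indicator E2 x * A e x \<partial>lborel) / m2\<bar> \<le> ennreal (2 * c + sqrt (V * Q))"
      unfolding head by simp
    then show ?thesis
      using c0 V0 Q0 by (subst (asm) ennreal_le_iff) auto
  qed
  define e where "e n = 1 / real (Suc n)" for n
  have e: "\<And>n. e n > 0" "e \<longlonglongrightarrow> 0"
    using LIMSEQ_inverse_real_of_nat by (simp_all add: e_def[abs_def] inverse_eq_divide del: of_nat_Suc)
  have lim: "(\<lambda>n. \<integral>x. indicator E x * A (e n) x \<partial>lborel) \<longlonglongrightarrow> (\<integral>x. indicator E x * u x \<partial>lborel)"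
    if "E \<in> sets borel" "emeasure lborel E = ennreal m" for E m
    unfolding A_def using that by (intro mollified_average_tendsto Lu e) auto
  have "(\<lambda>n. \<bar>(\<integral>x. indicator E1 x * A (e n) x \<partial>lborel) / m1 + (\<integral>x. indicator E2 x * A (e n) x \<partial>lborel) / m2\<bar>)
    \<longlonglongrightarrow> \<bar>(\<integral>x. indicator E1 x * u x \<partial>lborel) / m1 + (\<integral>x. indicator E2 x * u x \<partial>lborel) / m2\<bar>"
    using m1 m2 by (intro tendsto_intros lim[OF E(1) m1(1)] lim[OF E(2) m2(1)]) auto
  then have "\<bar>(\<integral>x. indicator E1 x * u x \<partial>lborel) / m1 + (\<integral>x. indicator E2 x * u x \<partial>lborel) / m2\<bar> \<le> 2 * c + sqrt (V * Q)"
    by (rule LIMSEQ_le_const2) (use bound[OF e(1)] in blast)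
  then show ?thesis by (simp add: c_def V_def Q_def)
qed

section \<open>Integrability and the critical inequality\<close>

lemma L2_cmult: "L2 u \<Longrightarrow> L2 (\<lambda>x. c * u x)"
  unfolding L2_def power_mult_distrib
  by (intro conjI borel_measurable_times borel_measurable_const integrable_mult_right) auto

lemma energy_ge:
  assumes u: "u \<in> W22" and "\<tau> > 0" "\<sigma> > 0"
  shows "(\<integral>x. (wlap u x)\<^sup>2 \<partial>lborel) + \<sigma> * (\<integral>x. (u x)\<^sup>2 \<partial>lborel) \<le> energy \<tau> \<sigma> u"
proof -
  have i: "integrable lborel (\<lambda>x. (wlap u x)\<^sup>2)" "integrable lborel (\<lambda>x. (u x)\<^sup>2)"
    using W22_wlap[OF u] W22_L2[OF u] by (auto simp: L2_def)
  have ig: "integrable lborel (grad_sq u)"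
    unfolding grad_sq_def using W22_wpartial(2)[OF u] by (intro Bochner_Integration.integrable_sum) (auto simp: L2_def)
  have g0: "grad_sq u x \<ge> 0" for x by (simp add: grad_sq_def sum_nonneg)
  have "(\<integral>x. (wlap u x)\<^sup>2 \<partial>lborel) + \<sigma> * (\<integral>x. (u x)\<^sup>2 \<partial>lborel) = (\<integral>x. (wlap u x)\<^sup>2 + \<sigma> * (u x)\<^sup>2 \<partial>lborel)"
    using i by simp
  also have "\<dots> \<le> energy \<tau> \<sigma> u"
    unfolding energy_def using i ig assms g0
    by (intro integral_mono Bochner_Integration.integrable_add integrable_mult_right) auto
  finally show ?thesis .
qed

lemma superlevel_average:
  fixes v :: "'a::euclidean_space \<Rightarrow> real"
  assumes v: "L2 v" and E: "emeasure lborel {x. v x > a} = ennreal m" "m > 0"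
  shows "a \<le> (\<integral>x. indicator {x. v x > a} x * v x \<partial>lborel) / m"
proof -
  have [measurable]: "v \<in> borel_measurable borel" using v by (rule L2_measurable)
  have m: "{x. v x > a} \<in> sets borel" by measurable
  have "a * m = (\<integral>x. indicator {x. v x > a} x * a \<partial>lborel)"
    using E m by (simp add: measure_def)
  also have "\<dots> \<le> (\<integral>x. indicator {x. v x > a} x * v x \<partial>lborel)"
    using E m v by (intro integral_mono L2_integrable_on_set integrable_mult_left integrable_real_indicator)
      (auto split: split_indicator)
  finally show ?thesis using E by (simp add: field_simps)
qed

text \<open>From level \<open>\<beta> * U\<close> on, Chebyshev's inequality gives measure at most
  1. This keeps \<open>ln (1 / m)\<close> nonnegative and is the range in which the kernel estimates
  hold.\<close>

lemma superlevel_measure: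
  fixes v :: "'a::euclidean_space \<Rightarrow> real"
  assumes v: "L2 v" and U: "(\<integral>x. (v x)\<^sup>2 \<partial>lborel) \<le> U" and \<beta>: "\<beta> > 0" and j: "real j \<ge> \<beta> * U" "j \<ge> 1"
  shows "emeasure lborel {x. v x > sqrt (real j / \<beta>)} = ennreal (measure lborel {x. v x > sqrt (real j / \<beta>)})"
    and "measure lborel {x. v x > sqrt (real j / \<beta>)} \<le> 1"
proof -
  have [measurable]: "v \<in> borel_measurable borel" using v by (rule L2_measurable)
  have U0: "U \<ge> 0" using U by (rule order_trans[rotated]) (intro integral_nonneg_AE AE_I2, simp)
  have "(\<integral>\<^sup>+x. ennreal ((v x)\<^sup>2) \<partial>lborel) = ennreal (\<integral>x. (v x)\<^sup>2 \<partial>lborel)"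
    using v by (intro nn_integral_eq_integral) (auto simp: L2_def)
  also have "\<dots> \<le> ennreal U" using U by (rule ennreal_leI)
  finally have "emeasure lborel {x. v x > sqrt (real j / \<beta>)} \<le> ennreal (U / (sqrt (real j / \<beta>))\<^sup>2)"
    using U0 \<beta> j by (intro emeasure_superlevel_le) auto
  also have "\<dots> \<le> ennreal 1"
    using \<beta> j by (intro ennreal_leI) (simp add: field_simps)
  finally have le: "emeasure lborel {x. v x > sqrt (real j / \<beta>)} \<le> 1" by simp
  then show eq: "emeasure lborel {x. v x > sqrt (real j / \<beta>)} = ennreal (measure lborel {x. v x > sqrt (real j / \<beta>)})"
    by (intro emeasure_eq_ennreal_measure) (auto simp: top_unique)
  show "measure lborel {x. v x > sqrt (real j / \<beta>)} \<le> 1"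
    using le unfolding eq by simp
qed

text \<open>The sign \<open>s\<close> treats \<open>u\<close> and \<open>- u\<close> at once. It is
  pulled out of the integrals and absorbed by the absolute value in
  \<open>set_average_bound\<close>, so nothing has to be said about the chosen weak derivatives of
  \<open>- u\<close>.\<close>

lemma superlevel_pair_bound:
  fixes u D :: "real^4 \<Rightarrow> real"
  assumes u: "u \<in> W22" and D: "L2 D" "\<And>x. D x \<ge> 0" "\<And>x. \<bar>wlap u x\<bar> \<le> M + D x" "M \<ge> 0"
    and R: "R \<ge> 0" "\<And>e. 0 < e \<Longrightarrow> (\<integral>\<^sup>+z. ennreal ((cutrest e z)\<^sup>2) \<partial>lborel) \<le> ennreal R"
    and s: "\<bar>s\<bar> = 1" and a: "a1 \<ge> 0" "a2 \<ge> 0"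
    and m1: "emeasure lborel {x. s * u x > a1} = ennreal m1" "0 < m1" "m1 \<le> 1"
    and m2: "emeasure lborel {x. s * u x > a2} = ennreal m2" "0 < m2" "m2 \<le> 1"
  shows "a1 + a2 \<le> M / 2 + 2 * sqrt (R * (\<integral>x. (u x)\<^sup>2 \<partial>lborel))
      + sqrt ((\<integral>x. (D x)\<^sup>2 \<partial>lborel) * ((3 * ln (1 / m1) + ln (1 / m2) + 16 * (pi\<^sup>2 + 1)) / (32 * pi\<^sup>2)))"
proof -
  let ?E1 = "{x. s * u x > a1}" and ?E2 = "{x. s * u x > a2}"
  have s2: "s\<^sup>2 = 1" using s by (metis one_power2 power2_abs)
  have Lu: "L2 u" using u by (rule W22_L2)
  then have Ls: "L2 (\<lambda>x. s * u x)" by (rule L2_cmult)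
  have [measurable]: "u \<in> borel_measurable borel" using Lu by (rule L2_measurable)
  have E: "?E1 \<in> sets borel" "?E2 \<in> sets borel" by measurable
  have "a1 + a2 \<le> (\<integral>x. indicator ?E1 x * (s * u x) \<partial>lborel) / m1 + (\<integral>x. indicator ?E2 x * (s * u x) \<partial>lborel) / m2"
    using m1 m2 by (intro add_mono superlevel_average Ls) auto
  also have "\<dots> = s * ((\<integral>x. indicator ?E1 x * u x \<partial>lborel) / m1 + (\<integral>x. indicator ?E2 x * u x \<partial>lborel) / m2)"
    by (simp add: mult.left_commute distrib_left)
  also have "\<dots> \<le> \<bar>s\<bar> * \<bar>(\<integral>x. indicator ?E1 x * u x \<partial>lborel) / m1 + (\<integral>x. indicator ?E2 x * u x \<partial>lborel) / m2\<bar>"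
    unfolding abs_mult[symmetric] by (rule abs_ge_self)
  also have "\<dots> \<le> M / 2 + 2 * sqrt (R * (\<integral>x. (u x)\<^sup>2 \<partial>lborel))
      + sqrt ((\<integral>x. (D x)\<^sup>2 \<partial>lborel) * ((3 * ln (1 / m1) + ln (1 / m2) + 16 * (pi\<^sup>2 + 1)) / (32 * pi\<^sup>2)))"
    unfolding s mult_1 by (rule set_average_bound[OF u D R E m1 m2])
  finally show ?thesis .
qed

theorem sup_exp_int_critical_finite:
  assumes \<tau>: "\<tau> > 0" and \<sigma>: "\<sigma> > 0"
  shows "(SUP u\<in>{u::real^4\<Rightarrow>real. u \<in> W22 \<and> energy \<tau> \<sigma> u \<le> 1}. exp_int (32 * pi\<^sup>2) u) < \<infinity>"
proof -
  define \<beta> :: real where "\<beta> = 32 * pi\<^sup>2"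
  have \<beta>: "\<beta> > 0" by (simp add: \<beta>_def)
  obtain R where R: "R > 0" "\<And>e. 0 < e \<Longrightarrow> (\<integral>\<^sup>+z. ennreal ((cutrest e z)\<^sup>2) \<partial>lborel) \<le> ennreal R"
    by (rule nn_integral_cutrest_sq_bounded) (rule that)
  \<comment> \<open>The first summand comes from the kernel estimate, the second is the cut-off
    error after multiplication by \<open>\<beta>\<close>.\<close>
  define C where "C = 16 * (pi\<^sup>2 + 1) + \<beta> * (4 * R / \<sigma>)"
  obtain B where B: "\<And>m J n. J \<ge> 1 \<Longrightarrow> (\<And>j. m j \<ge> 0) \<Longrightarrow>
    (\<And>i j. J \<le> i \<Longrightarrow> i \<le> j \<Longrightarrow> m i > 0 \<Longrightarrow> m j > 0 \<Longrightarrow>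
       (sqrt (real i) + sqrt (real j))\<^sup>2 \<le> 3 * ln (1 / m i) + ln (1 / m j) + C) \<Longrightarrow>
    (\<Sum>j\<in>{J..n}. exp (real j) * m j) \<le> B"
    by (rule level_sum_bounded[of C]) (rule that, blast)
  \<comment> \<open>The energy bound gives \<open>U \<le> 1 / \<sigma>\<close>, so this starting
    level works for all admissible \<open>u\<close> at once; the summand 1 makes it
    positive.\<close>
  define J where "J = nat \<lceil>\<beta> * (1 / \<sigma>)\<rceil> + 1"
  have J: "J \<ge> 1" "\<And>j. j \<ge> J \<Longrightarrow> real j \<ge> \<beta> * (1 / \<sigma>)"
  proof -
    fix j assume "j \<ge> J"
    then have "nat \<lceil>\<beta> * (1 / \<sigma>)\<rceil> \<le> j" unfolding J_def by (rule add_leD1)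
    then show "real j \<ge> \<beta> * (1 / \<sigma>)" by (rule order_trans[OF real_nat_ceiling_ge of_nat_mono])
  qed (simp add: J_def)
  have "exp_int \<beta> u \<le> ennreal (\<beta> * exp (real J) * (1 / \<sigma>) + 2 * exp 1 * B)"
    if u: "u \<in> W22" and en: "energy \<tau> \<sigma> u \<le> 1" for u :: "real^4 \<Rightarrow> real"
  proof -
    define U where "U = (\<integral>x. (u x)\<^sup>2 \<partial>lborel)"
    define V where "V = (\<integral>x. (wlap u x)\<^sup>2 \<partial>lborel)"
    have UV: "U \<ge> 0" "V \<ge> 0" "V + \<sigma> * U \<le> 1"
      using energy_ge[OF u \<tau> \<sigma>] en by (auto simp: U_def V_def)
    have Lu: "L2 u" using u by (rule W22_L2)
    have U\<sigma>: "U \<le> 1 / \<sigma>" using UV \<sigma> by (simp add: field_simps)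
    have sums: "(\<Sum>j\<in>{J..n}. exp (real j) * measure lborel {x. s * u x > sqrt (real j / \<beta>)}) \<le> B"
      if s: "\<bar>s\<bar> = 1" for s n
    proof (rule B[OF J(1)])
      fix i j assume ij: "J \<le> i" "i \<le> j"
        and pos: "0 < measure lborel {x. s * u x > sqrt (real i / \<beta>)}" "0 < measure lborel {x. s * u x > sqrt (real j / \<beta>)}"
      define mi mj where "mi = measure lborel {x. s * u x > sqrt (real i / \<beta>)}"
        and "mj = measure lborel {x. s * u x > sqrt (real j / \<beta>)}"
      have s2: "s\<^sup>2 = 1" using s by (metis one_power2 power2_abs)
      have Ls: "L2 (\<lambda>x. s * u x)" using Lu by (rule L2_cmult)
      have Us: "(\<integral>x. (s * u x)\<^sup>2 \<partial>lborel) \<le> 1 / \<sigma>" using U\<sigma> by (simp add: power_mult_distrib s2 U_def)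
      note mi = superlevel_measure[OF Ls Us \<beta> J(2)[OF ij(1)], folded mi_def]
      note mj = superlevel_measure[OF Ls Us \<beta> J(2)[OF order_trans[OF ij]], folded mj_def]
      have ge1: "i \<ge> 1" "j \<ge> 1" using J(1) ij by auto
      define Q where "Q = (3 * ln (1 / mi) + ln (1 / mj) + 16 * (pi\<^sup>2 + 1)) / (32 * pi\<^sup>2)"
      have Q0: "Q \<ge> 0" unfolding Q_def using pos mi(2) mj(2) ge1
        by (intro divide_nonneg_nonneg add_nonneg_nonneg) (auto simp: mi_def mj_def)
      \<comment> \<open>At the critical exponent the whole Laplacian is the excess part and the
        bounded part is 0: its full norm must be weighed against the energy.\<close>
      have LD: "L2 (\<lambda>x. \<bar>wlap u x\<bar>)" using W22_wlap[OF u] by (auto simp: L2_def)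
      have "sqrt (real i / \<beta>) + sqrt (real j / \<beta>) \<le> 0 / 2 + 2 * sqrt (R * U) + sqrt (V * Q)"
        using superlevel_pair_bound[OF u LD, of 0 R s "sqrt (real i / \<beta>)" "sqrt (real j / \<beta>)" mi mj]
          R s \<beta> pos mi mj ge1 by (simp add: mi_def mj_def U_def V_def Q_def)
      \<comment> \<open>The right side becomes an inner product of two plane vectors. The second,
        \<open>(sqrt (\<sigma> * U), sqrt V)\<close>, has length at most 1 by the energy bound, so
        the square is at most \<open>4 * R / \<sigma> + Q\<close>, with coefficient exactly 1 in
        front of \<open>Q\<close>.\<close>
      also have "\<dots> = sqrt (4 * R / \<sigma>) * sqrt (\<sigma> * U) + sqrt Q * sqrt V"
        using R \<sigma> by (simp add: real_sqrt_mult real_sqrt_divide mult_ac)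
      finally have "sqrt (real i / \<beta>) + sqrt (real j / \<beta>) \<le> sqrt (4 * R / \<sigma>) * sqrt (\<sigma> * U) + sqrt Q * sqrt V" .
      then have "(sqrt (real i / \<beta>) + sqrt (real j / \<beta>))\<^sup>2 \<le> (sqrt (4 * R / \<sigma>) * sqrt (\<sigma> * U) + sqrt Q * sqrt V)\<^sup>2"
        using \<beta> by (intro power_mono) auto
      also have "\<dots> \<le> ((sqrt (4 * R / \<sigma>))\<^sup>2 + (sqrt Q)\<^sup>2) * ((sqrt (\<sigma> * U))\<^sup>2 + (sqrt V)\<^sup>2)"
      proof -
        have "(a * b + c * d)\<^sup>2 \<le> (a\<^sup>2 + c\<^sup>2) * (b\<^sup>2 + d\<^sup>2)" for a b c d :: real
          using zero_le_power2[of "a * d - b * c"] by (simp add: power2_eq_square algebra_simps)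
        then show ?thesis .
      qed
      also have "\<dots> = (4 * R / \<sigma> + Q) * (\<sigma> * U + V)"
        using R \<sigma> UV Q0 by simp
      also have "\<dots> \<le> (4 * R / \<sigma> + Q) * 1"
        using R \<sigma> UV Q0 by (intro mult_left_mono) auto
      finally have le: "(sqrt (real i / \<beta>) + sqrt (real j / \<beta>))\<^sup>2 \<le> 4 * R / \<sigma> + Q" by simp
      have "(sqrt (real i) + sqrt (real j))\<^sup>2 = \<beta> * (sqrt (real i / \<beta>) + sqrt (real j / \<beta>))\<^sup>2"
        using \<beta> by (simp add: real_sqrt_divide add_divide_distrib[symmetric] power_divide)
      also have "\<dots> \<le> \<beta> * (4 * R / \<sigma> + Q)"
        using \<beta> le by (intro mult_left_mono) auto
      also have "\<dots> = 3 * ln (1 / mi) + ln (1 / mj) + C"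
      proof -
        have "\<beta> * Q = 3 * ln (1 / mi) + ln (1 / mj) + 16 * (pi\<^sup>2 + 1)"
          unfolding Q_def \<beta>_def by simp
        then show ?thesis by (simp add: C_def distrib_left)
      qed
      finally show "(sqrt (real i) + sqrt (real j))\<^sup>2 \<le> 3 * ln (1 / measure lborel {x. s * u x > sqrt (real i / \<beta>)})
        + ln (1 / measure lborel {x. s * u x > sqrt (real j / \<beta>)}) + C"
        by (simp add: mi_def mj_def)
    qed simp
    show ?thesis
    proof (rule exp_int_le_level_sums)
      show "u \<in> borel_measurable borel" using Lu by (rule L2_measurable)
      show "(\<integral>\<^sup>+x. ennreal ((u x)\<^sup>2) \<partial>lborel) \<le> ennreal (1 / \<sigma>)"
        using Lu U\<sigma> by (subst nn_integral_eq_integral) (auto simp: L2_def U_def intro!: ennreal_leI)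
      show "(\<Sum>j\<in>{J..n}. exp (real j) * measure lborel {x. u x > sqrt (real j / \<beta>)}) \<le> B" for n
        using sums[of 1 n] by simp
      show "(\<Sum>j\<in>{J..n}. exp (real j) * measure lborel {x. - u x > sqrt (real j / \<beta>)}) \<le> B" for n
        using sums[of "-1" n] by simp
    qed (use \<sigma> \<beta> J in auto)
  qed
  then have "(SUP u\<in>{u::real^4\<Rightarrow>real. u \<in> W22 \<and> energy \<tau> \<sigma> u \<le> 1}. exp_int \<beta> u)
    \<le> ennreal (\<beta> * exp (real J) * (1 / \<sigma>) + 2 * exp 1 * B)"
    by (intro SUP_least) auto
  also have "\<dots> < \<infinity>" by simp
  finally show ?thesis by (simp add: \<beta>_def)
qed

text \<open>Dominated convergence as the truncation height grows. It splits the Laplacian into a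
  bounded part and one of small norm, so that a fixed function behaves as if its exponent were as
  small as desired.\<close>

lemma L2_excess_small:
  fixes f :: "'a::euclidean_space \<Rightarrow> real"
  assumes f: "L2 f" and \<epsilon>: "\<epsilon> > 0"
  obtains M where "M \<ge> 0" "L2 (\<lambda>x. max 0 (\<bar>f x\<bar> - M))" "(\<integral>x. (max 0 (\<bar>f x\<bar> - M))\<^sup>2 \<partial>lborel) < \<epsilon>"
proof -
  have [measurable]: "f \<in> borel_measurable borel" using f by (rule L2_measurable)
  have i: "integrable lborel (\<lambda>x. (f x)\<^sup>2)" using f by (simp add: L2_def)
  have le: "(max 0 (\<bar>t\<bar> - M))\<^sup>2 \<le> t\<^sup>2" if "M \<ge> 0" for t M :: real
  proof -
    have "(max 0 (\<bar>t\<bar> - M))\<^sup>2 \<le> \<bar>t\<bar>\<^sup>2" using that by (intro power_mono) auto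
    then show ?thesis by simp
  qed
  have "(\<lambda>n. \<integral>x. (max 0 (\<bar>f x\<bar> - real n))\<^sup>2 \<partial>lborel) \<longlonglongrightarrow> (\<integral>x. 0 \<partial>(lborel :: 'a measure))"
  proof (rule integral_dominated_convergence[OF _ _ i])
    show "AE x in lborel. (\<lambda>n. (max 0 (\<bar>f x\<bar> - real n))\<^sup>2) \<longlonglongrightarrow> 0"
    proof (rule AE_I2)
      fix x
      obtain N where "\<bar>f x\<bar> \<le> real N" using real_arch_simple by blast
      then have "eventually (\<lambda>n. 0 = (max 0 (\<bar>f x\<bar> - real n))\<^sup>2) sequentially"
        unfolding eventually_sequentially by (intro exI[of _ N]) (auto simp: max_def)
      then show "(\<lambda>n. (max 0 (\<bar>f x\<bar> - real n))\<^sup>2) \<longlonglongrightarrow> 0"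
        by (rule Lim_transform_eventually[OF tendsto_const])
    qed
  qed (use le in auto)
  then have "eventually (\<lambda>n. (\<integral>x. (max 0 (\<bar>f x\<bar> - real n))\<^sup>2 \<partial>lborel) < \<epsilon>) sequentially"
    using \<epsilon> by (intro order_tendstoD(2)) auto
  then obtain n where n: "(\<integral>x. (max 0 (\<bar>f x\<bar> - real n))\<^sup>2 \<partial>lborel) < \<epsilon>"
    by (auto simp: eventually_sequentially)
  have "integrable lborel (\<lambda>x. (max 0 (\<bar>f x\<bar> - real n))\<^sup>2)"
    by (rule Bochner_Integration.integrable_bound[OF i]) (auto intro!: le)
  then have "L2 (\<lambda>x. max 0 (\<bar>f x\<bar> - real n))"
    by (simp add: L2_def)
  with n show ?thesis by (intro that[of "real n"]) auto
qed

theorem single_exp_int_finite: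
  fixes u :: "real^4 \<Rightarrow> real"
  assumes \<alpha>: "\<alpha> > 0" and u: "u \<in> W22"
  shows "exp_int \<alpha> u < \<infinity>"
proof -
  obtain R where R: "R > 0" "\<And>e. 0 < e \<Longrightarrow> (\<integral>\<^sup>+z. ennreal ((cutrest e z)\<^sup>2) \<partial>lborel) \<le> ennreal R"
    by (rule nn_integral_cutrest_sq_bounded) (rule that)
  \<comment> \<open>This threshold makes the level sets decay like
    \<open>exp (- 2 * real j)\<close>, which beats the weight \<open>exp (real j)\<close> of the
    layer-cake sum.\<close>
  obtain M where M: "M \<ge> 0" "L2 (\<lambda>x. max 0 (\<bar>wlap u x\<bar> - M))"
    "(\<integral>x. (max 0 (\<bar>wlap u x\<bar> - M))\<^sup>2 \<partial>lborel) < 32 * pi\<^sup>2 / (4 * \<alpha>)"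
    using L2_excess_small[OF W22_wlap[OF u], of "32 * pi\<^sup>2 / (4 * \<alpha>)"] \<alpha> by auto
  define V where "V = (\<integral>x. (max 0 (\<bar>wlap u x\<bar> - M))\<^sup>2 \<partial>lborel)"
  define U where "U = (\<integral>x. (u x)\<^sup>2 \<partial>lborel)"
  define A where "A = M / 4 + sqrt (R * U)"
  define K :: real where "K = 4 * (pi\<^sup>2 + 1)"
  define C where "C = 4 * \<alpha> * A\<^sup>2 + K"
  have U0: "U \<ge> 0" unfolding U_def by (intro integral_nonneg_AE AE_I2) simp
  have V0: "V \<ge> 0" unfolding V_def by (intro integral_nonneg_AE AE_I2) simp
  have Lu: "L2 u" using u by (rule W22_L2)
  define J where "J = nat \<lceil>\<alpha> * U\<rceil> + 1"
  have J: "J \<ge> 1" "\<And>j. j \<ge> J \<Longrightarrow> real j \<ge> \<alpha> * U"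
  proof -
    fix j assume "j \<ge> J"
    then have "nat \<lceil>\<alpha> * U\<rceil> \<le> j" unfolding J_def by (rule add_leD1)
    then show "real j \<ge> \<alpha> * U" by (rule order_trans[OF real_nat_ceiling_ge of_nat_mono])
  qed (simp add: J_def)
  have level: "measure lborel {x. s * u x > sqrt (real j / \<alpha>)} \<le> exp C * exp (- 2 * real j)"
    if s: "\<bar>s\<bar> = 1" and j: "j \<ge> J" for s j
  proof -
    define m where "m = measure lborel {x. s * u x > sqrt (real j / \<alpha>)}"
    have s2: "s\<^sup>2 = 1" using s by (metis one_power2 power2_abs)
    have Ls: "L2 (\<lambda>x. s * u x)" using Lu by (rule L2_cmult)
    have Us: "(\<integral>x. (s * u x)\<^sup>2 \<partial>lborel) \<le> U" by (simp add: power_mult_distrib s2 U_def)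
    have j1: "j \<ge> 1" using J j by simp
    note m = superlevel_measure[OF Ls Us \<alpha> J(2)[OF j] j1, folded m_def]
    show ?thesis
    proof (cases "m > 0")
      case True
      define t where "t = ln (1 / m)"
      have t: "t \<ge> 0" using True m by (simp add: t_def)
      have K: "K \<ge> 0" by (simp add: K_def)
      let ?a = "sqrt (real j / \<alpha>)"
      \<comment> \<open>Both sets coincide here; strict smallness of the norm leaves room, so one
        superlevel set suffices.\<close>
      have "?a + ?a \<le> M / 2 + 2 * sqrt (R * U) + sqrt (V * ((3 * ln (1 / m) + ln (1 / m) + 16 * (pi\<^sup>2 + 1)) / (32 * pi\<^sup>2)))"
        using superlevel_pair_bound[OF u M(2), of M R s ?a ?a m m] M(1) R s \<alpha> True m by (simp add: U_def V_def)
      also have "V * ((3 * ln (1 / m) + ln (1 / m) + 16 * (pi\<^sup>2 + 1)) / (32 * pi\<^sup>2)) = 2\<^sup>2 * (V / (32 * pi\<^sup>2) * (t + K))"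
        by (simp add: t_def K_def field_simps)
      also have "sqrt \<dots> = 2 * sqrt (V / (32 * pi\<^sup>2) * (t + K))"
        by (subst real_sqrt_mult) simp
      finally have "?a \<le> A + sqrt (V / (32 * pi\<^sup>2) * (t + K))"
        by (simp add: A_def)
      then have "?a\<^sup>2 \<le> (A + sqrt (V / (32 * pi\<^sup>2) * (t + K)))\<^sup>2"
        using \<alpha> by (intro power_mono) auto
      also have "\<dots> \<le> 2 * A\<^sup>2 + 2 * (sqrt (V / (32 * pi\<^sup>2) * (t + K)))\<^sup>2"
        using sum_squares_bound[of A "sqrt (V / (32 * pi\<^sup>2) * (t + K))"] unfolding power2_sum by linarith
      also have "(sqrt (V / (32 * pi\<^sup>2) * (t + K)))\<^sup>2 = V / (32 * pi\<^sup>2) * (t + K)"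
        using V0 t K by simp
      also have "V / (32 * pi\<^sup>2) * (t + K) \<le> 1 / (4 * \<alpha>) * (t + K)"
        using M(3) \<alpha> t K by (intro mult_right_mono) (auto simp: V_def[symmetric] field_simps)
      finally have "real j / \<alpha> \<le> 2 * A\<^sup>2 + 2 * (1 / (4 * \<alpha>) * (t + K))"
        using \<alpha> by simp
      then have "\<alpha> * (real j / \<alpha>) \<le> \<alpha> * (2 * A\<^sup>2 + 2 * (1 / (4 * \<alpha>) * (t + K)))"
        using \<alpha> by (intro mult_left_mono) auto
      then have "real j \<le> 2 * \<alpha> * A\<^sup>2 + (t + K) / 2"
        using \<alpha> by (simp add: distrib_left add_divide_distrib)
      then have "- t \<le> C + - 2 * real j" by (simp add: C_def field_simps)
      then have "exp (- t) \<le> exp (C + - 2 * real j)" by simp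
      moreover have "exp (- t) = m" using True by (simp add: t_def ln_div exp_minus)
      ultimately show ?thesis by (simp only: m_def exp_add)
    next
      case False
      then show ?thesis by (simp add: m_def measure_le_0_iff[symmetric] not_less order_trans[of _ 0])
    qed
  qed
  define B where "B = exp C * (1 / (1 - exp (- 1)))"
  have sums: "(\<Sum>j\<in>{J..n}. exp (real j) * measure lborel {x. s * u x > sqrt (real j / \<alpha>)}) \<le> B"
    if s: "\<bar>s\<bar> = 1" for s n
  proof -
    have "(\<Sum>j\<in>{J..n}. exp (real j) * measure lborel {x. s * u x > sqrt (real j / \<alpha>)})
      \<le> (\<Sum>j\<in>{J..n}. exp C * exp (- 1) ^ j)"
    proof (intro sum_mono)
      fix j assume "j \<in> {J..n}"
      then have "exp (real j) * measure lborel {x. s * u x > sqrt (real j / \<alpha>)} \<le> exp (real j) * (exp C * exp (- 2 * real j))"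
        by (intro mult_left_mono level s) auto
      also have "\<dots> = exp C * exp (- 1) ^ j"
        by (simp add: exp_of_nat_mult[symmetric] exp_add[symmetric])
      finally show "exp (real j) * measure lborel {x. s * u x > sqrt (real j / \<alpha>)} \<le> exp C * exp (- 1) ^ j" .
    qed
    also have "\<dots> = exp C * (\<Sum>j\<in>{J..n}. exp (- 1) ^ j)" by (simp add: sum_distrib_left)
    also have "\<dots> \<le> B"
      unfolding B_def
    proof (intro mult_left_mono)
      have "(\<Sum>j\<in>{J..n}. exp (- 1 :: real) ^ j) \<le> (\<Sum>j. exp (- 1 :: real) ^ j)"
        by (intro sum_le_suminf summable_geometric) auto
      also have "\<dots> = 1 / (1 - exp (- 1))" by (intro suminf_geometric) auto
      finally show "(\<Sum>j\<in>{J..n}. exp (- 1 :: real) ^ j) \<le> 1 / (1 - exp (- 1))" .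
    qed simp
    finally show ?thesis .
  qed
  have "exp_int \<alpha> u \<le> ennreal (\<alpha> * exp (real J) * U + 2 * exp 1 * B)"
  proof (rule exp_int_le_level_sums)
    show "u \<in> borel_measurable borel" using Lu by (rule L2_measurable)
    show "(\<integral>\<^sup>+x. ennreal ((u x)\<^sup>2) \<partial>lborel) \<le> ennreal U"
      using Lu by (subst nn_integral_eq_integral) (auto simp: L2_def U_def)
    show "(\<Sum>j\<in>{J..n}. exp (real j) * measure lborel {x. u x > sqrt (real j / \<alpha>)}) \<le> B" for n
      using sums[of 1 n] by simp
    show "(\<Sum>j\<in>{J..n}. exp (real j) * measure lborel {x. - u x > sqrt (real j / \<alpha>)}) \<le> B" for n
      using sums[of "-1" n] by simp
  qed (use U0 \<alpha> J in auto)
  also have "\<dots> < \<infinity>" by simp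
  finally show ?thesis .
qed

section \<open>Sharpness of the constant\<close>

text \<open>Used to compare the logarithm with \<open>q\<close> to the power -1/2; in the energy
  density it then only produces terms that stay integrable as \<open>e\<close> tends to 0.\<close>

lemma abs_ln_le_inverse_sqrt:
  fixes q :: real
  assumes "0 < q" "q \<le> 2"
  shows "\<bar>ln q\<bar> \<le> 2 * (1 / sqrt q)"
proof (cases "q \<le> 1")
  case True
  have "- ln q = 2 * ln (1 / sqrt q)"
    using assms by (simp add: ln_div ln_sqrt)
  also have "\<dots> \<le> 2 * (1 / sqrt q)"
    using ln_le_minus_one[of "1 / sqrt q"] assms by simp
  finally show ?thesis using True assms by simp
next
  case False
  have "ln q \<le> 1" using ln_le_minus_one[of q] assms by simp
  also have "1 \<le> 2 * (1 / sqrt q)"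
    using assms real_sqrt_le_mono[of q 4] by (simp add: field_simps)
  finally show ?thesis using False by simp
qed

lemma eta_antimono: "0 \<le> s \<Longrightarrow> s \<le> t \<Longrightarrow> t < 1 \<Longrightarrow> eta t \<le> eta s"
  by (simp add: eta_def flat_1 frac_le)

text \<open>A function of the squared distance. \<open>- ln (x \<bullet> x)\<close> is, up to a
  positive factor, the fundamental solution of the squared Laplacian in dimension four;
  \<open>e\<^sup>2\<close> smooths its pole.\<close>

definition logbump :: "real \<Rightarrow> real \<Rightarrow> real" where
  "logbump e s = - (eta s * ln (s + e\<^sup>2))"
definition logbump1 :: "real \<Rightarrow> real \<Rightarrow> real" where
  "logbump1 e s = - (eta1 s * ln (s + e\<^sup>2) + eta s / (s + e\<^sup>2))"
definition logbump2 :: "real \<Rightarrow> real \<Rightarrow> real" where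
  "logbump2 e s = - (eta2 s * ln (s + e\<^sup>2) + 2 * (eta1 s / (s + e\<^sup>2)) - eta s / (s + e\<^sup>2)\<^sup>2)"

lemma ln_shift_deriv:
  "s + b > 0 \<Longrightarrow> ((\<lambda>s. ln (s + b)) has_real_derivative 1 / (s + b)) (at s)"
  by (auto intro!: derivative_eq_intros)

lemma inverse_shift_deriv:
  "s + b > 0 \<Longrightarrow> ((\<lambda>s. 1 / (s + b)) has_real_derivative - (1 / (s + b)\<^sup>2)) (at s)"
  for s b :: real
  by (auto intro!: derivative_eq_intros simp: power2_eq_square)

lemma logbump_deriv:
  assumes "e > 0" "s \<ge> 0"
  shows "(logbump e has_real_derivative logbump1 e s) (at s)" (is ?A)
    and "(logbump1 e has_real_derivative logbump2 e s) (at s)" (is ?B)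
proof -
  define q where "q = s + e\<^sup>2"
  have q: "q > 0" using assms by (simp add: q_def add_nonneg_pos)
  note l = ln_shift_deriv[OF q[unfolded q_def], folded q_def]
    and r = inverse_shift_deriv[OF q[unfolded q_def], folded q_def]
  have "((\<lambda>s. - (eta s * ln (s + e\<^sup>2))) has_real_derivative - (eta1 s * ln (s + e\<^sup>2) + 1 / q * eta s)) (at s)"
    by (intro DERIV_minus DERIV_mult eta_deriv l)
  then show ?A by (simp add: logbump_def[abs_def] logbump1_def q_def)
  have "((\<lambda>s. - (eta1 s * ln (s + e\<^sup>2) + eta s * (1 / (s + e\<^sup>2)))) has_real_derivative
    - ((eta2 s * ln (s + e\<^sup>2) + 1 / q * eta1 s) + (eta1 s * (1 / (s + e\<^sup>2)) + - (1 / q\<^sup>2) * eta s))) (at s)"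
    by (intro DERIV_minus DERIV_add DERIV_mult eta_deriv eta1_deriv l r)
  then show ?B by (simp add: logbump1_def[abs_def] logbump2_def q_def diff_diff_eq add_ac)
qed

lemma test_fun_logbump:
  assumes "e > 0"
  shows "test_fun (\<lambda>x :: 'a::euclidean_space. c * logbump e ((x - a) \<bullet> (x - a)))"
proof -
  have eq: "(\<lambda>x :: 'a. c * logbump e ((x - a) \<bullet> (x - a))) =
    (\<lambda>x. (- c * ln ((x - a) \<bullet> (x - a) + e\<^sup>2)) * eta ((x - a) \<bullet> (x - a)))"
    by (simp add: fun_eq_iff logbump_def)
  have "(x - a) \<bullet> (x - a) + e\<^sup>2 > 0" for x :: 'a
    using assms by (simp add: add_nonneg_pos)
  then show ?thesis
    unfolding eq
    by (intro test_fun_times[OF test_fun_eta] Cinf_times Cinf_const Cinf_ln Cinf_plus Cinf_inner_self)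
qed

text \<open>Only \<open>16 / q\<^sup>2\<close>, with \<open>q = s + e\<^sup>2\<close>, has an
  unbounded integral as \<open>e\<close> tends to 0, and its coefficient decides the sharp constant.
  Everything else is pushed into terms whose integrals against the radial weight \<open>s\<close>
  stay bounded.\<close>

lemma logbump_energy_density:
  assumes "\<tau> > 0" "\<sigma> > 0"
  obtains C where "C \<ge> 0" "\<And>e s. 0 < e \<Longrightarrow> e \<le> 1 \<Longrightarrow> 0 \<le> s \<Longrightarrow> s < 1 \<Longrightarrow>
    (8 * logbump1 e s + 4 * s * logbump2 e s)\<^sup>2 + \<tau> * (4 * s * (logbump1 e s)\<^sup>2) + \<sigma> * (logbump e s)\<^sup>2
      \<le> 16 / (s + e\<^sup>2)\<^sup>2 + 64 * e\<^sup>2 / (s + e\<^sup>2) ^ 3 + C / ((s + e\<^sup>2) * sqrt (s + e\<^sup>2))"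
proof -
  obtain H where H: "H \<ge> 1" "\<And>s. s \<ge> 0 \<Longrightarrow> \<bar>eta1 s\<bar> \<le> H" "\<And>s. s \<ge> 0 \<Longrightarrow> \<bar>eta2 s\<bar> \<le> H"
    by (rule eta_bound) (rule that)
  \<comment> \<open>The summands are the bounds \<open>L\<close>, \<open>G\<close> and
    \<open>Z\<close> below for the Laplacian, the gradient and the function, in multiples of
    \<open>w ^ 3\<close>.\<close>
  define C where "C = (320 * H + 6400 * H\<^sup>2) + \<tau> * (256 * H\<^sup>2 + 16) + \<sigma> * 8"
  have C0: "C \<ge> 0" using assms H(1) by (simp add: C_def)
  show ?thesis
  proof (rule that[OF C0])
    fix e s :: real assume e: "0 < e" "e \<le> 1" and s: "0 \<le> s" "s < 1"
    define q where "q = s + e\<^sup>2"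
    define w where "w = 1 / sqrt q"
    define g where "g = ln q"
    have e2: "e\<^sup>2 \<le> 1" using e by (simp add: power_le_one)
    have q: "q > 0" "q \<le> 2" "s \<le> q" "e\<^sup>2 \<le> q" "s = q - e\<^sup>2"
      using e e2 s by (auto simp: q_def add_nonneg_pos)
    have w: "w > 0" "w\<^sup>2 = 1 / q" using q by (auto simp: w_def power_divide)
    \<comment> \<open>Since \<open>q\<close> is at most 2, \<open>w\<close> is bounded below, and
      lower powers of \<open>w\<close> can be raised to \<open>w ^ 3\<close> at the cost of a
      constant.\<close>
    have w1: "1 \<le> 2 * w"
      using q real_sqrt_le_mono[of q 4] by (simp add: w_def field_simps)
    have w3: "w ^ 3 = 1 / (q * sqrt q)"
    proof -
      have "w ^ 3 = w\<^sup>2 * w" by (simp add: eval_nat_numeral)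
      also have "\<dots> = 1 / (q * sqrt q)" unfolding w(2) by (simp add: w_def)
      finally show ?thesis .
    qed
    have w23: "w\<^sup>2 \<le> 2 * w ^ 3"
      using mult_left_mono[OF w1, of "w\<^sup>2"] by (simp add: eval_nat_numeral mult_ac)
    have w03: "1 \<le> 8 * w ^ 3"
      using power_mono[OF w1, of 3] by (simp add: power_mult_distrib)
    have g: "\<bar>g\<bar> \<le> 2 * w" unfolding g_def w_def by (rule abs_ln_le_inverse_sqrt[OF q(1,2)])
    have eta: "0 \<le> eta s" "eta s \<le> 1" using eta_nonneg eta_le_1 s by auto
    have H': "\<bar>eta1 s\<bar> \<le> H" "\<bar>eta2 s\<bar> \<le> H" using H s by auto
    have sq: "s / q \<le> 1" "s / q \<ge> 0" using q s by auto
    \<comment> \<open>The bracket multiplied by \<open>eta s\<close> is the Laplacian of the bare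
      logarithm up to sign; all other terms contain a derivative of the cut-off and are at most a
      multiple of \<open>w\<close>.\<close>
    have lap: "8 * logbump1 e s + 4 * s * logbump2 e s
      = - (eta s * (4 / q + 4 * e\<^sup>2 / q\<^sup>2) + g * (8 * eta1 s + 4 * s * eta2 s) + 8 * (s / q) * eta1 s)"
    proof -
      have "e\<^sup>2 = q - s" by (simp add: q_def)
      have i: "8 * (eta s / q) - 4 * s * (eta s / q\<^sup>2) = eta s * (4 / q + 4 * e\<^sup>2 / q\<^sup>2)"
        unfolding \<open>e\<^sup>2 = q - s\<close> using q(1) by (simp add: divide_simps) (simp add: algebra_simps power2_eq_square)
      have "8 * logbump1 e s + 4 * s * logbump2 e s
        = - ((8 * (eta s / q) - 4 * s * (eta s / q\<^sup>2)) + g * (8 * eta1 s + 4 * s * eta2 s) + 8 * (s / q) * eta1 s)"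
        unfolding logbump1_def logbump2_def q_def[symmetric] g_def[symmetric] by (simp add: algebra_simps)
      then show ?thesis unfolding i .
    qed
    have "\<bar>8 * logbump1 e s + 4 * s * logbump2 e s\<bar> \<le> (4 / q + 4 * e\<^sup>2 / q\<^sup>2) + 40 * H * w"
    proof -
      have a: "\<bar>eta s * (4 / q + 4 * e\<^sup>2 / q\<^sup>2)\<bar> \<le> 1 * (4 / q + 4 * e\<^sup>2 / q\<^sup>2)"
        unfolding abs_mult using eta q(1) by (intro mult_mono) auto
      have "\<bar>s * eta2 s\<bar> \<le> 1 * H"
        unfolding abs_mult using s H' by (intro mult_mono) auto
      then have "\<bar>8 * eta1 s + 4 * s * eta2 s\<bar> \<le> 12 * H"
        using H' by (simp add: abs_le_iff)
      then have b: "\<bar>g * (8 * eta1 s + 4 * s * eta2 s)\<bar> \<le> (2 * w) * (12 * H)"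
        unfolding abs_mult using g w by (intro mult_mono) auto
      have "\<bar>(s / q) * eta1 s\<bar> \<le> (2 * w) * H"
        unfolding abs_mult using sq w1 H' w by (intro mult_mono) auto
      then have "8 * \<bar>(s / q) * eta1 s\<bar> \<le> 8 * ((2 * w) * H)" by (rule mult_left_mono) simp
      moreover have "\<bar>8 * (s / q) * eta1 s\<bar> = 8 * \<bar>(s / q) * eta1 s\<bar>" by (simp add: abs_mult)
      moreover have "8 * ((2 * w) * H) = 16 * (H * w)" by simp
      ultimately have c: "\<bar>8 * (s / q) * eta1 s\<bar> \<le> 16 * (H * w)" by (simp only:)
      have tri: "\<bar>x + y + z\<bar> \<le> \<bar>x\<bar> + \<bar>y\<bar> + \<bar>z\<bar>" for x y z :: real by linarith
      have "1 * (4 / q + 4 * e\<^sup>2 / q\<^sup>2) + (2 * w) * (12 * H) + 16 * (H * w) = (4 / q + 4 * e\<^sup>2 / q\<^sup>2) + 40 * H * w"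
        by simp
      with order_trans[OF tri add_mono[OF add_mono[OF a b] c]] show ?thesis
        unfolding lap abs_minus_cancel by (simp only:)
    qed
    then have "(8 * logbump1 e s + 4 * s * logbump2 e s)\<^sup>2 \<le> ((4 / q + 4 * e\<^sup>2 / q\<^sup>2) + 40 * H * w)\<^sup>2"
      by (metis abs_ge_zero power2_abs power_mono)
    also have "\<dots> \<le> 16 / q\<^sup>2 + 64 * e\<^sup>2 / q ^ 3 + (320 * H + 6400 * H\<^sup>2) * w ^ 3"
    proof -
      let ?a = "4 / q" and ?b = "4 * e\<^sup>2 / q\<^sup>2" and ?d = "40 * H * w"
      \<comment> \<open>Only the product of \<open>?b\<close> and \<open>?d\<close> is split by the
        arithmetic-geometric mean. The leading square \<open>?a\<^sup>2\<close> must keep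
        coefficient 1.\<close>
      have sqe: "((?a + ?b) + ?d)\<^sup>2 \<le> ?a\<^sup>2 + 2 * ?a * ?b + 2 * ?a * ?d + 2 * ?b\<^sup>2 + 2 * ?d\<^sup>2"
        using sum_squares_bound[of ?b ?d] by (simp add: power2_sum algebra_simps)
      have t1: "?a\<^sup>2 = 16 / q\<^sup>2" by (simp add: power_divide)
      have t2: "2 * ?a * ?b = 32 * (e\<^sup>2 / q ^ 3)" by (simp add: eval_nat_numeral)
      have t3: "2 * ?a * ?d = 320 * H * w ^ 3"
      proof -
        have "2 * ?a * ?d = 320 * H * (1 / q * w)" by simp
        then show ?thesis unfolding w(2)[symmetric] by (simp add: eval_nat_numeral)
      qed
      have t4: "2 * ?b\<^sup>2 \<le> 32 * (e\<^sup>2 / q ^ 3)"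
      proof -
        have "2 * ?b\<^sup>2 = 32 * ((e\<^sup>2 * e\<^sup>2) / q ^ 4)" by (simp add: power_divide power_mult_distrib eval_nat_numeral)
        also have "\<dots> \<le> 32 * ((e\<^sup>2 * q) / q ^ 4)"
          using q by (intro mult_left_mono divide_right_mono) auto
        also have "\<dots> = 32 * (e\<^sup>2 / q ^ 3)" using q by (simp add: eval_nat_numeral)
        finally show ?thesis .
      qed
      have t5: "2 * ?d\<^sup>2 \<le> 6400 * H\<^sup>2 * w ^ 3"
        using mult_left_mono[OF w23, of "3200 * H\<^sup>2"] by (simp add: power_mult_distrib)
      have "((?a + ?b) + ?d)\<^sup>2 \<le> 16 / q\<^sup>2 + 32 * (e\<^sup>2 / q ^ 3) + 320 * H * w ^ 3 + 32 * (e\<^sup>2 / q ^ 3) + 6400 * H\<^sup>2 * w ^ 3"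
        using sqe t4 t5 unfolding t1 t2 t3 by linarith
      also have "\<dots> = 16 / q\<^sup>2 + 64 * e\<^sup>2 / q ^ 3 + (320 * H + 6400 * H\<^sup>2) * w ^ 3"
        by (simp add: distrib_right)
      finally show ?thesis .
    qed
    finally have L: "(8 * logbump1 e s + 4 * s * logbump2 e s)\<^sup>2 \<le> 16 / q\<^sup>2 + 64 * e\<^sup>2 / q ^ 3 + (320 * H + 6400 * H\<^sup>2) * w ^ 3" .
    have G: "4 * s * (logbump1 e s)\<^sup>2 \<le> (256 * H\<^sup>2 + 16) * w ^ 3"
    proof -
      have "\<bar>logbump1 e s\<bar> \<le> \<bar>eta1 s * g\<bar> + \<bar>eta s / q\<bar>"
        unfolding logbump1_def q_def[symmetric] g_def[symmetric] abs_minus_cancel by (rule abs_triangle_ineq)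
      also have "\<dots> \<le> H * (2 * w) + w\<^sup>2"
      proof (rule add_mono)
        show "\<bar>eta1 s * g\<bar> \<le> H * (2 * w)" unfolding abs_mult using H' g H(1) by (intro mult_mono) auto
        show "\<bar>eta s / q\<bar> \<le> w\<^sup>2" unfolding w(2) using eta q by (simp add: divide_right_mono)
      qed
      finally have "(logbump1 e s)\<^sup>2 \<le> (H * (2 * w) + w\<^sup>2)\<^sup>2"
        by (metis abs_ge_zero power2_abs power_mono)
      also have "\<dots> \<le> 2 * (H * (2 * w))\<^sup>2 + 2 * (w\<^sup>2)\<^sup>2"
        using sum_squares_bound[of "H * (2 * w)" "w\<^sup>2"] unfolding power2_sum by linarith
      also have "\<dots> = 8 * H\<^sup>2 * w\<^sup>2 + 2 * w\<^sup>2 * w\<^sup>2"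
        by (simp add: power_mult_distrib power2_eq_square)
      finally have "4 * s * (logbump1 e s)\<^sup>2 \<le> 4 * q * (8 * H\<^sup>2 * w\<^sup>2 + 2 * w\<^sup>2 * w\<^sup>2)"
        using q s by (intro mult_mono) auto
      also have "\<dots> = (q * w\<^sup>2) * (32 * H\<^sup>2 + 8 * w\<^sup>2)" by (simp add: algebra_simps)
      also have "q * w\<^sup>2 = 1" using w(2) q by simp
      also have "1 * (32 * H\<^sup>2 + 8 * w\<^sup>2) \<le> 32 * H\<^sup>2 * (8 * w ^ 3) + 8 * (2 * w ^ 3)"
        using mult_left_mono[OF w03, of "32 * H\<^sup>2"] w23 by simp
      finally show ?thesis by (simp add: algebra_simps)
    qed
    have Z: "(logbump e s)\<^sup>2 \<le> 8 * w ^ 3"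
    proof -
      have "\<bar>logbump e s\<bar> \<le> 1 * (2 * w)"
        unfolding logbump_def q_def[symmetric] g_def[symmetric] abs_minus_cancel abs_mult
        using eta g by (intro mult_mono) auto
      then have "(logbump e s)\<^sup>2 \<le> (1 * (2 * w))\<^sup>2" by (metis abs_ge_zero power2_abs power_mono)
      then show ?thesis using w23 by (simp add: power_mult_distrib)
    qed
    have "(8 * logbump1 e s + 4 * s * logbump2 e s)\<^sup>2 + \<tau> * (4 * s * (logbump1 e s)\<^sup>2) + \<sigma> * (logbump e s)\<^sup>2
      \<le> (16 / q\<^sup>2 + 64 * e\<^sup>2 / q ^ 3 + (320 * H + 6400 * H\<^sup>2) * w ^ 3) + \<tau> * ((256 * H\<^sup>2 + 16) * w ^ 3) + \<sigma> * (8 * w ^ 3)"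
      using assms by (intro add_mono mult_left_mono L G Z) auto
    also have "\<dots> = 16 / q\<^sup>2 + 64 * e\<^sup>2 / q ^ 3 + C * w ^ 3"
      by (simp add: C_def algebra_simps)
    finally show "(8 * logbump1 e s + 4 * s * logbump2 e s)\<^sup>2 + \<tau> * (4 * s * (logbump1 e s)\<^sup>2) + \<sigma> * (logbump e s)\<^sup>2
      \<le> 16 / (s + e\<^sup>2)\<^sup>2 + 64 * e\<^sup>2 / (s + e\<^sup>2) ^ 3 + C / ((s + e\<^sup>2) * sqrt (s + e\<^sup>2))"
      unfolding w3 q_def by simp
  qed
qed

text \<open>The weight \<open>s\<close> is at most \<open>q = s + e\<^sup>2\<close> and lowers each
  power by one. The leading term then integrates to
  \<open>16 * pi\<^sup>2 * (ln (1 + e\<^sup>2) - ln (e\<^sup>2))\<close>, where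
  \<open>- ln (e\<^sup>2) = 2 * ln (1 / e)\<close> gives the 32; the rest is bounded.\<close>

lemma logbump_density_integral:
  assumes e: "0 < e" "e \<le> 1" and C: "C \<ge> 0"
  shows "(\<integral>\<^sup>+s. ennreal (pi\<^sup>2 * s) * ennreal (if 0 \<le> s \<and> s < 1 then
      16 / (s + e\<^sup>2)\<^sup>2 + 64 * e\<^sup>2 / (s + e\<^sup>2) ^ 3 + C / ((s + e\<^sup>2) * sqrt (s + e\<^sup>2)) else 0) \<partial>lborel)
    \<le> ennreal (32 * pi\<^sup>2 * ln (1 / e) + pi\<^sup>2 * (16 * ln 2 + 64 + 4 * C))"
proof -
  let ?F = "\<lambda>s. pi\<^sup>2 * (16 * ln (s + e\<^sup>2) - 64 * e\<^sup>2 / (s + e\<^sup>2) + 2 * C * sqrt (s + e\<^sup>2))"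
  have "(\<integral>\<^sup>+s. ennreal (pi\<^sup>2 * s) * ennreal (if 0 \<le> s \<and> s < 1 then
      16 / (s + e\<^sup>2)\<^sup>2 + 64 * e\<^sup>2 / (s + e\<^sup>2) ^ 3 + C / ((s + e\<^sup>2) * sqrt (s + e\<^sup>2)) else 0) \<partial>lborel)
    \<le> (\<integral>\<^sup>+s. ennreal (pi\<^sup>2 * (16 / (s + e\<^sup>2) + 64 * e\<^sup>2 / (s + e\<^sup>2)\<^sup>2 + C / sqrt (s + e\<^sup>2))) * indicator {0..1} s \<partial>lborel)"
  proof (intro nn_integral_mono)
    fix s :: real
    show "ennreal (pi\<^sup>2 * s) * ennreal (if 0 \<le> s \<and> s < 1 then
      16 / (s + e\<^sup>2)\<^sup>2 + 64 * e\<^sup>2 / (s + e\<^sup>2) ^ 3 + C / ((s + e\<^sup>2) * sqrt (s + e\<^sup>2)) else 0)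
      \<le> ennreal (pi\<^sup>2 * (16 / (s + e\<^sup>2) + 64 * e\<^sup>2 / (s + e\<^sup>2)\<^sup>2 + C / sqrt (s + e\<^sup>2))) * indicator {0..1} s"
    proof (cases "0 \<le> s \<and> s < 1")
      case True
      define q where "q = s + e\<^sup>2"
      have q: "q > 0" "s \<le> q" using e True by (auto simp: q_def add_nonneg_pos)
      have "s * (16 / q\<^sup>2 + 64 * e\<^sup>2 / q ^ 3 + C / (q * sqrt q)) \<le> q * (16 / q\<^sup>2 + 64 * e\<^sup>2 / q ^ 3 + C / (q * sqrt q))"
        using q C by (intro mult_right_mono) auto
      also have "\<dots> = 16 / q + 64 * e\<^sup>2 / q\<^sup>2 + C / sqrt q"
        using q by (simp add: distrib_left eval_nat_numeral)
      finally have "pi\<^sup>2 * (s * (16 / q\<^sup>2 + 64 * e\<^sup>2 / q ^ 3 + C / (q * sqrt q))) \<le> pi\<^sup>2 * (16 / q + 64 * e\<^sup>2 / q\<^sup>2 + C / sqrt q)"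
        by (rule mult_left_mono) simp
      then have "ennreal (pi\<^sup>2 * s) * ennreal (16 / q\<^sup>2 + 64 * e\<^sup>2 / q ^ 3 + C / (q * sqrt q)) \<le> ennreal (pi\<^sup>2 * (16 / q + 64 * e\<^sup>2 / q\<^sup>2 + C / sqrt q))"
        using True by (subst ennreal_mult'[symmetric]) (auto intro!: ennreal_leI simp: mult.assoc)
      then show ?thesis using True by (simp add: q_def)
    qed auto
  qed
  also have "\<dots> = ennreal (?F 1 - ?F 0)"
  proof (intro nn_integral_FTC_Icc)
    fix s :: real assume "s \<in> {0..1}"
    then have q: "s + e\<^sup>2 > 0" using e by (simp add: add_nonneg_pos)
    define q where "q = s + e\<^sup>2"
    have "((\<lambda>s. sqrt (s + e\<^sup>2)) has_real_derivative inverse (sqrt q) / 2 * 1) (at s)"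
      unfolding q_def by (rule DERIV_chain2[where f = sqrt], rule DERIV_real_sqrt, rule q)
        (auto intro!: derivative_eq_intros)
    note d = DERIV_cmult[OF ln_shift_deriv[OF q], of 16] DERIV_cmult[OF inverse_shift_deriv[OF q], of "64 * e\<^sup>2"]
      DERIV_cmult[OF this, of "2 * C"]
    from DERIV_cmult[OF DERIV_add[OF DERIV_diff[OF d(1,2)] d(3)], of "pi\<^sup>2"]
    show "(?F has_real_derivative pi\<^sup>2 * (16 / (s + e\<^sup>2) + 64 * e\<^sup>2 / (s + e\<^sup>2)\<^sup>2 + C / sqrt (s + e\<^sup>2))) (at s)"
      by (simp add: q_def inverse_eq_divide)
    show "0 \<le> pi\<^sup>2 * (16 / (s + e\<^sup>2) + 64 * e\<^sup>2 / (s + e\<^sup>2)\<^sup>2 + C / sqrt (s + e\<^sup>2))"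
      using q C by (intro mult_nonneg_nonneg add_nonneg_nonneg) auto
  qed auto
  also have "\<dots> \<le> ennreal (32 * pi\<^sup>2 * ln (1 / e) + pi\<^sup>2 * (16 * ln 2 + 64 + 4 * C))"
  proof (intro ennreal_leI)
    have e2: "e\<^sup>2 \<le> 1" using e by (simp add: power_le_one)
    have "ln (1 + e\<^sup>2) \<le> ln 2" using e2 e by (intro ln_mono) (auto simp: add_pos_nonneg)
    moreover have "ln (0 + e\<^sup>2) = - 2 * ln (1 / e)" using e by (simp add: ln_div ln_realpow)
    moreover have "64 * e\<^sup>2 / (1 + e\<^sup>2) \<ge> 0" by simp
    moreover have "64 * e\<^sup>2 / (0 + e\<^sup>2) = 64" using e by simp
    moreover have "2 * C * sqrt (1 + e\<^sup>2) \<le> 2 * C * 2"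
      using C e2 real_sqrt_le_mono[of "1 + e\<^sup>2" 4] by (intro mult_left_mono) auto
    moreover have "2 * C * sqrt (0 + e\<^sup>2) \<ge> 0" using C by simp
    ultimately have "(16 * ln (1 + e\<^sup>2) - 64 * e\<^sup>2 / (1 + e\<^sup>2) + 2 * C * sqrt (1 + e\<^sup>2))
      - (16 * ln (0 + e\<^sup>2) - 64 * e\<^sup>2 / (0 + e\<^sup>2) + 2 * C * sqrt (0 + e\<^sup>2)) \<le> 32 * ln (1 / e) + (16 * ln 2 + 64 + 4 * C)"
      by linarith
    then have "pi\<^sup>2 * ((16 * ln (1 + e\<^sup>2) - 64 * e\<^sup>2 / (1 + e\<^sup>2) + 2 * C * sqrt (1 + e\<^sup>2))
      - (16 * ln (0 + e\<^sup>2) - 64 * e\<^sup>2 / (0 + e\<^sup>2) + 2 * C * sqrt (0 + e\<^sup>2))) \<le> pi\<^sup>2 * (32 * ln (1 / e) + (16 * ln 2 + 64 + 4 * C))"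
      by (rule mult_left_mono) simp
    then show "?F 1 - ?F 0 \<le> 32 * pi\<^sup>2 * ln (1 / e) + pi\<^sup>2 * (16 * ln 2 + 64 + 4 * C)"
      by (simp only: right_diff_distrib[symmetric]) (simp add: distrib_left mult_ac)
  qed
  finally show ?thesis .
qed

lemma logbump_energy:
  assumes "\<tau> > 0" "\<sigma> > 0"
  obtains C where "C > 0" "\<And>e c. 0 < e \<Longrightarrow> e \<le> 1 \<Longrightarrow>
    energy \<tau> \<sigma> (\<lambda>x::real^4. c * logbump e (x \<bullet> x)) \<le> c\<^sup>2 * (32 * pi\<^sup>2 * ln (1 / e) + C)"
proof -
  obtain C where C: "C \<ge> 0" "\<And>e s. 0 < e \<Longrightarrow> e \<le> 1 \<Longrightarrow> 0 \<le> s \<Longrightarrow> s < 1 \<Longrightarrow>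
    (8 * logbump1 e s + 4 * s * logbump2 e s)\<^sup>2 + \<tau> * (4 * s * (logbump1 e s)\<^sup>2) + \<sigma> * (logbump e s)\<^sup>2
      \<le> 16 / (s + e\<^sup>2)\<^sup>2 + 64 * e\<^sup>2 / (s + e\<^sup>2) ^ 3 + C / ((s + e\<^sup>2) * sqrt (s + e\<^sup>2))"
    by (rule logbump_energy_density[OF assms]) (rule that)
  define C' where "C' = pi\<^sup>2 * (16 * ln 2 + 64 + 4 * C)"
  have "C' > 0" unfolding C'_def using C(1) by (intro mult_pos_pos add_pos_nonneg) auto
  moreover have "energy \<tau> \<sigma> (\<lambda>x::real^4. c * logbump e (x \<bullet> x)) \<le> c\<^sup>2 * (32 * pi\<^sup>2 * ln (1 / e) + C')"
    if e: "0 < e" "e \<le> 1" for e c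
  proof -
    let ?f = "\<lambda>x::real^4. c * logbump e (x \<bullet> x)"
    define \<Phi> where "\<Phi> s = (8 * logbump1 e s + 4 * s * logbump2 e s)\<^sup>2 + \<tau> * (4 * s * (logbump1 e s)\<^sup>2) + \<sigma> * (logbump e s)\<^sup>2" for s
    have [measurable]: "eta \<in> borel_measurable borel" "eta1 \<in> borel_measurable borel" "eta2 \<in> borel_measurable borel"
      by (intro borel_measurable_continuous_onI eta_continuous)+
    have \<Phi>m[measurable]: "\<Phi> \<in> borel_measurable borel"
      unfolding \<Phi>_def[abs_def] logbump_def logbump1_def logbump2_def by measurable
    have \<Phi>0: "\<Phi> s \<ge> 0" if "s \<ge> 0" for s
      unfolding \<Phi>_def using assms that by (intro add_nonneg_nonneg mult_nonneg_nonneg) auto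
    have d: "((\<lambda>s. c * logbump e s) has_real_derivative c * logbump1 e s) (at s)"
      "((\<lambda>s. c * logbump1 e s) has_real_derivative c * logbump2 e s) (at s)" if "s \<ge> 0" for s
      using logbump_deriv[OF e(1) that] by (auto intro: DERIV_cmult)
    have tf: "test_fun ?f" using test_fun_logbump[OF e(1), of c "0::real^4"] by simp
    have "energy \<tau> \<sigma> ?f = (\<integral>x. c\<^sup>2 * \<Phi> (x \<bullet> x) \<partial>(lborel :: (real^4) measure))"
      unfolding energy_test_fun[OF tf]
    proof (intro Bochner_Integration.integral_cong refl)
      fix x :: "real^4"
      have l: "(\<Sum>b\<in>Basis. partial b (partial b ?f) x) = 8 * (c * logbump1 e (x \<bullet> x)) + 4 * (x \<bullet> x) * (c * logbump2 e (x \<bullet> x))"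
        using laplacian_radial[of "\<lambda>s. c * logbump e s" "\<lambda>s. c * logbump1 e s" "\<lambda>s. c * logbump2 e s" 0 x, OF d] by simp
      have g: "(\<Sum>b\<in>Basis. (partial b ?f x)\<^sup>2) = 4 * (x \<bullet> x) * (c * logbump1 e (x \<bullet> x))\<^sup>2"
        using gradient_sq_radial[of "\<lambda>s. c * logbump e s" "\<lambda>s. c * logbump1 e s" 0 x, OF d(1)] by simp
      show "(\<Sum>b\<in>Basis. partial b (partial b ?f) x)\<^sup>2 + \<tau> * (\<Sum>b\<in>Basis. (partial b ?f x)\<^sup>2) + \<sigma> * (?f x)\<^sup>2 = c\<^sup>2 * \<Phi> (x \<bullet> x)"
        unfolding l g \<Phi>_def by (simp add: power2_eq_square algebra_simps)
    qed
    also have "\<dots> = c\<^sup>2 * (\<integral>x. \<Phi> (x \<bullet> x) \<partial>(lborel :: (real^4) measure))" by simp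
    also have "(\<integral>x. \<Phi> (x \<bullet> x) \<partial>(lborel :: (real^4) measure)) \<le> 32 * pi\<^sup>2 * ln (1 / e) + C'"
    proof -
      have "(\<integral>\<^sup>+x. ennreal (\<Phi> (x \<bullet> x)) \<partial>(lborel :: (real^4) measure)) = (\<integral>\<^sup>+s. ennreal (pi\<^sup>2 * s) * ennreal (\<Phi> s) \<partial>lborel)"
        by (rule nn_integral_radial) measurable
      also have "\<dots> \<le> (\<integral>\<^sup>+s. ennreal (pi\<^sup>2 * s) * ennreal (if 0 \<le> s \<and> s < 1 then
          16 / (s + e\<^sup>2)\<^sup>2 + 64 * e\<^sup>2 / (s + e\<^sup>2) ^ 3 + C / ((s + e\<^sup>2) * sqrt (s + e\<^sup>2)) else 0) \<partial>lborel)"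
      proof (intro nn_integral_mono)
        fix s :: real
        consider "s < 0" | "0 \<le> s" "s < 1" | "s \<ge> 1" by linarith
        then show "ennreal (pi\<^sup>2 * s) * ennreal (\<Phi> s) \<le> ennreal (pi\<^sup>2 * s) * ennreal (if 0 \<le> s \<and> s < 1 then
          16 / (s + e\<^sup>2)\<^sup>2 + 64 * e\<^sup>2 / (s + e\<^sup>2) ^ 3 + C / ((s + e\<^sup>2) * sqrt (s + e\<^sup>2)) else 0)"
        proof cases
          case 1
          then have "ennreal (pi\<^sup>2 * s) = 0" by (simp add: ennreal_neg mult_le_0_iff)
          then show ?thesis by simp
        next
          case 2
          then show ?thesis using C(2)[OF e 2] by (simp add: \<Phi>_def mult_left_mono ennreal_leI)
        next
          case 3
          then have "\<Phi> s = 0" by (simp add: \<Phi>_def logbump_def logbump1_def logbump2_def eta_outside)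
          then show ?thesis by simp
        qed
      qed
      also have "\<dots> \<le> ennreal (32 * pi\<^sup>2 * ln (1 / e) + C')"
        unfolding C'_def using e C(1) by (rule logbump_density_integral)
      finally have le: "(\<integral>\<^sup>+x. ennreal (\<Phi> (x \<bullet> x)) \<partial>(lborel :: (real^4) measure)) \<le> ennreal (32 * pi\<^sup>2 * ln (1 / e) + C')" .
      have "(\<integral>x. \<Phi> (x \<bullet> x) \<partial>(lborel :: (real^4) measure)) = enn2real (\<integral>\<^sup>+x. ennreal (\<Phi> (x \<bullet> x)) \<partial>(lborel :: (real^4) measure))"
        using \<Phi>0 by (intro integral_eq_nn_integral) auto
      also have "\<dots> \<le> 32 * pi\<^sup>2 * ln (1 / e) + C'"
        using le e \<open>C' > 0\<close> by (intro enn2real_leI) auto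
      finally show ?thesis .
    qed
    finally show ?thesis by (simp add: mult_left_mono)
  qed
  ultimately show ?thesis by (rule that)
qed

text \<open>On the ball of radius \<open>e\<close> the logarithm has argument at most
  \<open>2 * e\<^sup>2\<close> and the cut-off is at least \<open>eta (e\<^sup>2)\<close>, so the
  integrand is bounded below by a constant; \<open>pi\<^sup>2 / 2 * e ^ 4\<close> is the volume of
  the ball.\<close>

lemma exp_int_logbump_ge:
  assumes \<alpha>: "\<alpha> > 0" and e: "0 < e" "2 * e\<^sup>2 \<le> 1"
  shows "ennreal ((exp (\<alpha> * (c\<^sup>2 * ((eta (e\<^sup>2))\<^sup>2 * (2 * ln (1 / e) - ln 2)\<^sup>2))) - 1) * (pi\<^sup>2 / 2 * e ^ 4))
    \<le> exp_int \<alpha> (\<lambda>x::real^4. c * logbump e (x \<bullet> x))"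
proof -
  let ?b = "\<alpha> * (c\<^sup>2 * ((eta (e\<^sup>2))\<^sup>2 * (2 * ln (1 / e) - ln 2)\<^sup>2))"
  have b0: "?b \<ge> 0" using \<alpha> by simp
  have "ennreal ((exp ?b - 1) * (pi\<^sup>2 / 2 * e ^ 4)) = ennreal (exp ?b - 1) * emeasure lborel (cball (0::real^4) e)"
  proof -
    have "emeasure lborel (cball (0::real^4) e) = ennreal (pi\<^sup>2 / 2 * e ^ 4)"
      using e by (simp add: emeasure_cball eval_unit_ball_vol)
    moreover have "ennreal ((exp ?b - 1) * (pi\<^sup>2 / 2 * e ^ 4)) = ennreal (exp ?b - 1) * ennreal (pi\<^sup>2 / 2 * e ^ 4)"
      using b0 by (intro ennreal_mult) auto
    ultimately show ?thesis by simp
  qed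
  also have "\<dots> = (\<integral>\<^sup>+x. ennreal (exp ?b - 1) * indicator (cball (0::real^4) e) x \<partial>lborel)"
    by (simp add: nn_integral_cmult_indicator)
  also have "\<dots> \<le> exp_int \<alpha> (\<lambda>x::real^4. c * logbump e (x \<bullet> x))"
    unfolding exp_int_def
  proof (intro nn_integral_mono)
    fix x :: "real^4"
    show "ennreal (exp ?b - 1) * indicator (cball 0 e) x \<le> ennreal (exp (\<alpha> * (c * logbump e (x \<bullet> x))\<^sup>2) - 1)"
    proof (cases "x \<in> cball 0 e")
      case True
      define s where "s = x \<bullet> x"
      have s: "0 \<le> s" "s \<le> e\<^sup>2"
        using True power_mono[of "norm x" e 2] by (auto simp: s_def power2_norm_eq_inner[symmetric])
      have e2: "e\<^sup>2 > 0" "e\<^sup>2 < 1" using e by (auto intro: le_less_trans[of _ "1/2"])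
      have f1: "eta (e\<^sup>2) \<le> eta s" using s e2 by (intro eta_antimono) auto
      have f2: "2 * ln (1 / e) - ln 2 \<le> - ln (s + e\<^sup>2)"
      proof -
        have "s + e\<^sup>2 > 0" using s(1) e2(1) by (rule add_nonneg_pos)
        then have "ln (s + e\<^sup>2) \<le> ln (2 * e\<^sup>2)" using s e2(1) by (subst ln_le_cancel_iff) linarith+
        also have "\<dots> = ln 2 - 2 * ln (1 / e)" using e by (simp add: ln_mult ln_div ln_realpow)
        finally show ?thesis by simp
      qed
      have f3: "2 * ln (1 / e) - ln 2 \<ge> 0"
      proof -
        have "ln (2 * e\<^sup>2) \<le> ln 1" using e by (intro ln_mono) auto
        then show ?thesis using e by (simp add: ln_mult ln_div ln_realpow)
      qed
      have "(eta (e\<^sup>2) * (2 * ln (1 / e) - ln 2))\<^sup>2 \<le> (eta s * (- ln (s + e\<^sup>2)))\<^sup>2"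
        by (intro power_mono mult_mono mult_nonneg_nonneg f1 f2 f3 eta_nonneg)
      also have "\<dots> = (logbump e s)\<^sup>2" by (simp add: logbump_def)
      finally have "(eta (e\<^sup>2) * (2 * ln (1 / e) - ln 2))\<^sup>2 \<le> (logbump e s)\<^sup>2" .
      then have "?b \<le> \<alpha> * (c * logbump e s)\<^sup>2"
        using \<alpha> by (simp add: power_mult_distrib mult_left_mono)
      then show ?thesis using True by (simp add: s_def ennreal_leI)
    qed simp
  qed
  finally show ?thesis .
qed

theorem sup_exp_int_supercritical_infinite:
  assumes \<alpha>: "\<alpha> > 32 * pi\<^sup>2" and \<tau>: "\<tau> > 0" and \<sigma>: "\<sigma> > 0"
  shows "(SUP u\<in>{u::real^4\<Rightarrow>real. u \<in> W22 \<and> energy \<tau> \<sigma> u \<le> 1}. exp_int \<alpha> u) = \<infinity>" (is "?S = _")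
proof -
  obtain C where C: "C > 0" "\<And>e c. 0 < e \<Longrightarrow> e \<le> 1 \<Longrightarrow>
    energy \<tau> \<sigma> (\<lambda>x::real^4. c * logbump e (x \<bullet> x)) \<le> c\<^sup>2 * (32 * pi\<^sup>2 * ln (1 / e) + C)"
    by (rule logbump_energy[OF \<tau> \<sigma>]) (rule that)
  have \<alpha>0: "\<alpha> > 0" using \<alpha> by (rule le_less_trans[rotated]) simp
  \<comment> \<open>For \<open>e = exp (- n)\<close> and the normalised multiple,
    \<open>T n * n\<close> is the exponent in \<open>exp_int_logbump_ge\<close>. Its limit rate
    \<open>4 * \<alpha> / (32 * pi\<^sup>2)\<close> exceeds 4, the rate at which the volume of the
    ball decays, exactly when \<open>\<alpha> > 32 * pi\<^sup>2\<close>.\<close>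
  define T where "T n = \<alpha> * ((eta (exp (- 2 * real n)))\<^sup>2 * (2 - ln 2 / real n)\<^sup>2) / (32 * pi\<^sup>2 + C / real n)" for n
  have "T \<longlonglongrightarrow> \<alpha> * (1\<^sup>2 * (2 - 0)\<^sup>2) / (32 * pi\<^sup>2 + 0)"
    unfolding T_def
  proof (intro tendsto_intros lim_const_over_n)
    have "(\<lambda>n. exp (- 2) ^ n) \<longlonglongrightarrow> (0::real)" by (intro LIMSEQ_power_zero) auto
    then have "(\<lambda>n. exp (- 2 * real n)) \<longlonglongrightarrow> 0"
      by (simp add: exp_of_nat_mult[symmetric] mult.commute)
    then have "(\<lambda>n. eta (exp (- 2 * real n))) \<longlonglongrightarrow> eta 0"
      using isCont_tendsto_compose[of 0 eta] eta_continuous(1)[of UNIV]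
      by (simp add: continuous_on_eq_continuous_at)
    then show "(\<lambda>n. eta (exp (- 2 * real n))) \<longlonglongrightarrow> 1" by (simp add: eta_0)
  qed auto
  moreover define \<delta> where "\<delta> = \<alpha> * 4 / (32 * pi\<^sup>2) - 4"
  have \<delta>: "\<delta> > 0" using \<alpha> by (simp add: \<delta>_def field_simps)
  moreover have "4 + \<delta> / 2 < \<alpha> * (1\<^sup>2 * (2 - 0)\<^sup>2) / (32 * pi\<^sup>2 + 0)"
  proof -
    have eq: "\<alpha> * (1\<^sup>2 * (2 - 0)\<^sup>2) / (32 * pi\<^sup>2 + 0) = 4 + \<delta>" by (simp add: \<delta>_def)
    show ?thesis unfolding eq using \<delta> by simp
  qed
  ultimately have "eventually (\<lambda>n. T n > 4 + \<delta> / 2) sequentially"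
    by (intro order_tendstoD(1))
  then obtain N where N: "\<And>n. n \<ge> N \<Longrightarrow> T n > 4 + \<delta> / 2"
    by (auto simp: eventually_sequentially)
  have lower: "ennreal (pi\<^sup>2 / 2 * (\<delta> / 2 * real n)) \<le> ?S" if n: "n \<ge> N" "n \<ge> 1" for n
  proof -
    define e where "e = exp (- real n)"
    have e: "0 < e" "e \<le> 1" by (auto simp: e_def)
    have e2: "e\<^sup>2 = exp (- 2 * real n)" by (simp add: e_def exp_double[symmetric] flip: power2_eq_square)
    have e21: "2 * e\<^sup>2 \<le> 1"
    proof -
      have "exp (- 2 * real n) \<le> exp (- 1)" using n by simp
      also have "exp (- 1 :: real) \<le> 1 / 2" using exp_ge_add_one_self[of "1::real"] by (simp add: exp_minus field_simps)
      finally show ?thesis by (simp add: e2)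
    qed
    have ln: "ln (1 / e) = real n" by (simp add: e_def ln_div)
    define P where "P = 32 * pi\<^sup>2 * real n + C"
    have P: "P > 0" using C by (simp add: P_def add_nonneg_pos)
    \<comment> \<open>\<open>P\<close> is the energy bound for the unscaled function, so this
      multiple has energy at most 1.\<close>
    define c where "c = 1 / sqrt P"
    have c2: "c\<^sup>2 = 1 / P" using P by (simp add: c_def power_divide)
    let ?u = "\<lambda>x::real^4. c * logbump e (x \<bullet> x)"
    have "test_fun ?u" using test_fun_logbump[OF e(1), of c "0::real^4"] by simp
    then have "?u \<in> W22" by (rule test_fun_W22)
    moreover have "energy \<tau> \<sigma> ?u \<le> 1"
      using C(2)[OF e, of c] P by (simp add: ln c2 P_def[symmetric])
    ultimately have "exp_int \<alpha> ?u \<le> ?S" by (intro SUP_upper) auto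
    have "\<alpha> * (c\<^sup>2 * ((eta (e\<^sup>2))\<^sup>2 * (2 * ln (1 / e) - ln 2)\<^sup>2)) = T n * real n"
    proof -
      have a: "2 * real n - ln 2 = real n * (2 - ln 2 / real n)" using n by (simp add: field_simps)
      have b: "P = real n * (32 * pi\<^sup>2 + C / real n)" using n by (simp add: P_def field_simps)
      show ?thesis
        unfolding c2 ln a b T_def e2 using n by (simp add: power_mult_distrib power2_eq_square)
    qed
    moreover have "(4 + \<delta> / 2) * real n \<le> T n * real n"
      using N[OF n(1)] by (intro mult_right_mono) auto
    ultimately have b: "(4 + \<delta> / 2) * real n \<le> \<alpha> * (c\<^sup>2 * ((eta (e\<^sup>2))\<^sup>2 * (2 * ln (1 / e) - ln 2)\<^sup>2))" by simp
    \<comment> \<open>Of the exponent, \<open>4 * n\<close> cancels the volume factor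
      \<open>e ^ 4 = exp (- 4 * n)\<close>; the surplus \<open>\<delta> / 2 * n\<close> is weakened
      to linear growth, which already makes the supremum infinite.\<close>
    have "\<delta> / 2 * real n \<le> exp (\<delta> / 2 * real n) - 1"
      using exp_ge_add_one_self[of "\<delta> / 2 * real n"] by linarith
    also have "\<dots> \<le> exp (\<delta> / 2 * real n) - exp (- 4 * real n)" by simp
    also have "\<dots> = (exp ((4 + \<delta> / 2) * real n) - 1) * exp (- 4 * real n)"
      by (simp add: left_diff_distrib exp_add[symmetric] algebra_simps)
    also have "\<dots> \<le> (exp (\<alpha> * (c\<^sup>2 * ((eta (e\<^sup>2))\<^sup>2 * (2 * ln (1 / e) - ln 2)\<^sup>2))) - 1) * exp (- 4 * real n)"
      using b by (intro mult_right_mono) auto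
    also have "exp (- 4 * real n) = e ^ 4"
      by (simp add: e_def exp_of_nat_mult[symmetric])
    finally have "pi\<^sup>2 / 2 * (\<delta> / 2 * real n) \<le> (exp (\<alpha> * (c\<^sup>2 * ((eta (e\<^sup>2))\<^sup>2 * (2 * ln (1 / e) - ln 2)\<^sup>2))) - 1) * (pi\<^sup>2 / 2 * e ^ 4)"
      using mult_left_mono[of _ _ "pi\<^sup>2 / 2"] by (simp add: mult_ac)
    then have "ennreal (pi\<^sup>2 / 2 * (\<delta> / 2 * real n)) \<le> exp_int \<alpha> ?u"
      using exp_int_logbump_ge[OF \<alpha>0 e(1) e21, of c] by (meson ennreal_leI order_trans)
    also have "\<dots> \<le> ?S" by fact
    finally show ?thesis .
  qed
  show ?thesis
  proof (cases ?S)
    case (real r)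
    define k where "k = pi\<^sup>2 / 2 * (\<delta> / 2)"
    have k: "k > 0" using \<delta> by (simp add: k_def)
    obtain n where n: "real n > r / k" using reals_Archimedean2 by blast
    define n' where "n' = max n (max N 1)"
    have "k * real n' \<le> r"
      using lower[of n'] real by (simp add: n'_def k_def mult.assoc)
    moreover have "r < k * real n'"
    proof -
      have "r < k * real n" using n k by (simp add: field_simps)
      also have "\<dots> \<le> k * real n'" using k by (simp add: n'_def)
      finally show ?thesis .
    qed
    ultimately show ?thesis by simp
  qed simp
qed

theorem theorem1p2:
  shows "(\<forall>\<alpha>>0. \<forall>u::real^4\<Rightarrow>real. u \<in> W22 \<longrightarrow> exp_int \<alpha> u < \<infinity>)
     \<and> (\<forall>\<tau>>0. \<forall>\<sigma>>0.
          (SUP u\<in>{u::real^4\<Rightarrow>real. u \<in> W22 \<and> energy \<tau> \<sigma> u \<le> 1}. exp_int (32 * pi\<^sup>2) u) < \<infinity>)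
     \<and> (\<forall>\<alpha>>32 * pi\<^sup>2. \<forall>\<tau>>0. \<forall>\<sigma>>0.
          (SUP u\<in>{u::real^4\<Rightarrow>real. u \<in> W22 \<and> energy \<tau> \<sigma> u \<le> 1}. exp_int \<alpha> u) = \<infinity>)"
  by (intro conjI allI impI single_exp_int_finite sup_exp_int_critical_finite sup_exp_int_supercritical_infinite)

end
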